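(* Fix a dimension $d\ge 1$ and let $N=n^d$, $n\in\mathbb N$. There exist a sequence $N\mapsto T^*(N)$ with $\lim_{N\to\infty}T^*(N)=\infty$ and, for each $N$, a coupling (a joint realization on one probability space) of the stationary slowed-down random stirring process $t\mapsto\eta^N(t)\in\Sigma^N$ on the torus $\mathbb T^N$ and the stationary discrete split-and-merge process $t\mapsto\zeta^N(t)\in\Omega^N$, with $\eta^N(0)\sim\mu^N$ and $\zeta^N(0)=\xi^N(0)$, where $\xi^N(t):=\mathbf p(\eta^N(t))$, such that for every $\delta>0$ $$\lim_{N\to\infty}\mathbf P\Big(\max_{0\le t\le T^*(N)} d\big(\xi^N(t),\zeta^N(t)\big)>\delta\Big)=0 .$$ (The two marginal processes are stationary; the coupled pair need not be.)
   Context: **Partitions.** $\Omega=\{\mathbf p=(p_i)_{i\ge1}: p_i\in[0,1],\ p_1\ge p_2\ge\dots\ge0,\ \sum_i p_i=1\}$ with the $\ell^1$-metric $d(\mathbf p,\mathbf p')=\sum_i|p_i-p_i'|$. $\Omega^N\subset\Omega$ is the set of those $\mathbf p\in\Omega$ for which every $Np_i$ is a non-negative integer. **Permutations.** $\Sigma^N$ is the group of all permutations of $N$ elements (here the vertices of $\mathbb T^N$), $\mu^N$ the uniform distribution on $\Sigma^N$. For $\sigma\in\Sigma^N$, $\mathbf p(\sigma)\in\Omega^N$ is the sequence of cycle lengths of $\sigma$ (fixed points are cycles of length 1) divided by $N$, listed in decreasing order and padded with zeros. $\pi^N$ is the law of $\mathbf p(\sigma)$ for $\sigma\sim\mu^N$.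 **Random stirring.** $\mathbb T^N=(\mathbb Z/n\mathbb Z)^d$ is the discrete torus with $N=n^d$ vertices, and $\mathbb B^N$ its set of unoriented nearest-neighbour edges, with $n\ge3$ so that $|\mathbb B^N|=dN$. For $\mathsf b\in\mathbb B^N$, $\tau_{\mathsf b}$ is the transposition of the two endpoints of $\mathsf b$. The slowed-down random stirring $\eta^N$ is the continuous-time Markov jump process on $\Sigma^N$ which jumps from $\sigma$ to $\tau_{\mathsf b}\sigma$ at rate $1/(dN)$ for each $\mathsf b\in\mathbb B^N$ (total jump rate 1). It is stationary when started from $\mu^N$. **Discrete split-and-merge.** For $i<j$, $\mathsf M_{ij}\mathbf p$ is obtained from $\mathbf p$ by replacing the entries $p_i,p_j$ by the single entry $p_i+p_j$ and rearranging in decreasing order; for $u\in[0,1)$, $\mathsf S_i^u\mathbf p$ is obtained by replacing $p_i$ by the two entries $up_i,(1-u)p_i$ and rearranging in decreasing order. $\zeta^N$ is the continuous-time Markov jump process on $\Omega^N$ with generator $$\mathcal G^Nf(\mathbf p)=\frac{2N}{N-1}\sum_{i<j}p_ip_j\big(f(\mathsf M_{ij}\mathbf p)-f(\mathbf p)\big)+\frac1{N-1}\sum_i p_i\sum_{k=1}^{Np_i-1}\big(f(\mathsf S_i^{k/(Np_i)}\mathbf p)-f(\mathbf p)\big).$$ It is stationary when started from $\pi^N$. All processes are taken piecewise constant and right-continuous with left limits. *)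

theory Defs
  imports "HOL-Probability.Probability" "HOL-Combinatorics.Combinatorics"
begin

section \<open>Markov jump processes on a finite state space\<close>

text \<open>The semigroup \<open>P\<^sub>t = exp (t G)\<close> of a bounded generator, as an exponential series.\<close>

definition semigroup_of :: "(('a \<Rightarrow> real) \<Rightarrow> 'a \<Rightarrow> real) \<Rightarrow> real \<Rightarrow> ('a \<Rightarrow> real) \<Rightarrow> 'a \<Rightarrow> real" where
  "semigroup_of G t f x = (\<Sum>k. t ^ k / fact k * (G ^^ k) f x)"

text \<open>Right-continuity and existence of left limits in the discrete topology of the state space;
  equivalently, piecewise constant and right-continuous with finitely many jumps in every compact
  time interval.\<close>

definition jump_path :: "(real \<Rightarrow> 'a) \<Rightarrow> bool" where
  "jump_path w \<longleftrightarrow>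
     (\<forall>t\<ge>0. \<exists>e>0. \<forall>s\<in>{t..<t + e}. w s = w t) \<and>
     (\<forall>t>0. \<exists>e>0. \<exists>a. \<forall>s\<in>{t - e<..<t}. 0 \<le> s \<longrightarrow> w s = a)"

text \<open>The last clause is the Markov property with respect to the process's own past,
  with transition probabilities \<open>P\<^sub>t(a, b) = exp (t G) 1\<^sub>b (a)\<close>.\<close>

definition markov_jump_process ::
  "'w measure \<Rightarrow> 'a set \<Rightarrow> (('a \<Rightarrow> real) \<Rightarrow> 'a \<Rightarrow> real) \<Rightarrow> (real \<Rightarrow> 'w \<Rightarrow> 'a) \<Rightarrow> bool" where
  "markov_jump_process M S G X \<longleftrightarrow>
     prob_space M \<and> finite S \<and>
     (\<forall>t\<ge>0. X t \<in> M \<rightarrow>\<^sub>M count_space S) \<and>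
     (\<forall>\<omega>\<in>space M. jump_path (\<lambda>t. X t \<omega>)) \<and>
     (\<forall>(m::nat) (\<tau> :: nat \<Rightarrow> real) (a :: nat \<Rightarrow> 'a) t b.
        0 \<le> \<tau> 0 \<longrightarrow> mono_on {..m} \<tau> \<longrightarrow> (\<forall>i\<le>m. a i \<in> S) \<longrightarrow> 0 \<le> t \<longrightarrow> b \<in> S \<longrightarrow>
        \<P>(\<omega> in M. (\<forall>i\<le>m. X (\<tau> i) \<omega> = a i) \<and> X (\<tau> m + t) \<omega> = b) =
        \<P>(\<omega> in M. \<forall>i\<le>m. X (\<tau> i) \<omega> = a i) * semigroup_of G t (indicator {b}) (a m))"

definition stationary_process :: "'w measure \<Rightarrow> 'a set \<Rightarrow> (real \<Rightarrow> 'w \<Rightarrow> 'a) \<Rightarrow> bool" where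
  "stationary_process M S X \<longleftrightarrow>
     (\<forall>(m::nat) (\<tau> :: nat \<Rightarrow> real) (a :: nat \<Rightarrow> 'a) s.
        (\<forall>i<m. 0 \<le> \<tau> i \<and> a i \<in> S) \<longrightarrow> 0 \<le> s \<longrightarrow>
        \<P>(\<omega> in M. \<forall>i<m. X (\<tau> i + s) \<omega> = a i) = \<P>(\<omega> in M. \<forall>i<m. X (\<tau> i) \<omega> = a i))"

definition stationary_markov_jump_process ::
  "'w measure \<Rightarrow> 'a set \<Rightarrow> (('a \<Rightarrow> real) \<Rightarrow> 'a \<Rightarrow> real) \<Rightarrow> 'a measure \<Rightarrow> (real \<Rightarrow> 'w \<Rightarrow> 'a) \<Rightarrow> bool" where
  "stationary_markov_jump_process M S G \<nu> X \<longleftrightarrow>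
     markov_jump_process M S G X \<and>
     distr M (count_space S) (X 0) = \<nu> \<and>
     stationary_process M S X"


section \<open>Partitions\<close>

text \<open>Sequences are indexed from 0.\<close>

definition partitions :: "(nat \<Rightarrow> real) set" where
  "partitions = {p. (\<forall>i. 0 \<le> p i \<and> p i \<le> 1) \<and> antimono p \<and> p sums 1}"

definition disc_partitions :: "nat \<Rightarrow> (nat \<Rightarrow> real) set" where
  "disc_partitions N = {p \<in> partitions. \<forall>i. real N * p i \<in> \<nat>}"

definition l1_dist :: "(nat \<Rightarrow> real) \<Rightarrow> (nat \<Rightarrow> real) \<Rightarrow> real" where
  "l1_dist p q = (\<Sum>i. \<bar>p i - q i\<bar>)"

text \<open>Decreasing rearrangement of a nonnegative sequence tending to 0. Only the nonzero entries are
  matched up, since zeros are mere padding (a sequence with infinitely many positive entries loses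
  all its zeros).\<close>

definition decr_rearr :: "(nat \<Rightarrow> real) \<Rightarrow> nat \<Rightarrow> real" where
  "decr_rearr q = (THE r. antimono r \<and>
     (\<exists>\<phi>. bij_betw \<phi> {i. r i \<noteq> 0} {i. q i \<noteq> 0} \<and> (\<forall>i. r i \<noteq> 0 \<longrightarrow> r i = q (\<phi> i))))"

definition merge_entries :: "nat \<Rightarrow> nat \<Rightarrow> (nat \<Rightarrow> real) \<Rightarrow> nat \<Rightarrow> real" where
  "merge_entries i j p = decr_rearr (p(i := p i + p j, j := 0))"

definition split_entry :: "nat \<Rightarrow> real \<Rightarrow> (nat \<Rightarrow> real) \<Rightarrow> nat \<Rightarrow> real" where
  "split_entry i u p = decr_rearr (case_nat ((1 - u) * p i) (p(i := u * p i)))"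

text \<open>For \<open>p \<in> disc_partitions N\<close> all but finitely many terms of both infinite sums vanish.\<close>

definition split_merge_gen ::
  "nat \<Rightarrow> ((nat \<Rightarrow> real) \<Rightarrow> real) \<Rightarrow> (nat \<Rightarrow> real) \<Rightarrow> real" where
  "split_merge_gen N f p =
     2 * real N / (real N - 1) *
       (\<Sum>\<^sub>\<infinity>(i, j)\<in>{(i, j). i < j}. p i * p j * (f (merge_entries i j p) - f p)) +
     1 / (real N - 1) *
       (\<Sum>\<^sub>\<infinity>i. p i * (\<Sum>k\<in>{k::nat. 1 \<le> k \<and> real k \<le> real N * p i - 1}.
          f (split_entry i (real k / (real N * p i)) p) - f p))"


section \<open>Random stirring on the discrete torus\<close>

text \<open>The torus \<open>(\<int>/n\<int>)\<^sup>d\<close>, with residues represented by \<open>0, \<dots>, n - 1\<close>.\<close>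

definition torus :: "nat \<Rightarrow> nat \<Rightarrow> (nat \<Rightarrow> nat) set" where
  "torus d n = {..<d} \<rightarrow>\<^sub>E {..<n}"

definition torus_edges :: "nat \<Rightarrow> nat \<Rightarrow> (nat \<Rightarrow> nat) set set" where
  "torus_edges d n = {{x, x(i := (x i + 1) mod n)} | x i. x \<in> torus d n \<and> i < d}"

definition edge_swap :: "'v set \<Rightarrow> 'v \<Rightarrow> 'v" where
  "edge_swap e = (THE \<tau>. \<exists>x y. e = {x, y} \<and> \<tau> = Transposition.transpose x y)"

definition perms_on :: "'v set \<Rightarrow> ('v \<Rightarrow> 'v) set" where
  "perms_on V = {\<sigma>. \<sigma> permutes V}"

definition stirring_gen ::
  "nat \<Rightarrow> nat \<Rightarrow> (((nat \<Rightarrow> nat) \<Rightarrow> (nat \<Rightarrow> nat)) \<Rightarrow> real) \<Rightarrow> ((nat \<Rightarrow> nat) \<Rightarrow> (nat \<Rightarrow> nat)) \<Rightarrow> real" where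
  "stirring_gen d n f \<sigma> =
     (\<Sum>b\<in>torus_edges d n. 1 / real (d * n ^ d) * (f (edge_swap b \<circ> \<sigma>) - f \<sigma>))"

definition cycle_lengths :: "'v set \<Rightarrow> ('v \<Rightarrow> 'v) \<Rightarrow> nat list" where
  "cycle_lengths V \<sigma> =
     rev (sorted_list_of_multiset (image_mset card (mset_set (orbit \<sigma> ` V))))"

definition cycle_partition :: "'v set \<Rightarrow> ('v \<Rightarrow> 'v) \<Rightarrow> nat \<Rightarrow> real" where
  "cycle_partition V \<sigma> i =
     (if i < length (cycle_lengths V \<sigma>) then real (cycle_lengths V \<sigma> ! i) / real (card V) else 0)"

definition cycle_law :: "'v set \<Rightarrow> (nat \<Rightarrow> real) measure" where
  "cycle_law V =
     distr (uniform_count_measure (perms_on V)) (count_space (disc_partitions (card V)))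
       (cycle_partition V)"

end

theory Submission imports Defs begin

text \<open>
  The discrete split-and-merge process is the cycle-type projection of the random transposition walk.
  If \<open>x \<noteq> y\<close> is a uniformly chosen ordered pair of vertices, then multiplying \<open>\<sigma>\<close> by the transposition of
  \<open>x\<close> and \<open>y\<close> merges the cycles of \<open>x\<close> and \<open>y\<close> when these are different, and otherwise cuts the common
  cycle, of length \<open>m\<close>, into cycles of lengths \<open>k\<close> and \<open>m - k\<close> with \<open>k\<close> uniform on \<open>{1..<m}\<close>. These are
  exactly the rates of the split-and-merge generator (\<open>split_merge_gen_cycle_partition\<close>). Hence
  \<open>\<zeta>\<close> may be realized as \<open>p(\<theta>)\<close>, where \<open>\<theta>\<close> jumps at rate 1 by a transposition chosen uniformly
  among all pairs of vertices, while \<open>\<eta>\<close> jumps at rate 1 by a transposition chosen uniformly among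
  the edges of the torus.

  Over a bounded number \<open>K\<close> of jumps the geometry of the torus is invisible to cycle lengths. Let
  \<open>\<eta>\<close> start at a uniform \<open>\<sigma>\<close> and use edges \<open>b\<^sub>1, b\<^sub>2, \<dots>\<close>, let \<open>c\<^sub>1, c\<^sub>2, \<dots>\<close> be the pairs used by \<open>\<theta>\<close>,
  and take \<open>\<sigma>\<close>, the \<open>b\<^sub>i\<close>, the \<open>c\<^sub>i\<close> and the common jump times all independent. When \<open>b\<^sub>1, \<dots>, b\<^sub>K\<close> are pairwise
  disjoint and so are \<open>c\<^sub>1, \<dots>, c\<^sub>K\<close>, some permutation \<open>\<pi>\<close> of the vertices carries \<open>b\<^sub>i\<close> to \<open>c\<^sub>i\<close> for all
  \<open>i \<le> K\<close> (\<open>align_disjoint_pairs\<close>). Choose such a \<open>\<pi>\<close> whenever one exists and the identity otherwise. Start \<open>\<theta>\<close> at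
  \<open>\<pi> \<circ> \<sigma> \<circ> \<pi>\<^sup>-\<^sup>1\<close>. Conjugation by a fixed permutation preserves the uniform law, and \<open>\<sigma>\<close> is independent of
  everything that determines \<open>\<pi>\<close>, so \<open>\<theta>\<close> still starts uniformly and independently of its jumps
  (\<open>realign_measure_preserving\<close>): both marginals are the right stationary processes. On the event of
  disjointness \<open>\<theta>\<close> is the conjugate of \<open>\<eta>\<close> by \<open>\<pi>\<close> during the first \<open>K\<close> jumps, so the two cycle
  partitions coincide and the distance is 0 (\<open>cycle_partition_coupled\<close>).

  For given \<open>i \<noteq> j\<close>, the edges \<open>b\<^sub>i\<close> and \<open>b\<^sub>j\<close> share a vertex with probability at most \<open>4 / N\<close>, likewise for the
  pairs \<open>c\<^sub>i\<close> and \<open>c\<^sub>j\<close>, and more than \<open>K\<close> jumps occur before time \<open>T\<close> with probability at most \<open>T / (K + 1)\<close>. The coupling therefore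
  fails before \<open>T\<close> with probability at most \<open>T / (K + 1) + 8 K\<^sup>2 / N\<close> (\<open>measure_uncoupled\<close>). With
  \<open>T = N\<^bsup>1/6\<^esup>\<close> and \<open>K = \<lfloor>N\<^bsup>1/3\<^esup>\<rfloor>\<close> this tends to 0 while \<open>T\<close> tends to infinity.

  The jump processes are built from a stream of independent exponential gaps with independent uniform
  marks. The one probabilistic fact behind both the Markov property and stationarity is that, at a
  fixed time \<open>t\<close>, the stream of remaining gaps and marks has the original law and is independent of
  the number of jumps and the state at time \<open>t\<close> (\<open>emeasure_count_run_residual\<close>).
\<close>

section \<open>Cycles of a permutation multiplied by a transposition\<close>

text \<open>As long as the \<open>\<sigma>\<close>-path from \<open>u\<close> avoids \<open>x\<close> and \<open>y\<close>, the transposition has no effect on it; it acts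
  for the first time at the step that reaches \<open>{x, y}\<close>.\<close>

lemma funpow_transpose_comp:
  fixes \<sigma> :: "'v \<Rightarrow> 'v"
  assumes "\<And>j. 0 < j \<Longrightarrow> j < l \<Longrightarrow> (\<sigma> ^^ j) u \<noteq> x \<and> (\<sigma> ^^ j) u \<noteq> y" "0 < l"
  shows "j < l \<Longrightarrow> ((Transposition.transpose x y \<circ> \<sigma>) ^^ j) u = (\<sigma> ^^ j) u"
    and "((Transposition.transpose x y \<circ> \<sigma>) ^^ l) u = Transposition.transpose x y ((\<sigma> ^^ l) u)"
proof -
  have *: "j < l \<Longrightarrow> ((Transposition.transpose x y \<circ> \<sigma>) ^^ j) u = (\<sigma> ^^ j) u" for j
  proof (induction j)
    case (Suc j)
    then have "\<sigma> ((\<sigma> ^^ j) u) \<noteq> x \<and> \<sigma> ((\<sigma> ^^ j) u) \<noteq> y" using assms(1)[of "Suc j"] by simp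
    then have "(Transposition.transpose x y \<circ> \<sigma>) ((\<sigma> ^^ j) u) = \<sigma> ((\<sigma> ^^ j) u)"
      by (simp add: transpose_apply_other)
    with Suc show ?case by (simp add: funpow.simps(2) del: o_apply) (simp add: o_apply)
  qed simp
  then show "j < l \<Longrightarrow> ((Transposition.transpose x y \<circ> \<sigma>) ^^ j) u = (\<sigma> ^^ j) u" .
  obtain k where l: "l = Suc k" using \<open>0 < l\<close> by (cases l) auto
  show "((Transposition.transpose x y \<circ> \<sigma>) ^^ l) u = Transposition.transpose x y ((\<sigma> ^^ l) u)"
    using *[of k] by (simp add: l)
qed

lemma orbit_funpow_enum:
  assumes "permutation \<sigma>"
  shows "bij_betw (\<lambda>j. (\<sigma> ^^ j) x) {..<card (orbit \<sigma> x)} (orbit \<sigma> x)"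
    and "(\<sigma> ^^ card (orbit \<sigma> x)) x = x" and "0 < card (orbit \<sigma> x)"
proof -
  have x: "x \<in> orbit \<sigma> x" using assms by (rule permutation_self_in_orbit)
  let ?m = "funpow_dist1 \<sigma> x x"
  have inj: "inj_on (\<lambda>j. (\<sigma> ^^ j) x) {0..<?m}" by (rule inj_on_funpow_dist1[OF x])
  have im: "orbit \<sigma> x = (\<lambda>j. (\<sigma> ^^ j) x) ` {0..<?m}" by (rule orbit_conv_funpow_dist1[OF x])
  have card: "card (orbit \<sigma> x) = ?m" unfolding im using card_image[OF inj] by simp
  show "0 < card (orbit \<sigma> x)" unfolding card by simp
  show "(\<sigma> ^^ card (orbit \<sigma> x)) x = x" unfolding card by (rule funpow_dist1_prop[OF x])
  show "bij_betw (\<lambda>j. (\<sigma> ^^ j) x) {..<card (orbit \<sigma> x)} (orbit \<sigma> x)"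
    using inj im unfolding card bij_betw_def by (auto simp: atLeast0LessThan)
qed

lemma orbit_transpose_other:
  assumes "permutation \<sigma>" "x \<notin> orbit \<sigma> z" "y \<notin> orbit \<sigma> z"
  shows "orbit (Transposition.transpose x y \<circ> \<sigma>) z = orbit \<sigma> z"
proof (rule orbit_cong)
  show "z \<in> orbit \<sigma> z" using assms by (intro permutation_self_in_orbit)
  fix s assume "s \<in> orbit \<sigma> z"
  then have "\<sigma> s \<in> orbit \<sigma> z" by (rule orbit.step)
  then have "\<sigma> s \<noteq> x" "\<sigma> s \<noteq> y" using assms by auto
  then show "(Transposition.transpose x y \<circ> \<sigma>) s = \<sigma> s" by (simp add: transpose_apply_other)
qed

text \<open>Let \<open>y = \<sigma>\<^sup>k x\<close>. Under the product, the path from \<open>x\<close> runs along the cycle up to the predecessor of \<open>y\<close>,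
  where the transposition sends it back to \<open>x\<close>; the path from \<open>y\<close> closes up in the same way at the
  predecessor of \<open>x\<close>.\<close>

lemma orbit_transpose_split:
  assumes \<sigma>: "permutation \<sigma>" and k: "0 < k" "k < card (orbit \<sigma> x)"
  defines "y \<equiv> (\<sigma> ^^ k) x"
  shows "orbit (Transposition.transpose x y \<circ> \<sigma>) x = (\<lambda>j. (\<sigma> ^^ j) x) ` {..<k}"
    and "orbit (Transposition.transpose x y \<circ> \<sigma>) y = (\<lambda>j. (\<sigma> ^^ j) x) ` {k..<card (orbit \<sigma> x)}"
proof -
  define m where "m = card (orbit \<sigma> x)"
  note en = orbit_funpow_enum[OF \<sigma>, of x, folded m_def]
  have inj: "i < m \<Longrightarrow> j < m \<Longrightarrow> (\<sigma> ^^ i) x = (\<sigma> ^^ j) x \<longleftrightarrow> i = j" for i j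
    using en(1) by (auto simp: bij_betw_def inj_on_def)
  have km: "k < m" using k by (simp add: m_def)
  have ne: "(\<sigma> ^^ j) x \<noteq> x \<and> (\<sigma> ^^ j) x \<noteq> y" if "0 < j" "j < m" "j \<noteq> k" for j
    using inj[of j 0] inj[of j k] that km by (auto simp: y_def)
  let ?\<rho> = "Transposition.transpose x y \<circ> \<sigma>"
  have 1: "j < k \<Longrightarrow> (?\<rho> ^^ j) x = (\<sigma> ^^ j) x" for j
    using ne km k(1) by (intro funpow_transpose_comp) auto
  have "(?\<rho> ^^ k) x = Transposition.transpose x y ((\<sigma> ^^ k) x)"
    using ne km k(1) by (intro funpow_transpose_comp) auto
  then have "(?\<rho> ^^ k) x = x" by (simp add: y_def)
  from orbit_altdef_bounded[OF this k(1)] 1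
  show "orbit ?\<rho> x = (\<lambda>j. (\<sigma> ^^ j) x) ` {..<k}" 
  proof -
    have "(\<lambda>j. (?\<rho> ^^ j) x) ` {..<k} = (\<lambda>j. (\<sigma> ^^ j) x) ` {..<k}" using 1 by (intro image_cong) auto
    then show ?thesis using \<open>orbit ?\<rho> x = {(?\<rho> ^^ m) x |m. m < k}\<close> by auto
  qed
  have pow: "(\<sigma> ^^ j) y = (\<sigma> ^^ (j + k)) x" for j by (simp add: y_def funpow_add)
  have neq: "(\<sigma> ^^ j) y \<noteq> x \<and> (\<sigma> ^^ j) y \<noteq> y" if "0 < j" "j < m - k" for j
    unfolding pow using that by (intro ne) auto
  have 2: "j < m - k \<Longrightarrow> (?\<rho> ^^ j) y = (\<sigma> ^^ j) y" for j
    using neq km k(1) by (intro funpow_transpose_comp) auto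
  have "(?\<rho> ^^ (m - k)) y = Transposition.transpose x y ((\<sigma> ^^ (m - k)) y)"
    using neq km k(1) by (intro funpow_transpose_comp) auto
  also have "(\<sigma> ^^ (m - k)) y = x" unfolding pow using km en(2) by simp
  also have "Transposition.transpose x y x = y" by simp
  finally have "(?\<rho> ^^ (m - k)) y = y" .
  from orbit_altdef_bounded[OF this] km
  have "orbit ?\<rho> y = {(?\<rho> ^^ j) y |j. j < m - k}" by simp
  also have "\<dots> = {(\<sigma> ^^ (j + k)) x |j. j < m - k}"
  proof -
    have "j < m - k \<Longrightarrow> (?\<rho> ^^ j) y = (\<sigma> ^^ (j + k)) x" for j by (simp only: 2 pow)
    then have "(\<lambda>j. (?\<rho> ^^ j) y) ` {..<m - k} = (\<lambda>j. (\<sigma> ^^ (j + k)) x) ` {..<m - k}"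
      by (intro image_cong) auto
    then show ?thesis by (simp add: image_def Bex_def conj_commute)
  qed
  also have "\<dots> = (\<lambda>j. (\<sigma> ^^ j) x) ` {k..<m}"
  proof -
    have "(\<lambda>j. j + k) ` {..<m - k} = {k..<m}"
      using km image_add_atLeastLessThan'[of k 0 "m - k"] by (simp add: atLeast0LessThan)
    moreover have "(\<lambda>j. (\<sigma> ^^ j) x) ` (\<lambda>j. j + k) ` {..<m - k} = (\<lambda>j. (\<sigma> ^^ (j + k)) x) ` {..<m - k}"
      by (rule image_image)
    ultimately have "(\<lambda>j. (\<sigma> ^^ j) x) ` {k..<m} = (\<lambda>j. (\<sigma> ^^ (j + k)) x) ` {..<m - k}"
      by simp
    then show ?thesis by (simp add: image_def Bex_def conj_commute)
  qed
  finally show "orbit ?\<rho> y = (\<lambda>j. (\<sigma> ^^ j) x) ` {k..<card (orbit \<sigma> x)}" by (simp add: m_def)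
qed

text \<open>The path from \<open>x\<close> follows its old cycle once around and is sent to \<open>y\<close> instead of closing up.\<close>

lemma mem_orbit_transpose_merge:
  assumes \<sigma>: "permutation \<sigma>" and y: "y \<notin> orbit \<sigma> x"
  shows "y \<in> orbit (Transposition.transpose x y \<circ> \<sigma>) x"
proof -
  define m where "m = card (orbit \<sigma> x)"
  note en = orbit_funpow_enum[OF \<sigma>, of x, folded m_def]
  have "(\<sigma> ^^ j) x \<noteq> x \<and> (\<sigma> ^^ j) x \<noteq> y" if "0 < j" "j < m" for j
  proof
    show "(\<sigma> ^^ j) x \<noteq> x" 
      using inj_onD[OF bij_betw_imp_inj_on[OF en(1)], of j 0] that by auto
    show "(\<sigma> ^^ j) x \<noteq> y" using y that by (auto simp: orbit_altdef)
  qed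
  then have "((Transposition.transpose x y \<circ> \<sigma>) ^^ m) x = Transposition.transpose x y ((\<sigma> ^^ m) x)"
    using en(3) by (intro funpow_transpose_comp) auto
  then have "((Transposition.transpose x y \<circ> \<sigma>) ^^ m) x = y" using en(2) by simp
  then show ?thesis using en(3) unfolding orbit_altdef by (intro CollectI exI[of _ m]) simp
qed

definition cycle_type :: "'v set \<Rightarrow> ('v \<Rightarrow> 'v) \<Rightarrow> nat multiset" where
  "cycle_type V \<sigma> = image_mset card (mset_set (orbit \<sigma> ` V))"

lemma permutes_transpose_comp:
  assumes "\<sigma> permutes V" "x \<in> V" "y \<in> V"
  shows "Transposition.transpose x y \<circ> \<sigma> permutes V"
  using assms by (intro permutes_compose permutes_swap_id)

lemma orbits_disjoint:
  assumes "permutation \<sigma>" "x \<notin> orbit \<sigma> z"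
  shows "orbit \<sigma> x \<inter> orbit \<sigma> z = {}"
proof (rule ccontr)
  assume "orbit \<sigma> x \<inter> orbit \<sigma> z \<noteq> {}"
  then obtain w where w: "w \<in> orbit \<sigma> x" "w \<in> orbit \<sigma> z" by auto
  note eq = orbit_cyclic_eq3[OF cyclic_on_orbit'[OF assms(1)]]
  have "orbit \<sigma> x = orbit \<sigma> z" using eq[OF w(1)] eq[OF w(2)] by simp
  then show False using assms permutation_self_in_orbit[OF assms(1), of x] by simp
qed

text \<open>Only the cycle of \<open>x\<close> changes: it is cut into the two arcs described above, and every cycle that contains
  neither \<open>x\<close> nor \<open>y\<close> is kept. The equation is written additively because truncated multiset subtraction is
  awkward to calculate with.\<close>

lemma cycle_type_split:
  assumes "finite V" "\<sigma> permutes V" "x \<in> V" and k: "0 < k" "k < card (orbit \<sigma> x)"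
  shows "cycle_type V (Transposition.transpose x ((\<sigma> ^^ k) x) \<circ> \<sigma>) + {#card (orbit \<sigma> x)#} =
         cycle_type V \<sigma> + {#k, card (orbit \<sigma> x) - k#}"
    and "card (orbit (Transposition.transpose x ((\<sigma> ^^ k) x) \<circ> \<sigma>) x) = k"
    and "card (orbit (Transposition.transpose x ((\<sigma> ^^ k) x) \<circ> \<sigma>) ((\<sigma> ^^ k) x)) = card (orbit \<sigma> x) - k"
proof -
  have \<sigma>: "permutation \<sigma>" using assms by (auto simp: permutation_permutes)
  define m where "m = card (orbit \<sigma> x)"
  define y where "y = (\<sigma> ^^ k) x"
  define \<rho> where "\<rho> = Transposition.transpose x y \<circ> \<sigma>"
  note en = orbit_funpow_enum[OF \<sigma>, of x, folded m_def]
  define A where "A = orbit \<rho> x"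
  define B where "B = orbit \<rho> y"
  have A: "A = (\<lambda>j. (\<sigma> ^^ j) x) ` {..<k}" and B: "B = (\<lambda>j. (\<sigma> ^^ j) x) ` {k..<m}"
    using orbit_transpose_split[OF \<sigma> k] by (simp_all add: A_def B_def \<rho>_def y_def m_def)
  have km: "k < m" using k by (simp add: m_def)
  have inj: "inj_on (\<lambda>j. (\<sigma> ^^ j) x) {..<m}" using en(1) by (simp add: bij_betw_def)
  have cA: "card A = k" unfolding A using km by (subst card_image) (auto intro: inj_on_subset[OF inj])
  have cB: "card B = m - k" unfolding B using km by (subst card_image) (auto intro: inj_on_subset[OF inj])
  have AB: "A \<union> B = orbit \<sigma> x"
  proof -
    have "{..<k} \<union> {k..<m} = {..<m}" using km by auto
    then show ?thesis using en(1) unfolding A B bij_betw_def by (simp only: image_Un[symmetric])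
  qed
  have dis: "A \<inter> B = {}" unfolding A B using km inj
    by (subst inj_on_image_Int[symmetric, OF inj]) auto
  have neA: "x \<in> A" unfolding A using k(1) by (auto intro!: image_eqI[of _ _ 0])
  have neB: "B \<noteq> {}" unfolding B using km by auto
  have yV: "y \<in> V" using assms(3) permutes_in_image[OF permutes_funpow[OF assms(2)]] by (simp add: y_def)
  have \<rho>: "\<rho> permutes V" unfolding \<rho>_def using assms yV by (intro permutes_transpose_comp)
  then have \<rho>p: "permutation \<rho>" using assms by (auto simp: permutation_permutes)
  define R where "R = orbit \<sigma> ` V - {orbit \<sigma> x}"
  have other: "orbit \<rho> z = orbit \<sigma> z \<and> orbit \<sigma> z \<noteq> orbit \<sigma> x" if "z \<notin> orbit \<sigma> x" for z
  proof -
    have d: "orbit \<sigma> z \<inter> orbit \<sigma> x = {}" using orbits_disjoint[OF \<sigma> that] .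
    have "x \<in> orbit \<sigma> x" "y \<in> orbit \<sigma> x" using permutation_self_in_orbit[OF \<sigma>, of x] AB neA
       permutation_self_in_orbit[OF \<rho>p, of y] by (auto simp: B_def)
    then show ?thesis using d orbit_transpose_other[OF \<sigma>, of x z y] orbit_nonempty[of \<sigma> x]
      by (auto simp: \<rho>_def)
  qed
  have inO: "orbit \<rho> z \<in> {A, B} \<and> orbit \<sigma> z = orbit \<sigma> x" if "z \<in> orbit \<sigma> x" for z
  proof
    show "orbit \<rho> z \<in> {A, B}" using that AB
      orbit_cyclic_eq3[OF cyclic_on_orbit'[OF \<rho>p]] by (auto simp: A_def B_def)
    show "orbit \<sigma> z = orbit \<sigma> x" using that orbit_cyclic_eq3[OF cyclic_on_orbit'[OF \<sigma>]] by auto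
  qed
  have im: "orbit \<rho> ` V = insert A (insert B R)"
  proof
    show "orbit \<rho> ` V \<subseteq> insert A (insert B R)"
    proof
      fix C assume "C \<in> orbit \<rho> ` V"
      then obtain z where z: "z \<in> V" "C = orbit \<rho> z" by auto
      show "C \<in> insert A (insert B R)"
        using other[of z] inO[of z] z by (cases "z \<in> orbit \<sigma> x") (auto simp: R_def)
    qed
    show "insert A (insert B R) \<subseteq> orbit \<rho> ` V"
    proof
      fix C assume "C \<in> insert A (insert B R)"
      then consider "C = A" | "C = B" | z where "z \<in> V" "C = orbit \<sigma> z" "orbit \<sigma> z \<noteq> orbit \<sigma> x"
        by (auto simp: R_def)
      then show "C \<in> orbit \<rho> ` V"
      proof cases
        case (3 z)
        then have "z \<notin> orbit \<sigma> x" using inO by auto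
        then show ?thesis using other[of z] 3 by auto
      qed (use assms yV in \<open>auto simp: A_def B_def\<close>)
    qed
  qed
  have Rdis: "C \<inter> orbit \<sigma> x = {}" if C: "C \<in> R" for C
  proof -
    obtain z where z: "C = orbit \<sigma> z" "orbit \<sigma> z \<noteq> orbit \<sigma> x" using C unfolding R_def by blast
    then have "z \<notin> orbit \<sigma> x" using inO by auto
    then show ?thesis unfolding z(1) by (rule orbits_disjoint[OF \<sigma>])
  qed
  have "A \<notin> R" "B \<notin> R" using Rdis[of A] Rdis[of B] neA neB AB by auto
  moreover have "A \<noteq> B" using dis neA by auto
  moreover have fR: "finite R" using assms(1) by (simp add: R_def)
  ultimately have ct: "cycle_type V \<rho> = {#k, m - k#} + image_mset card (mset_set R)"
    unfolding cycle_type_def im by (simp add: cA cB)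
  have "orbit \<sigma> ` V = insert (orbit \<sigma> x) R" using assms(3) by (auto simp: R_def)
  moreover have "orbit \<sigma> x \<notin> R" by (simp add: R_def)
  ultimately have "cycle_type V \<sigma> = {#m#} + image_mset card (mset_set R)"
    using fR unfolding cycle_type_def by (simp add: m_def)
  then show "cycle_type V (Transposition.transpose x ((\<sigma> ^^ k) x) \<circ> \<sigma>) + {#card (orbit \<sigma> x)#} =
         cycle_type V \<sigma> + {#k, card (orbit \<sigma> x) - k#}"
    using ct by (simp add: \<rho>_def y_def m_def)
  show "card (orbit (Transposition.transpose x ((\<sigma> ^^ k) x) \<circ> \<sigma>) x) = k"
    using cA by (simp add: A_def \<rho>_def y_def)
  show "card (orbit (Transposition.transpose x ((\<sigma> ^^ k) x) \<circ> \<sigma>) ((\<sigma> ^^ k) x)) = card (orbit \<sigma> x) - k"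
    using cB by (simp add: B_def \<rho>_def y_def m_def)
qed

text \<open>Merging is the inverse of splitting: after the multiplication \<open>x\<close> and \<open>y\<close> lie on one cycle, and multiplying
  by the same transposition again restores \<open>\<sigma>\<close>.\<close>

lemma cycle_type_merge:
  assumes "finite V" "\<sigma> permutes V" "x \<in> V" "y \<in> V" and xy: "y \<notin> orbit \<sigma> x"
  shows "cycle_type V (Transposition.transpose x y \<circ> \<sigma>) + {#card (orbit \<sigma> x), card (orbit \<sigma> y)#} =
         cycle_type V \<sigma> + {#card (orbit \<sigma> x) + card (orbit \<sigma> y)#}"
proof -
  define \<rho> where "\<rho> = Transposition.transpose x y \<circ> \<sigma>"
  have \<sigma>: "permutation \<sigma>" using assms by (auto simp: permutation_permutes)
  have \<rho>: "\<rho> permutes V" unfolding \<rho>_def using assms by (intro permutes_transpose_comp)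
  then have \<rho>p: "permutation \<rho>" using assms by (auto simp: permutation_permutes)
  \<comment> \<open>The splitting lemma is applied to \<open>\<rho>\<close>, in which \<open>x\<close> and \<open>y\<close> share a cycle; its result is \<open>\<sigma>\<close>.\<close>
  have \<rho>\<sigma>: "Transposition.transpose x y \<circ> \<rho> = \<sigma>" by (simp add: \<rho>_def o_assoc)
  have "y \<in> orbit \<rho> x" unfolding \<rho>_def by (rule mem_orbit_transpose_merge[OF \<sigma> xy])
  moreover have "x \<noteq> y" using xy permutation_self_in_orbit[OF \<sigma>] by auto
  moreover have "orbit \<rho> x = (\<lambda>j. (\<rho> ^^ j) x) ` {..<card (orbit \<rho> x)}"
    using orbit_funpow_enum(1)[OF \<rho>p, of x] by (simp add: bij_betw_def)
  ultimately obtain k where k: "k < card (orbit \<rho> x)" "y = (\<rho> ^^ k) x" "k \<noteq> 0" by force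
  then have k: "0 < k" "k < card (orbit \<rho> x)" "y = (\<rho> ^^ k) x" by auto
  note s = cycle_type_split[OF assms(1) \<rho> assms(3) k(1,2), folded k(3), unfolded \<rho>\<sigma>]
  have "card (orbit \<rho> x) = card (orbit \<sigma> x) + card (orbit \<sigma> y)"
    using s(2,3) k by simp
  then show ?thesis using s by (simp add: \<rho>_def)
qed

lemma cycle_type_conj:
  assumes \<pi>: "\<pi> permutes V" and \<sigma>: "permutation \<sigma>"
  shows "cycle_type V (\<pi> \<circ> \<sigma> \<circ> inv \<pi>) = cycle_type V \<sigma>"
proof -
  have bij: "bij \<pi>" using \<pi> by (rule permutes_bij)
  have pow: "((\<pi> \<circ> \<sigma> \<circ> inv \<pi>) ^^ j) (\<pi> z) = \<pi> ((\<sigma> ^^ j) z)" for j z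
    by (induction j) (use bij in \<open>auto simp: bij_is_inj inv_f_f\<close>)
  have orb: "orbit (\<pi> \<circ> \<sigma> \<circ> inv \<pi>) (\<pi> z) = \<pi> ` orbit \<sigma> z" for z
    unfolding orbit_altdef pow by auto
  have im: "orbit (\<pi> \<circ> \<sigma> \<circ> inv \<pi>) ` V = (`) \<pi> ` (orbit \<sigma> ` V)"
  proof -
    have "orbit (\<pi> \<circ> \<sigma> \<circ> inv \<pi>) ` V = orbit (\<pi> \<circ> \<sigma> \<circ> inv \<pi>) ` (\<pi> ` V)"
      using \<pi> by (simp add: permutes_image)
    also have "\<dots> = (`) \<pi> ` (orbit \<sigma> ` V)" by (simp only: image_image orb)
    finally show ?thesis .
  qed
  have inj: "inj_on ((`) \<pi>) (orbit \<sigma> ` V)"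
    using bij by (auto intro!: inj_onI simp: bij_is_inj inj_image_eq_iff)
  show ?thesis unfolding cycle_type_def im
    using bij by (subst image_mset_mset_set[OF inj, symmetric])
      (auto simp: multiset.map_comp o_def card_image bij_is_inj inj_on_subset[OF bij_is_inj])
qed

section \<open>Decreasing rearrangements as sorted multisets\<close>

text \<open>A finitely supported decreasing sequence is determined by the multiset of its nonzero entries. Calculating
  with that multiset replaces the bijections in the definition of the rearrangement.\<close>

definition seq_of_mset :: "real multiset \<Rightarrow> nat \<Rightarrow> real" where
  "seq_of_mset A i = (if i < size A then rev (sorted_list_of_multiset A) ! i else 0)"

lemma length_sorted_list_of_multiset: "length (sorted_list_of_multiset A) = size A"
  by (metis mset_sorted_list_of_multiset size_mset)

lemma sorted_list_of_multiset_image_mono: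
  assumes "mono f"
  shows "sorted_list_of_multiset (image_mset f A) = map f (sorted_list_of_multiset A)"
proof -
  have "image_mset f A = mset (map f (sorted_list_of_multiset A))" by simp
  then have "sorted_list_of_multiset (image_mset f A) = sort (map f (sorted_list_of_multiset A))"
    by (simp only: sorted_list_of_multiset_mset)
  also have "\<dots> = map f (sorted_list_of_multiset A)"
    using assms by (intro sort_key_id_if_sorted)
      (auto simp: sorted_map monoD intro: sorted_wrt_mono_rel[OF _ sorted_sorted_list_of_multiset])
  finally show ?thesis .
qed

lemma cycle_partition_eq_seq_of_mset:
  "cycle_partition V \<sigma> = seq_of_mset (image_mset (\<lambda>k. real k / real (card V)) (cycle_type V \<sigma>))"
proof -
  have "mono (\<lambda>k. real k / real (card V))" by (auto intro!: monoI divide_right_mono)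
  then show ?thesis
    by (auto simp: fun_eq_iff cycle_partition_def seq_of_mset_def cycle_lengths_def cycle_type_def
        length_sorted_list_of_multiset sorted_list_of_multiset_image_mono rev_map nth_map)
qed

lemma seq_of_mset_nth_in: "i < size A \<Longrightarrow> seq_of_mset A i \<in># A"
  by (metis length_rev length_sorted_list_of_multiset nth_mem seq_of_mset_def
      set_rev set_sorted_list_of_multiset)

context
  fixes A :: "real multiset" assumes pos: "\<forall>a\<in>#A. 0 < a"
begin

lemma seq_of_mset_nonneg: "0 \<le> seq_of_mset A i"
  using bspec[OF pos seq_of_mset_nth_in, of i] by (cases "i < size A") (auto simp: seq_of_mset_def)

lemma seq_of_mset_support: "{i. seq_of_mset A i \<noteq> 0} = {..<size A}"
  using bspec[OF pos seq_of_mset_nth_in] by (force simp: seq_of_mset_def)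

lemma antimono_seq_of_mset: "antimono (seq_of_mset A)"
proof (rule antimonoI)
  fix i j :: nat assume "i \<le> j"
  show "seq_of_mset A j \<le> seq_of_mset A i"
  proof (cases "j < size A")
    case True
    have "sorted_wrt (\<ge>) (rev (sorted_list_of_multiset A))"
      using sorted_sorted_list_of_multiset[of A] by (simp add: sorted_wrt_rev)
    then have "rev (sorted_list_of_multiset A) ! i \<ge> rev (sorted_list_of_multiset A) ! j"
      using True \<open>i \<le> j\<close> by (cases "i = j") (auto simp: sorted_wrt_iff_nth_less length_sorted_list_of_multiset)
    then show ?thesis using True \<open>i \<le> j\<close> by (simp add: seq_of_mset_def)
  next
    case False
    then have "seq_of_mset A j = 0" by (simp add: seq_of_mset_def)
    then show ?thesis using seq_of_mset_nonneg[of i] by simp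
  qed
qed

end

lemma image_seq_of_mset: "image_mset (seq_of_mset A) (mset_set {..<size A}) = A"
proof -
  have "image_mset (seq_of_mset A) (mset_set {..<size A})
      = image_mset ((!) (rev (sorted_list_of_multiset A))) (mset_set {..<size A})"
    by (intro image_mset_cong) (auto simp: seq_of_mset_def)
  also have "\<dots> = mset (map ((!) (rev (sorted_list_of_multiset A))) [0..<size A])"
    by (simp add: atLeast0LessThan)
  also have "map ((!) (rev (sorted_list_of_multiset A))) [0..<size A] = rev (sorted_list_of_multiset A)"
    using map_nth[of "rev (sorted_list_of_multiset A)"] by (simp add: length_sorted_list_of_multiset)
  finally show ?thesis by simp
qed

lemma sum_seq_of_mset: "(\<Sum>i<size A. seq_of_mset A i) = sum_mset A"
  by (metis image_seq_of_mset sum_unfold_sum_mset)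

text \<open>The support of a decreasing nonnegative sequence is an initial segment, and on it the sequence lists its
  values in decreasing order, which is unique.\<close>

lemma antimono_eq_seq_of_mset:
  fixes r :: "nat \<Rightarrow> real"
  assumes r: "antimono r" and nn: "\<And>i. 0 \<le> r i" and fin: "finite {i. r i \<noteq> 0}"
  shows "r = seq_of_mset (image_mset r (mset_set {i. r i \<noteq> 0}))"
proof -
  have down: "r i \<noteq> 0" if "r j \<noteq> 0" "i \<le> j" for i j
    using antimonoD[OF r that(2)] nn[of i] nn[of j] that(1) by auto
  obtain n where n: "{i. r i \<noteq> 0} = {..<n}"
  proof (cases "{i. r i \<noteq> 0} = {}")
    case True then show ?thesis using that[of 0] by auto
  next
    case False
    define m where "m = Max {i. r i \<noteq> 0}"
    have "m \<in> {i. r i \<noteq> 0}" unfolding m_def using fin False by (rule Max_in)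
    moreover have "i \<le> m" if "r i \<noteq> 0" for i unfolding m_def using fin that by (intro Max_ge) auto
    moreover have "r i \<noteq> 0" if "i \<le> m" for i
      using down[of m i] that \<open>m \<in> {i. r i \<noteq> 0}\<close> by simp
    ultimately have "{i. r i \<noteq> 0} = {..<Suc m}" by (auto simp: less_Suc_eq_le)
    then show ?thesis by (rule that)
  qed
  define A where "A = image_mset r (mset_set {..<n})"
  have sz: "size A = n" by (simp add: A_def)
  have "A = mset (rev (map r [0..<n]))" by (simp add: A_def atLeast0LessThan)
  then have "sorted_list_of_multiset A = sort (rev (map r [0..<n]))"
    by (simp only: sorted_list_of_multiset_mset)
  also have "sorted (rev (map r [0..<n]))"
    using r unfolding sorted_wrt_iff_nth_less by (simp add: antimonoD rev_nth)
  then have "sort (rev (map r [0..<n])) = rev (map r [0..<n])" by (rule sorted_sort_id)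
  finally have "rev (sorted_list_of_multiset A) = map r [0..<n]" by simp
  then have "r i = seq_of_mset A i" for i
    using n sz by (auto simp: seq_of_mset_def)
  then have "r = seq_of_mset A" by (rule ext)
  then show ?thesis unfolding n A_def .
qed

lemma image_mset_eq_bij_betw:
  assumes "finite X" "finite Y" "image_mset f (mset_set X) = image_mset g (mset_set Y)"
  obtains \<phi> where "bij_betw \<phi> X Y" "\<And>x. x \<in> X \<Longrightarrow> f x = g (\<phi> x)"
proof -
  have "card X = card Y" using arg_cong[OF assms(3), of size] by simp
  then obtain h where h: "bij_betw h X Y" using assms finite_same_card_bij by blast
  have "mset_set Y = image_mset h (mset_set X)"
    using h by (simp add: bij_betw_def image_mset_mset_set)
  then have "image_mset f (mset_set X) = image_mset (\<lambda>x. g (h x)) (mset_set X)"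
    using assms(3) by (simp add: multiset.map_comp o_def)
  then obtain p where p: "p permutes X" "\<forall>x\<in>X. f x = g (h (p x))"
    using image_mset_eq_implies_permutes[OF assms(1)] by blast
  show ?thesis
  proof
    show "bij_betw (h \<circ> p) X Y" using p(1) h by (intro bij_betw_trans[of p X X] permutes_imp_bij)
  qed (use p in auto)
qed

text \<open>Existence comes from matching families with equal value multisets, uniqueness from the fact that every
  candidate is a decreasing sequence with this multiset of nonzero values.\<close>

lemma decr_rearr_eq_seq_of_mset:
  assumes fin: "finite {i. q i \<noteq> 0}" and nn: "\<And>i. 0 \<le> q i"
  shows "decr_rearr q = seq_of_mset (image_mset q (mset_set {i. q i \<noteq> 0}))"
  unfolding decr_rearr_def
proof (rule the_equality)
  define A where "A = image_mset q (mset_set {i. q i \<noteq> 0})"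
  have pos: "\<forall>a\<in>#A. 0 < a" using nn fin by (fastforce simp: A_def less_le)
  obtain \<phi> where "bij_betw \<phi> {..<size A} {i. q i \<noteq> 0}" "\<And>i. i \<in> {..<size A} \<Longrightarrow> seq_of_mset A i = q (\<phi> i)"
    using image_seq_of_mset[of A]
    by (rule_tac image_mset_eq_bij_betw[OF _ fin, of "{..<size A}" "seq_of_mset A" q])
      (auto simp: A_def)
  then show "antimono (seq_of_mset A) \<and> (\<exists>\<phi>. bij_betw \<phi> {i. seq_of_mset A i \<noteq> 0} {i. q i \<noteq> 0} \<and>
      (\<forall>i. seq_of_mset A i \<noteq> 0 \<longrightarrow> seq_of_mset A i = q (\<phi> i)))"
    using antimono_seq_of_mset[OF pos] seq_of_mset_support[OF pos] by auto
  fix r :: "nat \<Rightarrow> real" assume "antimono r \<and> (\<exists>\<phi>. bij_betw \<phi> {i. r i \<noteq> 0} {i. q i \<noteq> 0} \<and> (\<forall>i. r i \<noteq> 0 \<longrightarrow> r i = q (\<phi> i)))"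
  then obtain \<phi> where r: "antimono r" and bij: "bij_betw \<phi> {i. r i \<noteq> 0} {i. q i \<noteq> 0}"
    and eq: "\<And>i. r i \<noteq> 0 \<Longrightarrow> r i = q (\<phi> i)" by auto
  have nnr: "0 \<le> r i" for i using eq[of i] nn[of "\<phi> i"] by (cases "r i = 0") auto
  have finr: "finite {i. r i \<noteq> 0}" using bij fin by (simp add: bij_betw_finite)
  have "image_mset r (mset_set {i. r i \<noteq> 0}) = image_mset (q \<circ> \<phi>) (mset_set {i. r i \<noteq> 0})"
    using eq finr by (intro image_mset_cong) auto
  also have "\<dots> = A" using bij unfolding A_def bij_betw_def
    by (auto simp: image_mset_mset_set multiset.map_comp[symmetric])
  finally show "r = seq_of_mset A" using antimono_eq_seq_of_mset[OF r nnr finr] by simp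
qed

lemma image_mset_support_update:
  fixes q :: "nat \<Rightarrow> real"
  assumes "finite {i. q i \<noteq> 0}" "v \<noteq> 0" "q i \<noteq> 0"
  shows "image_mset (q(i := v)) (mset_set {j. (q(i := v)) j \<noteq> 0}) + {#q i#}
       = image_mset q (mset_set {j. q j \<noteq> 0}) + {#v#}"
proof -
  define R where "R = {j. q j \<noteq> 0} - {i}"
  have R: "finite R" "i \<notin> R" using assms by (auto simp: R_def)
  have 1: "{j. q j \<noteq> 0} = insert i R" "{j. (q(i := v)) j \<noteq> 0} = insert i R"
    using assms by (auto simp: R_def)
  have "image_mset (q(i := v)) (mset_set R) = image_mset q (mset_set R)"
    using R by (intro image_mset_cong) auto
  then show ?thesis using R unfolding 1 by simp
qed

lemma image_mset_support_delete:
  fixes q :: "nat \<Rightarrow> real"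
  assumes "finite {i. q i \<noteq> 0}" "q i \<noteq> 0"
  shows "image_mset (q(i := 0)) (mset_set {j. (q(i := 0)) j \<noteq> 0}) + {#q i#}
       = image_mset q (mset_set {j. q j \<noteq> 0})"
proof -
  define R where "R = {j. q j \<noteq> 0} - {i}"
  have R: "finite R" "i \<notin> R" using assms by (auto simp: R_def)
  have 1: "{j. q j \<noteq> 0} = insert i R" "{j. (q(i := 0)) j \<noteq> 0} = R"
    using assms by (auto simp: R_def)
  have "image_mset (q(i := 0)) (mset_set R) = image_mset q (mset_set R)"
    using R by (intro image_mset_cong) auto
  then show ?thesis using R unfolding 1 by simp
qed

lemma image_mset_support_shift:
  fixes q :: "nat \<Rightarrow> real"
  assumes "finite {i. q i \<noteq> 0}" "v \<noteq> 0"
  shows "image_mset (case_nat v q) (mset_set {j. case_nat v q j \<noteq> 0})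
       = image_mset q (mset_set {j. q j \<noteq> 0}) + {#v#}" and "finite {j. case_nat v q j \<noteq> 0}"
proof -
  have 1: "{j. case_nat v q j \<noteq> 0} = insert 0 (Suc ` {j. q j \<noteq> 0})"
  proof (rule set_eqI)
    fix j show "j \<in> {j. case_nat v q j \<noteq> 0} \<longleftrightarrow> j \<in> insert 0 (Suc ` {j. q j \<noteq> 0})"
      using assms by (cases j) auto
  qed
  show "finite {j. case_nat v q j \<noteq> 0}" unfolding 1 using assms by simp
  show "image_mset (case_nat v q) (mset_set {j. case_nat v q j \<noteq> 0})
       = image_mset q (mset_set {j. q j \<noteq> 0}) + {#v#}"
    unfolding 1 using assms
    by (simp add: image_mset_mset_set[symmetric] multiset.map_comp o_def)
qed

context
  fixes A :: "real multiset" assumes pos: "\<forall>a\<in>#A. 0 < a"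
begin

text \<open>The new multiset \<open>B\<close> is characterized by an additive equation, in the form in which
  \<open>cycle_type_merge\<close> delivers it.\<close>

lemma merge_entries_seq_of_mset:
  assumes "i < size A" "j < size A" "i \<noteq> j"
    and B: "B + {#seq_of_mset A i, seq_of_mset A j#} = A + {#seq_of_mset A i + seq_of_mset A j#}"
  shows "merge_entries i j (seq_of_mset A) = seq_of_mset B"
proof -
  define p where "p = seq_of_mset A"
  have fin: "finite {i. p i \<noteq> 0}" unfolding p_def seq_of_mset_support[OF pos] by simp
  have pij: "p i > 0" "p j > 0" using assms bspec[OF pos seq_of_mset_nth_in] by (auto simp: p_def)
  have nn: "0 \<le> p i" for i using seq_of_mset_nonneg[OF pos] by (simp add: p_def)
  define p' where "p' = p(i := p i + p j)"
  define q where "q = p'(j := 0)"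
  have fin': "finite {i. p' i \<noteq> 0}"
    by (rule finite_subset[of _ "insert i {i. p i \<noteq> 0}"]) (use fin in \<open>auto simp: p'_def\<close>)
  have 1: "image_mset p' (mset_set {i. p' i \<noteq> 0}) + {#p i#} = A + {#p i + p j#}"
    unfolding p'_def using image_mset_support_update[OF fin, of "p i + p j" i] pij
    by (simp add: p_def seq_of_mset_support[OF pos] image_seq_of_mset)
  have 2: "image_mset q (mset_set {i. q i \<noteq> 0}) + {#p j#} = image_mset p' (mset_set {i. p' i \<noteq> 0})"
  proof -
    have e: "p' j = p j" using assms(3) by (simp add: p'_def)
    then have "p' j \<noteq> 0" using pij by simp
    from image_mset_support_delete[OF fin' this, unfolded e] show ?thesis unfolding q_def .
  qed
  have "finite {i. q i \<noteq> 0}"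
    by (rule finite_subset[OF _ fin']) (auto simp: q_def)
  moreover have "\<And>i. 0 \<le> q i" using nn by (auto simp: q_def p'_def)
  ultimately have "decr_rearr q = seq_of_mset (image_mset q (mset_set {i. q i \<noteq> 0}))"
    by (rule decr_rearr_eq_seq_of_mset)
  also have "image_mset q (mset_set {i. q i \<noteq> 0}) = B"
  proof -
    have "image_mset q (mset_set {i. q i \<noteq> 0}) + {#p i, p j#} = B + {#p i, p j#}"
      using 1 2 B by (simp add: p_def)
    then show ?thesis by (simp only: add_right_cancel)
  qed
  finally show ?thesis unfolding merge_entries_def q_def p'_def p_def .
qed

lemma split_entry_seq_of_mset:
  assumes "i < size A" and u: "0 < u" "u < 1"
    and B: "B + {#seq_of_mset A i#} = A + {#u * seq_of_mset A i, (1 - u) * seq_of_mset A i#}"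
  shows "split_entry i u (seq_of_mset A) = seq_of_mset B"
proof -
  define p where "p = seq_of_mset A"
  have fin: "finite {i. p i \<noteq> 0}" unfolding p_def seq_of_mset_support[OF pos] by simp
  have pij: "p i > 0" using assms bspec[OF pos seq_of_mset_nth_in] by (auto simp: p_def)
  have nn: "0 \<le> p i" for i using seq_of_mset_nonneg[OF pos] by (simp add: p_def)
  define p' where "p' = p(i := u * p i)"
  define v where "v = (1 - u) * p i"
  define q where "q = case_nat v p'"
  have v: "v > 0" using u pij by (simp add: v_def)
  have fin': "finite {i. p' i \<noteq> 0}"
    by (rule finite_subset[of _ "insert i {i. p i \<noteq> 0}"]) (use fin in \<open>auto simp: p'_def\<close>)
  have 1: "image_mset p' (mset_set {i. p' i \<noteq> 0}) + {#p i#} = A + {#u * p i#}"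
    unfolding p'_def using image_mset_support_update[OF fin, of "u * p i" i] pij u
    by (simp add: p_def seq_of_mset_support[OF pos] image_seq_of_mset)
  have 2: "image_mset q (mset_set {i. q i \<noteq> 0}) = image_mset p' (mset_set {i. p' i \<noteq> 0}) + {#v#}"
    unfolding q_def using image_mset_support_shift(1)[OF fin', of v] v by simp
  have "finite {i. q i \<noteq> 0}"
    unfolding q_def using image_mset_support_shift(2)[OF fin', of v] v by simp
  moreover have "\<And>i. 0 \<le> q i" using nn u v by (auto simp: q_def p'_def split: nat.splits)
  ultimately have "decr_rearr q = seq_of_mset (image_mset q (mset_set {i. q i \<noteq> 0}))"
    by (rule decr_rearr_eq_seq_of_mset)
  also have "image_mset q (mset_set {i. q i \<noteq> 0}) = B"
  proof -
    have "image_mset q (mset_set {i. q i \<noteq> 0}) + {#p i#} = B + {#p i#}"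
      using 1 2 B by (simp add: p_def v_def add_mset_commute)
    then show ?thesis by (simp only: add_right_cancel)
  qed
  finally show ?thesis by (simp add: split_entry_def q_def p'_def p_def v_def)
qed

end

section \<open>Split-and-merge as the projection of random transpositions\<close>

definition distinct_pairs :: "'v set \<Rightarrow> ('v \<times> 'v) set" where
  "distinct_pairs V = {(x, y). x \<in> V \<and> y \<in> V \<and> x \<noteq> y}"

lemma cycle_partition_merge:
  assumes V: "finite V" and \<sigma>: "\<sigma> permutes V" and xy: "x \<in> V" "y \<in> V" "y \<notin> orbit \<sigma> x"
    and i: "i < card (orbit \<sigma> ` V)" "cycle_partition V \<sigma> i = real (card (orbit \<sigma> x)) / real (card V)"
    and j: "j < card (orbit \<sigma> ` V)" "cycle_partition V \<sigma> j = real (card (orbit \<sigma> y)) / real (card V)"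
    and ij: "i \<noteq> j"
  shows "cycle_partition V (Transposition.transpose x y \<circ> \<sigma>) = merge_entries i j (cycle_partition V \<sigma>)"
proof -
  let ?g = "\<lambda>k::nat. real k / real (card V)"
  let ?A = "image_mset ?g (cycle_type V \<sigma>)"
  let ?B = "image_mset ?g (cycle_type V (Transposition.transpose x y \<circ> \<sigma>))"
  have p: "permutation \<sigma>" using V \<sigma> by (auto simp: permutation_permutes)
  have N: "card V > 0" using V xy by (auto simp: card_gt_0_iff)
  have pos: "\<forall>a\<in>#?A. 0 < a"
    using orbit_funpow_enum(3)[OF p] N V by (auto simp: cycle_type_def)
  have sz: "size ?A = card (orbit \<sigma> ` V)" by (simp add: cycle_type_def)
  have "?B + {#?g (card (orbit \<sigma> x)), ?g (card (orbit \<sigma> y))#}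
       = ?A + {#?g (card (orbit \<sigma> x) + card (orbit \<sigma> y))#}"
    using arg_cong[OF cycle_type_merge[OF V \<sigma> xy], of "image_mset ?g"] by simp
  then show ?thesis
    unfolding cycle_partition_eq_seq_of_mset using i j ij
    by (intro merge_entries_seq_of_mset[OF pos, symmetric])
      (simp_all only: sz cycle_partition_eq_seq_of_mset[symmetric] add_divide_distrib of_nat_add not_False_eq_True)
qed

lemma cycle_partition_split:
  assumes V: "finite V" and \<sigma>: "\<sigma> permutes V" and x: "x \<in> V"
    and k: "0 < k" "k < card (orbit \<sigma> x)"
    and i: "i < card (orbit \<sigma> ` V)" "cycle_partition V \<sigma> i = real (card (orbit \<sigma> x)) / real (card V)"
  shows "cycle_partition V (Transposition.transpose x ((\<sigma> ^^ k) x) \<circ> \<sigma>) =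
         split_entry i (real k / (real (card V) * cycle_partition V \<sigma> i)) (cycle_partition V \<sigma>)"
proof -
  let ?g = "\<lambda>k::nat. real k / real (card V)"
  let ?A = "image_mset ?g (cycle_type V \<sigma>)"
  let ?B = "image_mset ?g (cycle_type V (Transposition.transpose x ((\<sigma> ^^ k) x) \<circ> \<sigma>))"
  let ?m = "card (orbit \<sigma> x)"
  have p: "permutation \<sigma>" using V \<sigma> by (auto simp: permutation_permutes)
  have N: "card V > 0" using V x by (auto simp: card_gt_0_iff)
  have pos: "\<forall>a\<in>#?A. 0 < a"
    using orbit_funpow_enum(3)[OF p] N V by (auto simp: cycle_type_def)
  have sz: "size ?A = card (orbit \<sigma> ` V)" by (simp add: cycle_type_def)
  have u: "real k / (real (card V) * cycle_partition V \<sigma> i) = real k / real ?m"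
    using N by (simp add: i)
  have m: "?m > 0" using k by simp
  have eq: "?B + {#?g ?m#} = ?A + {#?g k, ?g (?m - k)#}"
    using arg_cong[OF cycle_type_split(1)[OF V \<sigma> x k], of "image_mset ?g"] by simp
  have "?g k = real k / real ?m * cycle_partition V \<sigma> i" using m by (simp add: i)
  moreover have "?g (?m - k) = (1 - real k / real ?m) * cycle_partition V \<sigma> i"
    using m k by (simp add: i of_nat_diff diff_divide_distrib left_diff_distrib)
  ultimately have "?B + {#cycle_partition V \<sigma> i#} = ?A +
       {#real k / real ?m * cycle_partition V \<sigma> i, (1 - real k / real ?m) * cycle_partition V \<sigma> i#}"
    using eq by (simp only: i(2)[symmetric])
  moreover have "i < size ?A" using i(1) by (simp only: sz)
  ultimately show ?thesis
    unfolding u unfolding cycle_partition_eq_seq_of_mset using k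
    by (intro split_entry_seq_of_mset[OF pos, symmetric]) simp_all
qed

text \<open>Ordered pairs of distinct vertices are sorted by the cycles that they meet. For two
  different cycles \<open>i\<close>, \<open>j\<close> of lengths \<open>m\<^sub>i\<close>, \<open>m\<^sub>j\<close> there are \<open>m\<^sub>i m\<^sub>j\<close> choices of \<open>(x, y)\<close>, all with the effect of merging; within
  cycle \<open>i\<close> each \<open>x\<close> has exactly one partner \<open>\<sigma>\<^sup>k x\<close> for every \<open>k \<in> {1..<m\<^sub>i}\<close>, with the effect of splitting off
  \<open>k\<close>. Dividing by the number \<open>N (N - 1)\<close> of pairs gives the two rates of the split-and-merge generator.\<close>

theorem split_merge_gen_cycle_partition:
  assumes V: "finite V" "2 \<le> card V" and \<sigma>: "\<sigma> permutes V"
  shows "split_merge_gen (card V) f (cycle_partition V \<sigma>) =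
    (\<Sum>(x, y)\<in>distinct_pairs V. f (cycle_partition V (Transposition.transpose x y \<circ> \<sigma>)) - f (cycle_partition V \<sigma>))
      / (real (card V) * (real (card V) - 1))"
proof -
  define N where "N = card V"
  define p where "p = cycle_partition V \<sigma>"
  define g where "g x y = f (cycle_partition V (Transposition.transpose x y \<circ> \<sigma>)) - f p" for x y
  define r where "r = card (orbit \<sigma> ` V)"
  define Mg where "Mg i j = f (merge_entries i j p) - f p" for i j
  define Sp where "Sp i k = f (split_entry i (real k / (real N * p i)) p) - f p" for i and k :: nat
  have perm: "permutation \<sigma>" using V \<sigma> by (auto simp: permutation_permutes)
  have N: "real N > 1" "real N \<noteq> 0" "real N - 1 \<noteq> 0" using V by (auto simp: N_def)
  let ?g = "\<lambda>k::nat. real k / real (card V)"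
  obtain C where C: "bij_betw C {..<r} (orbit \<sigma> ` V)"
    and pC: "\<And>i. i < r \<Longrightarrow> p i = real (card (C i)) / real N"
  proof (rule image_mset_eq_bij_betw[of "{..<r}" "orbit \<sigma> ` V" p "\<lambda>C. real (card C) / real N"])
    show "image_mset p (mset_set {..<r}) = image_mset (\<lambda>C. real (card C) / real N) (mset_set (orbit \<sigma> ` V))"
      using image_seq_of_mset[of "image_mset ?g (cycle_type V \<sigma>)"]
      by (simp add: p_def cycle_partition_eq_seq_of_mset cycle_type_def multiset.map_comp o_def N_def r_def)
  qed (use V in \<open>auto simp: r_def\<close>)
  have p0: "p i = 0" if "i \<ge> r" for i
    using that by (simp add: p_def cycle_partition_eq_seq_of_mset seq_of_mset_def cycle_type_def r_def)
  have p_supp: "i < r" if "p i \<noteq> 0" for i using p0[of i] that by (cases "i < r") auto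
  define m where "m i = card (C i)" for i
  have Corb: "C i = orbit \<sigma> x" if "i < r" "x \<in> C i" for i x
  proof -
    have "C i \<in> orbit \<sigma> ` V" using C that by (auto simp: bij_betw_def)
    then obtain z where "C i = orbit \<sigma> z" by auto
    then show ?thesis using orbit_cyclic_eq3[OF cyclic_on_orbit'[OF perm], of x z] that by simp
  qed
  have CV: "C i \<subseteq> V" if "i < r" for i
  proof -
    have "C i \<in> orbit \<sigma> ` V" using C that by (auto simp: bij_betw_def)
    then show ?thesis using permutes_orbit_subset[OF \<sigma>] by auto
  qed
  have Cfin: "finite (C i)" if "i < r" for i using CV[OF that] V(1) by (rule finite_subset)
  have Cdis: "C i \<inter> C j = {}" if "i < r" "j < r" "i \<noteq> j" for i j
  proof (rule ccontr)
    assume "C i \<inter> C j \<noteq> {}"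
    then obtain z where "z \<in> C i" "z \<in> C j" by auto
    then have "C i = C j" using Corb that by metis
    then show False using C that by (auto simp: bij_betw_def inj_on_def)
  qed
  have Vun: "V = (\<Union>i\<in>{..<r}. C i)"
  proof
    show "V \<subseteq> (\<Union>i\<in>{..<r}. C i)"
    proof
      fix x assume "x \<in> V"
      then have "orbit \<sigma> x \<in> C ` {..<r}" using C by (auto simp: bij_betw_def)
      then show "x \<in> (\<Union>i\<in>{..<r}. C i)" using permutation_self_in_orbit[OF perm, of x] by auto
    qed
  qed (use CV in auto)
  have sumV: "(\<Sum>x\<in>V. h x) = (\<Sum>i<r. \<Sum>x\<in>C i. h x)" for h :: "'a \<Rightarrow> real"
    unfolding Vun using Cfin Cdis by (intro sum.UNION_disjoint) auto
  have gM: "g x y = Mg i j" if "i < r" "j < r" "i \<noteq> j" "x \<in> C i" "y \<in> C j" for i j x y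
  proof -
    have "y \<notin> orbit \<sigma> x" using Corb[of i x] Cdis[of i j] that by auto
    moreover have "x \<in> V" "y \<in> V" using CV that by auto
    ultimately show ?thesis unfolding g_def Mg_def p_def
      using that pC Corb[of i x] Corb[of j y]
      by (subst cycle_partition_merge[OF V(1) \<sigma>, of x y i j]) (auto simp: r_def p_def N_def)
  qed
  have ne: "\<exists>x. x \<in> C i" if "i < r" for i
  proof -
    have "C i \<in> orbit \<sigma> ` V" using C that by (auto simp: bij_betw_def)
    then show ?thesis using orbit_nonempty by fastforce
  qed
  \<comment> \<open>Read off from a common transposition, so that no symmetry of the rearrangement has to be proved.\<close>
  have Mg_sym: "Mg i j = Mg j i" if ij: "i < r" "j < r" for i j
  proof (cases "i = j")
    case False
    obtain x y where "x \<in> C i" "y \<in> C j" using ne[OF ij(1)] ne[OF ij(2)] by blast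
    then have "Mg i j = g x y" "Mg j i = g y x" using gM ij False by simp_all
    then show ?thesis by (simp add: g_def transpose_commute)
  qed simp
  have gS: "(\<Sum>y\<in>C i - {x}. g x y) = (\<Sum>k\<in>{1..<m i}. Sp i k)" if i: "i < r" "x \<in> C i" for i x
  proof -
    note en = orbit_funpow_enum[OF perm, of x, folded Corb[OF i], folded m_def]
    have "bij_betw (\<lambda>j. (\<sigma> ^^ j) x) ({..<m i} - {0}) (C i - {x})"
      using en i(2) by (intro bij_betw_DiffI bij_betw_singletonI) auto
    moreover have "{..<m i} - {0} = {1..<m i}" by auto
    ultimately have b: "bij_betw (\<lambda>j. (\<sigma> ^^ j) x) {1..<m i} (C i - {x})" by simp
    have "(\<Sum>y\<in>C i - {x}. g x y) = (\<Sum>k\<in>{1..<m i}. g x ((\<sigma> ^^ k) x))"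
      by (rule sum.reindex_bij_betw[OF b, symmetric])
    also have "\<dots> = (\<Sum>k\<in>{1..<m i}. Sp i k)"
    proof (rule sum.cong)
      fix k assume k: "k \<in> {1..<m i}"
      have xV: "x \<in> V" using CV[OF i(1)] i(2) by auto
      show "g x ((\<sigma> ^^ k) x) = Sp i k"
        unfolding g_def Sp_def p_def N_def using k i xV pC[OF i(1)]
        by (subst cycle_partition_split[OF V(1) \<sigma>, of x k i])
          (auto simp: m_def Corb[OF i] r_def p_def N_def)
    qed simp
    finally show ?thesis .
  qed
  have inner: "(\<Sum>y\<in>V - {x}. g x y) = (\<Sum>j\<in>{..<r} - {i}. real (m j) * Mg i j) + (\<Sum>k\<in>{1..<m i}. Sp i k)"
    if i: "i < r" "x \<in> C i" for i x
  proof -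
    have "(\<Sum>y\<in>V - {x}. g x y) = (\<Sum>y\<in>V. if y = x then 0 else g x y)"
      using V(1) by (intro sum.mono_neutral_cong_left) auto
    also have "\<dots> = (\<Sum>j<r. \<Sum>y\<in>C j. if y = x then 0 else g x y)" by (rule sumV)
    also have "\<dots> = (\<Sum>j\<in>{..<r} - {i}. \<Sum>y\<in>C j. if y = x then 0 else g x y)
                    + (\<Sum>y\<in>C i. if y = x then 0 else g x y)"
      using i by (subst sum.remove[of _ i]) auto
    also have "(\<Sum>y\<in>C i. if y = x then 0 else g x y) = (\<Sum>y\<in>C i - {x}. g x y)"
      using Cfin[OF i(1)] by (intro sum.mono_neutral_cong_right) auto
    also have "\<dots> = (\<Sum>k\<in>{1..<m i}. Sp i k)" by (rule gS[OF i])
    also have "(\<Sum>j\<in>{..<r} - {i}. \<Sum>y\<in>C j. if y = x then 0 else g x y)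
             = (\<Sum>j\<in>{..<r} - {i}. real (m j) * Mg i j)"
    proof (rule sum.cong)
      fix j assume j: "j \<in> {..<r} - {i}"
      have "(\<Sum>y\<in>C j. if y = x then 0 else g x y) = (\<Sum>y\<in>C j. Mg i j)"
        using j i Cdis[of i j] by (intro sum.cong) (auto simp: gM)
      then show "(\<Sum>y\<in>C j. if y = x then 0 else g x y) = real (m j) * Mg i j" by (simp add: m_def)
    qed simp
    finally show ?thesis .
  qed
  have dp: "distinct_pairs V = Sigma V (\<lambda>x. V - {x})" by (auto simp: distinct_pairs_def)
  define P where "P = {(i, j). i < j \<and> j < r}"
  have finP: "finite P"
    by (rule finite_subset[of _ "{..<r} \<times> {..<r}"]) (auto simp: P_def)
  have "(\<Sum>(x, y)\<in>distinct_pairs V. g x y) = (\<Sum>x\<in>V. \<Sum>y\<in>V - {x}. g x y)"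
    unfolding dp using V(1) by (subst sum.Sigma) auto
  also have "\<dots> = (\<Sum>i<r. \<Sum>x\<in>C i. (\<Sum>j\<in>{..<r} - {i}. real (m j) * Mg i j) + (\<Sum>k\<in>{1..<m i}. Sp i k))"
    unfolding sumV by (intro sum.cong inner) auto
  also have "\<dots> = (\<Sum>i<r. \<Sum>j\<in>{..<r} - {i}. real (m i) * real (m j) * Mg i j)
                + (\<Sum>i<r. real (m i) * (\<Sum>k\<in>{1..<m i}. Sp i k))"
    by (simp add: m_def sum.distrib distrib_left sum_distrib_left mult.assoc)
  also have "(\<Sum>i<r. \<Sum>j\<in>{..<r} - {i}. real (m i) * real (m j) * Mg i j)
           = 2 * (\<Sum>(i, j)\<in>P. real (m i) * real (m j) * Mg i j)"
  proof -
    let ?h = "\<lambda>i j. real (m i) * real (m j) * Mg i j"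
    let ?Q = "{(i, j). j < i \<and> i < r}"
    have Q: "?Q = prod.swap ` P" by (auto simp: P_def)
    have "(\<Sum>i<r. \<Sum>j\<in>{..<r} - {i}. ?h i j) = (\<Sum>(i, j)\<in>Sigma {..<r} (\<lambda>i. {..<r} - {i}). ?h i j)"
      by (subst sum.Sigma) auto
    also have "Sigma {..<r} (\<lambda>i. {..<r} - {i}) = P \<union> ?Q" by (auto simp: P_def)
    also have "(\<Sum>(i, j)\<in>P \<union> ?Q. ?h i j) = (\<Sum>(i, j)\<in>P. ?h i j) + (\<Sum>(i, j)\<in>?Q. ?h i j)"
      using finP unfolding Q by (intro sum.union_disjoint) (auto simp: P_def)
    also have "(\<Sum>(i, j)\<in>?Q. ?h i j) = (\<Sum>(i, j)\<in>P. ?h j i)"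
      unfolding Q by (subst sum.reindex) (auto simp: case_prod_unfold)
    also have "\<dots> = (\<Sum>(i, j)\<in>P. ?h i j)"
      by (intro sum.cong) (auto simp: P_def Mg_sym)
    finally show ?thesis by simp
  qed
  finally have tot: "(\<Sum>(x, y)\<in>distinct_pairs V. g x y) = 2 * (\<Sum>(i, j)\<in>P. real (m i) * real (m j) * Mg i j)
                + (\<Sum>i<r. real (m i) * (\<Sum>k\<in>{1..<m i}. Sp i k))" .
  have inf1: "(\<Sum>\<^sub>\<infinity>(i, j)\<in>{(i, j). i < j}. p i * p j * Mg i j)
            = (\<Sum>(i, j)\<in>P. real (m i) * real (m j) * Mg i j) / (real N)\<^sup>2"
  proof -
    have "(\<Sum>\<^sub>\<infinity>(i, j)\<in>{(i, j). i < j}. p i * p j * Mg i j) = (\<Sum>\<^sub>\<infinity>(i, j)\<in>P. p i * p j * Mg i j)"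
      by (rule infsum_cong_neutral) (auto simp: P_def dest: p_supp)
    also have "\<dots> = (\<Sum>(i, j)\<in>P. p i * p j * Mg i j)" using finP by simp
    also have "\<dots> = (\<Sum>(i, j)\<in>P. real (m i) * real (m j) * Mg i j / (real N)\<^sup>2)"
      by (intro sum.cong) (auto simp: P_def pC m_def power2_eq_square)
    finally show ?thesis by (simp add: sum_divide_distrib case_prod_unfold)
  qed
  have kset: "{k::nat. 1 \<le> k \<and> real k \<le> real N * p i - 1} = {1..<m i}" if "i < r" for i
    using N pC[OF that] by (auto simp: m_def)
  have inf2: "(\<Sum>\<^sub>\<infinity>i. p i * (\<Sum>k\<in>{k::nat. 1 \<le> k \<and> real k \<le> real N * p i - 1}. Sp i k))
            = (\<Sum>i<r. real (m i) * (\<Sum>k\<in>{1..<m i}. Sp i k)) / real N"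
  proof -
    have "(\<Sum>\<^sub>\<infinity>i. p i * (\<Sum>k\<in>{k::nat. 1 \<le> k \<and> real k \<le> real N * p i - 1}. Sp i k))
        = (\<Sum>\<^sub>\<infinity>i\<in>{..<r}. p i * (\<Sum>k\<in>{1..<m i}. Sp i k))"
    proof (rule infsum_cong_neutral)
      fix i assume "i \<in> UNIV \<inter> {..<r}"
      then have "i < r" by simp
      then show "p i * (\<Sum>k\<in>{k::nat. 1 \<le> k \<and> real k \<le> real N * p i - 1}. Sp i k) = p i * (\<Sum>k\<in>{1..<m i}. Sp i k)"
        by (simp only: kset)
    qed (auto simp: p0)
    also have "\<dots> = (\<Sum>i<r. p i * (\<Sum>k\<in>{1..<m i}. Sp i k))" by simp
    also have "\<dots> = (\<Sum>i<r. real (m i) * (\<Sum>k\<in>{1..<m i}. Sp i k) / real N)"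
      by (intro sum.cong) (auto simp: pC m_def)
    finally show ?thesis by (simp add: sum_divide_distrib)
  qed
  have "split_merge_gen N f p = 2 * real N / (real N - 1) * (\<Sum>\<^sub>\<infinity>(i, j)\<in>{(i, j). i < j}. p i * p j * Mg i j)
    + 1 / (real N - 1) * (\<Sum>\<^sub>\<infinity>i. p i * (\<Sum>k\<in>{k::nat. 1 \<le> k \<and> real k \<le> real N * p i - 1}. Sp i k))"
    by (simp add: split_merge_gen_def Mg_def Sp_def)
  also have "\<dots> = (\<Sum>(x, y)\<in>distinct_pairs V. g x y) / (real N * (real N - 1))"
  proof -
    have "2 * real N / (real N - 1) * (a / (real N)\<^sup>2) + 1 / (real N - 1) * (b / real N)
        = (2 * a + b) / (real N * (real N - 1))" for a b
      using N by (simp add: power2_eq_square add_divide_distrib mult.commute)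
    then show ?thesis unfolding inf1 inf2 tot .
  qed
  finally show ?thesis by (simp add: N_def p_def g_def)
qed

lemma cycle_partition_in_disc_partitions:
  assumes V: "finite V" "V \<noteq> {}" and \<sigma>: "\<sigma> permutes V"
  shows "cycle_partition V \<sigma> \<in> disc_partitions (card V)"
proof -
  let ?g = "\<lambda>k::nat. real k / real (card V)"
  define A where "A = image_mset ?g (cycle_type V \<sigma>)"
  have cp: "cycle_partition V \<sigma> = seq_of_mset A" by (simp add: cycle_partition_eq_seq_of_mset A_def)
  have perm: "permutation \<sigma>" using V \<sigma> by (auto simp: permutation_permutes)
  have N: "card V > 0" using V by (auto simp: card_gt_0_iff)
  have pos: "\<forall>a\<in>#A. 0 < a"
    using orbit_funpow_enum(3)[OF perm] N V by (auto simp: cycle_type_def A_def)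
  have dj: "disjoint (orbit \<sigma> ` V)"
  proof (rule disjointI)
    fix a b assume "a \<in> orbit \<sigma> ` V" "b \<in> orbit \<sigma> ` V" "a \<noteq> b"
    then obtain x z where xz: "a = orbit \<sigma> x" "b = orbit \<sigma> z" by auto
    then have "x \<notin> orbit \<sigma> z" using \<open>a \<noteq> b\<close> orbit_cyclic_eq3[OF cyclic_on_orbit'[OF perm]] by auto
    then show "a \<inter> b = {}" unfolding xz by (rule orbits_disjoint[OF perm])
  qed
  have un: "\<Union>(orbit \<sigma> ` V) = V"
    using permutes_orbit_subset[OF \<sigma>] permutation_self_in_orbit[OF perm] by blast
  have "sum_mset (cycle_type V \<sigma>) = (\<Sum>C\<in>orbit \<sigma> ` V. card C)"
    by (simp add: cycle_type_def sum_unfold_sum_mset)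
  also have "\<dots> = card V"
    using card_Union_disjoint[OF dj] un V(1) finite_subset[OF permutes_orbit_subset[OF \<sigma>]] by force
  finally have s: "sum_mset (cycle_type V \<sigma>) = card V" .
  have "sum_mset (image_mset ?g B) = real (sum_mset B) / real (card V)" for B :: "nat multiset"
    by (induction B) (auto simp: add_divide_distrib)
  from this[of "cycle_type V \<sigma>"] have "sum_mset A = 1" unfolding s A_def using N by simp
  then have sums: "seq_of_mset A sums 1"
    using sums_finite[of "{..<size A}" "seq_of_mset A"] by (simp add: sum_seq_of_mset) (simp add: seq_of_mset_def)
  have nn: "0 \<le> seq_of_mset A i" for i by (rule seq_of_mset_nonneg[OF pos])
  have le: "seq_of_mset A i \<le> 1" for i
    using sums nn sum_le_suminf[of "seq_of_mset A" "{i}"] by (auto simp: sums_iff)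
  have "real (card V) * seq_of_mset A i \<in> \<nat>" for i
  proof (cases "i < size A")
    case True
    then have "seq_of_mset A i \<in># A" by (rule seq_of_mset_nth_in)
    then obtain k where "seq_of_mset A i = ?g k" by (auto simp: A_def)
    then show ?thesis using N by simp
  qed (simp add: seq_of_mset_def)
  then show ?thesis unfolding cp using sums nn le antimono_seq_of_mset[OF pos]
    by (auto simp: disc_partitions_def partitions_def)
qed

text \<open>Entries are multiples of \<open>1 / N\<close>, and at most \<open>N\<close> of them can be nonzero because each such entry is at
  least \<open>1 / N\<close>.\<close>

lemma finite_disc_partitions:
  assumes "N \<noteq> 0"
  shows "finite (disc_partitions N)"
proof -
  note False = assms
  have "p i = 0" if p: "p \<in> disc_partitions N" and i: "i \<ge> N" for p i
  proof (rule ccontr)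
    assume ne: "p i \<noteq> 0"
    have nn: "0 \<le> p j" for j using p by (auto simp: disc_partitions_def partitions_def)
    obtain k where k: "real N * p i = real k" using p by (auto simp: disc_partitions_def elim: Nats_cases)
    then have "k \<ge> 1" using ne nn[of i] False by (cases k) auto
    then have ge: "1 / real N \<le> p i" using k False by (simp add: field_simps)
    have "1 < (\<Sum>j\<le>i. 1 / real N)" using i False by (simp add: field_simps)
    also have "\<dots> \<le> (\<Sum>j\<le>i. p j)"
      using p ge by (intro sum_mono) (auto simp: disc_partitions_def partitions_def dest: antimonoD order_trans)
    also have "\<dots> \<le> suminf p"
      using p nn by (intro sum_le_suminf) (auto simp: disc_partitions_def partitions_def sums_iff)
    also have "\<dots> = 1" using p by (auto simp: disc_partitions_def partitions_def sums_iff)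
    finally show False by simp
  qed
  moreover have "p i \<in> (\<lambda>k. real k / real N) ` {..N}" if p: "p \<in> disc_partitions N" for p i
  proof -
    obtain k where k: "real N * p i = real k" using p by (auto simp: disc_partitions_def elim: Nats_cases)
    moreover have "p i \<le> 1" using p by (auto simp: disc_partitions_def partitions_def)
    ultimately have "real k \<le> real N" using False by (metis mult_left_le of_nat_0_le_iff)
    then show ?thesis using k False by (intro image_eqI[of _ _ k]) (auto simp: field_simps)
  qed
  ultimately have "disc_partitions N \<subseteq> {p. \<forall>i. (i \<in> {..<N} \<longrightarrow> p i \<in> (\<lambda>k. real k / real N) ` {..N})
      \<and> (i \<notin> {..<N} \<longrightarrow> p i = 0)}" by auto
  then show ?thesis by (rule finite_subset) (intro finite_set_of_finite_funs, auto)
qed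

lemma cycle_partition_conj:
  assumes "\<pi> permutes V" "permutation \<sigma>"
  shows "cycle_partition V (\<pi> \<circ> \<sigma> \<circ> inv \<pi>) = cycle_partition V \<sigma>"
  by (simp add: cycle_partition_eq_seq_of_mset cycle_type_conj[OF assms])

section \<open>Marked arrival times\<close>

lemma nn_integral_uniform_count_measure:
  assumes "finite A"
  shows "(\<integral>\<^sup>+x. f x \<partial>uniform_count_measure A) = (\<Sum>x\<in>A. ennreal (1 / real (card A)) * f x)"
  unfolding uniform_count_measure_def using assms
  by (subst nn_integral_point_measure_finite) (auto simp: mult.commute)

text \<open>As a function of \<open>t\<close> the probability \<open>e\<^bsup>-t\<^esup> t\<^sup>k / k!\<close> of exactly \<open>k\<close> jumps before \<open>t\<close> is the Erlang density; in
  particular it is 0 for negative \<open>t\<close>, so that the recursion over the first gap needs no case distinction.\<close>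

abbreviation poisson_density :: "nat \<Rightarrow> real \<Rightarrow> real" where
  "poisson_density k t \<equiv> erlang_density k 1 t"

text \<open>Recursion of the Poisson weights \<open>e\<^bsup>-t\<^esup> t\<^sup>k / k!\<close> when the first of \<open>k + 1\<close> jumps occurs at time \<open>g\<close>.\<close>

lemma nn_integral_exponential_poisson:
  "(\<integral>\<^sup>+g. ennreal (exponential_density 1 g) * ennreal (poisson_density k (t - g)) \<partial>lborel)
   = ennreal (poisson_density (Suc k) t)"
proof (cases "0 \<le> t")
  case False
  have "(\<integral>\<^sup>+g. ennreal (exponential_density 1 g) * ennreal (poisson_density k (t - g)) \<partial>lborel)
      = (\<integral>\<^sup>+g. 0 \<partial>(lborel :: real measure))"
    using False by (intro nn_integral_cong) (auto simp: erlang_density_def)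
  then show ?thesis using False by (simp add: erlang_density_def)
next
  case True
  define F where "F g = - exp (- t) * (t - g) ^ Suc k / fact (Suc k)" for g
  define f where "f g = exp (- t) * (t - g) ^ k / fact k" for g
  have "(\<integral>\<^sup>+g. ennreal (exponential_density 1 g) * ennreal (poisson_density k (t - g)) \<partial>lborel)
      = (\<integral>\<^sup>+g. ennreal (f g) * indicator {0..t} g \<partial>lborel)"
  proof (intro nn_integral_cong)
    fix g :: real
    have "exp (- g) * exp (- (t - g)) = exp (- t)" by (simp add: exp_add[symmetric])
    then show "ennreal (exponential_density 1 g) * ennreal (poisson_density k (t - g)) = ennreal (f g) * indicator {0..t} g"
      by (auto simp: erlang_density_def f_def indicator_def ennreal_mult'[symmetric] mult_ac
          simp flip: mult.assoc)
  qed
  also have "\<dots> = ennreal (F t - F 0)"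
  proof (rule nn_integral_FTC_Icc)
    fix g assume g: "g \<in> {0..t}"
    show "0 \<le> f g" using g by (simp add: f_def)
    have "(F has_real_derivative - exp (- t) * (real (Suc k) * ((t - g) ^ k * (-1))) / fact (Suc k)) (at g)"
      unfolding F_def
      by (rule derivative_eq_intros refl | simp del: fact_Suc)+
    moreover have "- exp (- t) * (real (Suc k) * ((t - g) ^ k * (-1))) / fact (Suc k) = f g"
      unfolding f_def fact_Suc by (simp del: of_nat_Suc)
    ultimately show "(F has_real_derivative f g) (at g)" by (simp only:)
  qed (use True in \<open>auto simp: f_def\<close>)
  also have "F t - F 0 = poisson_density (Suc k) t" using True by (simp add: F_def erlang_density_def mult.commute)
  finally show ?thesis .
qed

lemma poisson_density_sums: "0 \<le> t \<Longrightarrow> (\<lambda>k. poisson_density k t) sums 1"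
proof -
  assume t: "0 \<le> t"
  have "(\<lambda>k. exp (- t) * (t ^ k /\<^sub>R fact k)) sums (exp (- t) * exp t)"
    by (intro sums_mult exp_converges)
  moreover have "exp (- t) * exp t = 1" by (simp add: exp_add[symmetric])
  moreover have "exp (- t) * (t ^ k /\<^sub>R fact k) = poisson_density k t" for k
    using t by (simp add: erlang_density_def field_simps)
  ultimately show ?thesis by simp
qed

definition arrival :: "nat \<Rightarrow> (real \<times> 'm) stream \<Rightarrow> real" where
  "arrival k \<omega> = (\<Sum>i<k. fst (\<omega> !! i))"

lemma arrival_simps: "arrival 0 \<omega> = 0" "arrival (Suc k) \<omega> = arrival k \<omega> + fst (\<omega> !! k)"
  by (simp_all add: arrival_def)

lemma arrival_Suc_shd: "arrival (Suc k) \<omega> = fst (shd \<omega>) + arrival k (stl \<omega>)"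
  unfolding arrival_def by (subst sum.lessThan_Suc_shift) simp

text \<open>Stated as a predicate rather than through a counting function so that it is meaningful, and satisfies its recursion,
  for streams whose arrival times fail to increase to infinity.\<close>

definition count_is :: "nat \<Rightarrow> real \<Rightarrow> (real \<times> 'm) stream \<Rightarrow> bool" where
  "count_is k t \<omega> \<longleftrightarrow> arrival k \<omega> \<le> t \<and> t < arrival (Suc k) \<omega>"

lemma count_is_0: "count_is 0 t \<omega> \<longleftrightarrow> 0 \<le> t \<and> t < fst (shd \<omega>)"
  by (simp add: count_is_def arrival_simps)

lemma count_is_Suc: "count_is (Suc k) t \<omega> \<longleftrightarrow> count_is k (t - fst (shd \<omega>)) (stl \<omega>)"
  unfolding count_is_def arrival_Suc_shd[of "Suc k"] arrival_Suc_shd[of k \<omega>] by auto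

text \<open>What remains of the stream after time \<open>t\<close> if \<open>k\<close> arrivals have occurred: the current gap loses the part
  already elapsed and keeps its mark.\<close>

definition residual :: "nat \<Rightarrow> real \<Rightarrow> (real \<times> 'm) stream \<Rightarrow> (real \<times> 'm) stream" where
  "residual k t \<omega> = (arrival (Suc k) \<omega> - t, snd (\<omega> !! k)) ## sdrop (Suc k) \<omega>"

lemma residual_0: "residual 0 t \<omega> = (fst (shd \<omega>) - t, snd (shd \<omega>)) ## stl \<omega>"
  by (simp add: residual_def arrival_simps)

lemma residual_Suc: "residual (Suc k) t \<omega> = residual k (t - fst (shd \<omega>)) (stl \<omega>)"
  by (simp add: residual_def arrival_Suc_shd[of "Suc k"])

lemma arrival_residual_Suc: "arrival (Suc j) (residual k t \<omega>) = arrival (Suc (k + j)) \<omega> - t"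
proof (induction j)
  case 0
  then show ?case by (simp add: arrival_def residual_def)
next
  case (Suc j)
  have "residual k t \<omega> !! Suc j = \<omega> !! (Suc (k + j))" by (simp add: residual_def sdrop_snth)
  then show ?case using Suc by (simp add: arrival_simps(2)[of "Suc j"] arrival_simps(2)[of "Suc (k + j)"])
qed

lemma count_is_residual:
  assumes "count_is k t \<omega>" "0 \<le> s"
  shows "count_is j s (residual k t \<omega>) \<longleftrightarrow> count_is (k + j) (t + s) \<omega>"
proof (cases j)
  case 0
  then show ?thesis using assms by (auto simp: count_is_def arrival_residual_Suc arrival_simps(1))
next
  case (Suc i)
  then show ?thesis using assms arrival_residual_Suc[of "Suc i" k t \<omega>] arrival_residual_Suc[of i k t \<omega>]
    by (auto simp: count_is_def)
qed

text \<open>Positive gaps and an arrival count at every integer time; this makes the counting function defined at all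
  times. It holds almost surely, and the sample space is restricted to such streams so that every path is a
  jump path.\<close>

definition good_stream :: "(real \<times> 'm) stream \<Rightarrow> bool" where
  "good_stream \<omega> \<longleftrightarrow> (\<forall>i. 0 < fst (\<omega> !! i)) \<and> (\<forall>n::nat. \<exists>k. count_is k (real n) \<omega>)"

lemma arrival_mono:
  assumes "\<forall>i. 0 < fst (\<omega> !! i)"
  shows "strict_mono (\<lambda>k. arrival k \<omega>)"
  using assms by (intro strict_monoI_Suc) (simp add: arrival_simps)

lemma count_is_unique:
  assumes "\<forall>i. 0 < fst (\<omega> !! i)" "count_is j t \<omega>" "count_is k t \<omega>"
  shows "j = k"
proof (rule ccontr)
  note mono = strict_mono_leD[OF arrival_mono[OF assms(1)]]
  assume "j \<noteq> k"
  then consider "Suc j \<le> k" | "Suc k \<le> j" by linarith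
  then show False using mono[of "Suc j" k] mono[of "Suc k" j] assms(2,3)
    by cases (auto simp: count_is_def)
qed

lemma good_stream_ex1_count:
  assumes g: "good_stream \<omega>" and t: "0 \<le> t"
  shows "\<exists>!k. count_is k t \<omega>"
proof -
  have pos: "\<forall>i. 0 < fst (\<omega> !! i)" using g by (simp add: good_stream_def)
  obtain k where "count_is k (real (nat \<lceil>t\<rceil>)) \<omega>" using g by (auto simp: good_stream_def)
  then have "t < arrival (Suc k) \<omega>" using t by (simp add: count_is_def) linarith
  then have ex: "\<exists>k. t < arrival k \<omega>" by blast
  define m where "m = (LEAST k. t < arrival k \<omega>)"
  have m: "t < arrival m \<omega>" unfolding m_def using ex by (rule LeastI_ex)
  then have "m \<noteq> 0" using t by (auto simp: arrival_simps intro: ccontr)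
  then obtain j where j: "m = Suc j" by (cases m) auto
  then have "\<not> t < arrival j \<omega>" using not_less_Least[of j "\<lambda>k. t < arrival k \<omega>"] by (simp add: m_def)
  then have "count_is j t \<omega>" using m j by (simp add: count_is_def)
  then show ?thesis using count_is_unique[OF pos] by blast
qed

definition jump_count :: "real \<Rightarrow> (real \<times> 'm) stream \<Rightarrow> nat" where
  "jump_count t \<omega> = (THE k. count_is k t \<omega>)"

lemma jump_count_eq: "good_stream \<omega> \<Longrightarrow> count_is k t \<omega> \<Longrightarrow> jump_count t \<omega> = k"
  unfolding jump_count_def good_stream_def using count_is_unique by blast

lemma count_is_jump_count: "good_stream \<omega> \<Longrightarrow> 0 \<le> t \<Longrightarrow> count_is (jump_count t \<omega>) t \<omega>"
  unfolding jump_count_def by (rule theI') (rule good_stream_ex1_count)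

lemma good_stream_residual:
  assumes g: "good_stream \<omega>" and t: "0 \<le> t" and k: "count_is k t \<omega>"
  shows "good_stream (residual k t \<omega>)"
  unfolding good_stream_def
proof (intro conjI allI)
  fix i show "0 < fst (residual k t \<omega> !! i)"
  proof (cases i)
    case 0
    then show ?thesis using k by (simp add: residual_def count_is_def)
  next
    case (Suc j)
    then have "residual k t \<omega> !! i = \<omega> !! (Suc k + j)" by (simp add: residual_def sdrop_snth)
    moreover have "0 < fst (\<omega> !! (Suc k + j))" using g unfolding good_stream_def by blast
    ultimately show ?thesis by (simp only:)
  qed
next
  fix n :: nat
  define j where "j = jump_count (t + real n) \<omega>"
  have j: "count_is j (t + real n) \<omega>" unfolding j_def using g t by (intro count_is_jump_count) auto
  have "k \<le> j"
  proof (rule ccontr)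
    assume "\<not> k \<le> j"
    then have "arrival (Suc j) \<omega> \<le> arrival k \<omega>"
      using g by (intro strict_mono_leD[OF arrival_mono]) (auto simp: good_stream_def)
    then show False using j k by (auto simp: count_is_def)
  qed
  then show "\<exists>i. count_is i (real n) (residual k t \<omega>)"
    using j count_is_residual[OF k, of "real n" "j - k"] by auto
qed

lemma jump_count_residual:
  assumes g: "good_stream \<omega>" and "0 \<le> t" "0 \<le> s"
  shows "jump_count (t + s) \<omega> = jump_count t \<omega> + jump_count s (residual (jump_count t \<omega>) t \<omega>)"
proof -
  let ?k = "jump_count t \<omega>"
  have k: "count_is ?k t \<omega>" using assms by (intro count_is_jump_count)
  have "good_stream (residual ?k t \<omega>)" using assms k by (intro good_stream_residual)
  then have "count_is (jump_count s (residual ?k t \<omega>)) s (residual ?k t \<omega>)"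
    using assms by (intro count_is_jump_count)
  then have "count_is (?k + jump_count s (residual ?k t \<omega>)) (t + s) \<omega>"
    using count_is_residual[OF k] assms by simp
  then show ?thesis using g by (intro jump_count_eq)
qed

primrec run_marks :: "('m \<Rightarrow> 's \<Rightarrow> 's) \<Rightarrow> nat \<Rightarrow> 's \<Rightarrow> (real \<times> 'm) stream \<Rightarrow> 's" where
  "run_marks F 0 x \<omega> = x"
| "run_marks F (Suc k) x \<omega> = run_marks F k (F (snd (shd \<omega>)) x) (stl \<omega>)"

lemma run_marks_Suc_snth: "run_marks F (Suc k) x \<omega> = F (snd (\<omega> !! k)) (run_marks F k x \<omega>)"
  by (induction k arbitrary: x \<omega>) simp_all

lemma run_marks_residual:
  "run_marks F j (run_marks F k x \<omega>) (residual k t \<omega>) = run_marks F (k + j) x \<omega>"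
proof (induction j)
  case (Suc j)
  have "snd (residual k t \<omega> !! j) = snd (\<omega> !! (k + j))"
    by (cases j) (auto simp: residual_def sdrop_snth)
  then show ?case using Suc by (simp add: run_marks_Suc_snth del: run_marks.simps)
qed simp

definition marked_path :: "('m \<Rightarrow> 's \<Rightarrow> 's) \<Rightarrow> real \<Rightarrow> 's \<times> (real \<times> 'm) stream \<Rightarrow> 's" where
  "marked_path F t z = run_marks F (jump_count t (snd z)) (fst z) (snd z)"

lemma marked_path_shift:
  assumes "good_stream \<omega>" "0 \<le> t" "0 \<le> s"
  shows "marked_path F (t + s) (x, \<omega>) =
    marked_path F s (marked_path F t (x, \<omega>), residual (jump_count t \<omega>) t \<omega>)"
  using assms by (simp add: marked_path_def jump_count_residual run_marks_residual)

lemma jump_path_marked_path: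
  assumes g: "good_stream \<omega>"
  shows "jump_path (\<lambda>t. marked_path F t (x, \<omega>))"
  unfolding jump_path_def
proof (intro conjI allI impI)
  fix t :: real assume t: "0 \<le> t"
  define k where "k = jump_count t \<omega>"
  have k: "count_is k t \<omega>" unfolding k_def using g t by (rule count_is_jump_count)
  have jc: "jump_count s \<omega> = k" if "s \<in> {t..<arrival (Suc k) \<omega>}" for s
    using that k by (intro jump_count_eq[OF g]) (auto simp: count_is_def)
  have lt: "t < arrival (Suc k) \<omega>" using k by (simp add: count_is_def)
  show "\<exists>e>0. \<forall>s\<in>{t..<t + e}. marked_path F s (x, \<omega>) = marked_path F t (x, \<omega>)"
  proof (intro exI conjI ballI)
    show "0 < arrival (Suc k) \<omega> - t" using lt by simp
    fix s assume "s \<in> {t..<t + (arrival (Suc k) \<omega> - t)}"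
    then have "jump_count s \<omega> = k" by (intro jc) simp
    moreover have "jump_count t \<omega> = k" by (simp add: k_def)
    ultimately show "marked_path F s (x, \<omega>) = marked_path F t (x, \<omega>)" by (simp add: marked_path_def)
  qed
next
  fix t :: real assume t: "0 < t"
  define k where "k = jump_count t \<omega>"
  have k: "count_is k t \<omega>" unfolding k_def using g t by (intro count_is_jump_count) auto
  show "\<exists>e>0. \<exists>a. \<forall>s\<in>{t - e<..<t}. 0 \<le> s \<longrightarrow> marked_path F s (x, \<omega>) = a"
  proof (cases "arrival k \<omega> < t")
    case True
    have "jump_count s \<omega> = k" if "s \<in> {arrival k \<omega><..<t}" for s
      using that k by (intro jump_count_eq[OF g]) (auto simp: count_is_def)
    then show ?thesis using True
      by (intro exI[of _ "t - arrival k \<omega>"] conjI exI[of _ "run_marks F k x \<omega>"]) (auto simp: marked_path_def)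
  next
    case False
    then have eq: "arrival k \<omega> = t" using k by (simp add: count_is_def)
    then obtain j where j: "k = Suc j" using t by (cases k) (auto simp: arrival_simps)
    have "0 < fst (\<omega> !! j)" using g by (simp add: good_stream_def)
    then have lt: "arrival j \<omega> < t" using eq by (simp add: j arrival_simps)
    have "jump_count s \<omega> = j" if "s \<in> {arrival j \<omega><..<t}" for s
      using that eq by (intro jump_count_eq[OF g]) (auto simp: count_is_def j)
    then show ?thesis using lt
      by (intro exI[of _ "t - arrival j \<omega>"] conjI exI[of _ "run_marks F j x \<omega>"]) (auto simp: marked_path_def)
  qed
qed

lemma jump_path_map:
  assumes "jump_path w"
  shows "jump_path (\<lambda>t. h (w t))"
  unfolding jump_path_def
proof (intro conjI allI impI)
  fix t :: real assume "0 \<le> t"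
  then have "\<exists>e>0. \<forall>s\<in>{t..<t + e}. w s = w t"
    by (rule assms[unfolded jump_path_def, THEN conjunct1, THEN spec, THEN mp])
  then obtain e where "e > 0" "\<forall>s\<in>{t..<t + e}. w s = w t" by auto
  then show "\<exists>e>0. \<forall>s\<in>{t..<t + e}. h (w s) = h (w t)"
    by (intro exI[of _ e] conjI ballI arg_cong[of "w _" _ h])
      (assumption | (erule bspec, assumption))+
next
  fix t :: real assume "0 < t"
  then have "\<exists>e>0. \<exists>a. \<forall>s\<in>{t - e<..<t}. 0 \<le> s \<longrightarrow> w s = a"
    by (rule assms[unfolded jump_path_def, THEN conjunct2, THEN spec, THEN mp])
  then obtain e a where "e > 0" "\<forall>s\<in>{t - e<..<t}. 0 \<le> s \<longrightarrow> w s = a" by auto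
  then show "\<exists>e>0. \<exists>a. \<forall>s\<in>{t - e<..<t}. 0 \<le> s \<longrightarrow> h (w s) = a" by (intro exI[of _ e] conjI exI[of _ "h a"]) auto
qed

section \<open>Walks driven by uniform marks, and their semigroups\<close>

lemma binomial_difference:
  fixes a :: "nat \<Rightarrow> real"
  shows "(\<Sum>j\<le>Suc k. real (Suc k choose j) * (-1) ^ (Suc k - j) * a j)
    = (\<Sum>j\<le>k. real (k choose j) * (-1) ^ (k - j) * a (Suc j)) - (\<Sum>j\<le>k. real (k choose j) * (-1) ^ (k - j) * a j)"
proof -
  have "(\<Sum>j\<le>Suc k. real (Suc k choose j) * (-1) ^ (Suc k - j) * a j)
     = (-1) ^ Suc k * a 0 + (\<Sum>j\<le>k. real (Suc k choose Suc j) * (-1) ^ (k - j) * a (Suc j))"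
    by (subst sum.atMost_Suc_shift) simp
  also have "(\<Sum>j\<le>k. real (Suc k choose Suc j) * (-1) ^ (k - j) * a (Suc j))
     = (\<Sum>j\<le>k. real (k choose j) * (-1) ^ (k - j) * a (Suc j))
     + (\<Sum>j\<le>k. real (k choose Suc j) * (-1) ^ (k - j) * a (Suc j))"
    by (simp add: sum.distrib[symmetric] algebra_simps)
  also have "(\<Sum>j\<le>k. real (k choose Suc j) * (-1) ^ (k - j) * a (Suc j))
     = (\<Sum>j\<le>Suc k. real (k choose j) * (-1) ^ (Suc k - j) * a j) - (-1) ^ Suc k * a 0"
    by (subst sum.atMost_Suc_shift) simp
  also have "(\<Sum>j\<le>Suc k. real (k choose j) * (-1) ^ (Suc k - j) * a j)
     = (\<Sum>j\<le>k. real (k choose j) * (-1) ^ (Suc k - j) * a j)" by simp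
  also have "\<dots> = - (\<Sum>j\<le>k. real (k choose j) * (-1) ^ (k - j) * a j)"
    by (simp add: sum_negf[symmetric] Suc_diff_le)
  finally show ?thesis by simp
qed

text \<open>Bijectivity of the action of each mark is what makes the uniform law on the states invariant.\<close>

locale uniform_walk =
  fixes C :: "'m set" and S :: "'s set" and F :: "'m \<Rightarrow> 's \<Rightarrow> 's"
  assumes finite_C: "finite C" and C_ne: "C \<noteq> {}"
    and finite_S: "finite S" and S_ne: "S \<noteq> {}"
    and F_bij: "\<And>c. c \<in> C \<Longrightarrow> bij_betw (F c) S S"
begin

lemma F_in: "c \<in> C \<Longrightarrow> x \<in> S \<Longrightarrow> F c x \<in> S"
  using F_bij by (auto simp: bij_betw_def)

definition step_avg :: "('s \<Rightarrow> real) \<Rightarrow> 's \<Rightarrow> real" where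
  "step_avg f x = (\<Sum>c\<in>C. f (F c x)) / real (card C)"

lemma card_C: "0 < real (card C)" using finite_C C_ne by (simp add: card_gt_0_iff)

primrec steps_avg :: "nat \<Rightarrow> ('s \<Rightarrow> real) \<Rightarrow> 's \<Rightarrow> real" where
  "steps_avg 0 f = f"
| "steps_avg (Suc k) f = step_avg (steps_avg k f)"

lemma step_avg_cong: "(\<And>x. x \<in> S \<Longrightarrow> f x = g x) \<Longrightarrow> x \<in> S \<Longrightarrow> step_avg f x = step_avg g x"
  by (auto simp: step_avg_def F_in intro!: sum.cong arg_cong2[where f="(/)"])

lemma step_avg_mono: "(\<And>x. x \<in> S \<Longrightarrow> f x \<le> g x) \<Longrightarrow> x \<in> S \<Longrightarrow> step_avg f x \<le> step_avg g x"
  by (auto simp: step_avg_def F_in intro!: divide_right_mono sum_mono)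

lemma step_avg_const: "step_avg (\<lambda>_. a) x = a"
  using card_C by (simp add: step_avg_def)

lemma steps_avg_bounds:
  assumes "\<And>x. x \<in> S \<Longrightarrow> a \<le> f x \<and> f x \<le> b" "x \<in> S"
  shows "a \<le> steps_avg k f x \<and> steps_avg k f x \<le> b"
  using assms(2)
proof (induction k arbitrary: x)
  case (Suc k)
  show ?case using step_avg_mono[of "\<lambda>_. a" "steps_avg k f" x] step_avg_mono[of "steps_avg k f" "\<lambda>_. b" x] Suc
    by (simp add: step_avg_const)
qed (use assms in auto)

lemma steps_avg_sum:
  "steps_avg k (\<lambda>z. \<Sum>y\<in>Y. f y z) x = (\<Sum>y\<in>Y. steps_avg k (f y) x)"
proof (induction k arbitrary: x)
  case (Suc k)
  then have "steps_avg k (\<lambda>z. \<Sum>y\<in>Y. f y z) = (\<lambda>x. \<Sum>y\<in>Y. steps_avg k (f y) x)" by auto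
  then show ?case
    by (simp add: step_avg_def sum_divide_distrib) (subst sum.swap, simp)
qed simp

lemma sum_steps_avg: "(\<Sum>x\<in>S. steps_avg k f x) = (\<Sum>x\<in>S. f x)"
proof (induction k)
  case (Suc k)
  have "(\<Sum>x\<in>S. steps_avg (Suc k) f x) = (\<Sum>c\<in>C. \<Sum>x\<in>S. steps_avg k f (F c x)) / card C"
    by (simp add: step_avg_def sum_divide_distrib) (subst sum.swap, simp)
  also have "(\<Sum>c\<in>C. \<Sum>x\<in>S. steps_avg k f (F c x)) = (\<Sum>c\<in>C. \<Sum>x\<in>S. steps_avg k f x)"
    by (intro sum.cong sum.reindex_bij_betw F_bij) auto
  finally show ?case using Suc card_C by simp
qed simp

text \<open>With \<open>P\<close> the averaging operator, \<open>(P - 1)\<^sup>k\<close> is expanded by the binomial theorem. The map \<open>h\<close> covers the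
  lumped case, where the generator acts on functions of \<open>h x\<close> only.\<close>

lemma generator_power:
  fixes G' :: "('t \<Rightarrow> real) \<Rightarrow> 't \<Rightarrow> real"
  assumes G: "\<And>f x. x \<in> S \<Longrightarrow> G' f (h x) = step_avg (f \<circ> h) x - f (h x)" and "x \<in> S"
  shows "(G' ^^ k) f (h x) = (\<Sum>j\<le>k. real (k choose j) * (-1) ^ (k - j) * steps_avg j (f \<circ> h) x)"
  using assms(2)
proof (induction k arbitrary: x)
  case (Suc k)
  let ?c = "\<lambda>j. real (k choose j) * (-1) ^ (k - j)"
  have "(G' ^^ Suc k) f (h x) = step_avg ((G' ^^ k) f \<circ> h) x - (G' ^^ k) f (h x)"
    using G[OF Suc.prems, of "(G' ^^ k) f"] by simp
  also have "step_avg ((G' ^^ k) f \<circ> h) x = step_avg (\<lambda>x. \<Sum>j\<le>k. ?c j * steps_avg j (f \<circ> h) x) x"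
    using Suc.IH Suc.prems by (intro step_avg_cong) (simp_all only: o_apply[of "(G' ^^ k) f" h])
  also have "\<dots> = (\<Sum>j\<le>k. ?c j * steps_avg (Suc j) (f \<circ> h) x)"
    by (simp add: step_avg_def sum_divide_distrib sum_distrib_left) (subst sum.swap, simp)
  finally show ?case unfolding Suc.IH[OF Suc.prems] by (simp only: binomial_difference)
qed simp

text \<open>\<open>e\<^bsup>t (P - 1)\<^esup> = e\<^bsup>-t\<^esup> \<Sum>\<^sub>k t\<^sup>k / k! P\<^sup>k\<close>, as a Cauchy product of the two exponential series.\<close>

lemma semigroup_eq:
  fixes G' :: "('t \<Rightarrow> real) \<Rightarrow> 't \<Rightarrow> real"
  assumes G: "\<And>f x. x \<in> S \<Longrightarrow> G' f (h x) = step_avg (f \<circ> h) x - f (h x)" and x: "x \<in> S" and t: "0 \<le> t"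
  shows "(\<lambda>k. poisson_density k t * steps_avg k (f \<circ> h) x) sums semigroup_of G' t f (h x)"
proof -
  define s where "s j = steps_avg j (f \<circ> h) x" for j
  define B where "B = Max ((\<lambda>x. \<bar>f (h x)\<bar>) ` S)"
  have "\<bar>f (h y)\<bar> \<le> B" if "y \<in> S" for y unfolding B_def using finite_S that by (intro Max_ge) auto
  then have s: "\<bar>s j\<bar> \<le> B" for j
    using steps_avg_bounds[of "-B" "f \<circ> h" B x j] x unfolding s_def by (force simp: abs_le_iff)
  \<comment> \<open>The two factors of the Cauchy product: the series of \<open>e\<^bsup>t P\<^esup>\<close> and of \<open>e\<^bsup>-t\<^esup>\<close>.\<close>
  define a where "a j = t ^ j /\<^sub>R fact j * s j" for j
  define b where "b j = (- t) ^ j /\<^sub>R fact j" for j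
  have "summable (\<lambda>j. t ^ j /\<^sub>R fact j * B)" by (intro summable_mult2 summable_exp_generic)
  then have sa: "summable (\<lambda>j. norm (a j))"
    using s t by (rule_tac summable_comparison_test') (auto simp: a_def abs_mult intro!: mult_left_mono)
  have sb: "summable (\<lambda>j. norm (b j))" unfolding b_def by (rule summable_norm_exp)
  have bs: "(\<Sum>k. b k) = exp (- t)" unfolding b_def by (simp add: exp_def)
  have "(\<lambda>k. \<Sum>i\<le>k. a i * b (k - i)) sums ((\<Sum>k. a k) * exp (- t))"
    using Cauchy_product_sums[OF sa sb] by (simp add: bs)
  moreover have "(\<Sum>i\<le>k. a i * b (k - i)) = t ^ k / fact k * (G' ^^ k) f (h x)" for k
  proof -
    have "a i * b (k - i) = t ^ k / fact k * (real (k choose i) * (-1) ^ (k - i) * s i)" if "i \<le> k" for i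
    proof -
      have "t ^ k = t ^ i * t ^ (k - i)" using that by (simp add: power_add[symmetric])
      then have "t ^ k / fact k * real (k choose i) = (t ^ i / fact i) * (t ^ (k - i) / fact (k - i))"
        using that by (simp add: binomial_fact)
      moreover have "b (k - i) = (-1) ^ (k - i) * (t ^ (k - i) / fact (k - i))"
        by (simp add: b_def power_minus[of t] divide_inverse)
      moreover have "a i = t ^ i / fact i * s i" by (simp add: a_def divide_inverse)
      moreover have "t ^ k / fact k * (real (k choose i) * (-1) ^ (k - i) * s i)
        = (t ^ k / fact k * real (k choose i)) * ((-1) ^ (k - i) * s i)" by (simp only: mult_ac)
      ultimately show ?thesis by (simp only:) (simp only: mult_ac)
    qed
    then show ?thesis using generator_power[where h=h and G'=G', OF G x, of k f]
      by (simp add: sum_distrib_left s_def)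
  qed
  ultimately have "semigroup_of G' t f (h x) = (\<Sum>k. a k) * exp (- t)"
    unfolding semigroup_of_def by (simp add: sums_iff)
  moreover have "(\<lambda>k. a k * exp (- t)) sums ((\<Sum>k. a k) * exp (- t))"
    by (rule sums_mult2[OF summable_sums[OF summable_norm_cancel[OF sa]]])
  moreover have "a k * exp (- t) = poisson_density k t * steps_avg k (f \<circ> h) x" for k
    using t by (simp add: a_def s_def erlang_density_def divide_inverse mult_ac del: o_apply)
  ultimately show ?thesis by simp
qed

abbreviation mark_measure :: "(real \<times> 'm) measure" where
  "mark_measure \<equiv> density lborel (exponential_density 1) \<Otimes>\<^sub>M uniform_count_measure C"

definition driver :: "(real \<times> 'm) stream measure" where
  "driver = stream_space mark_measure"

lemma prob_space_exponential: "prob_space (density lborel (\<lambda>x. ennreal (exponential_density 1 x)))"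
  by (rule prob_space_exponential_density) simp

lemma prob_space_marks: "prob_space (uniform_count_measure C)"
  using finite_C C_ne by (intro prob_space_uniform_count_measure)

lemma prob_space_mark_measure: "prob_space mark_measure"
proof -
  interpret E: prob_space "density lborel (\<lambda>x. ennreal (exponential_density 1 x))" by (rule prob_space_exponential)
  interpret U: prob_space "uniform_count_measure C" by (rule prob_space_marks)
  interpret pair_prob_space "density lborel (\<lambda>x. ennreal (exponential_density 1 x))" "uniform_count_measure C" ..
  show ?thesis by unfold_locales
qed

lemma prob_space_driver: "prob_space driver"
  unfolding driver_def by (rule prob_space.prob_space_stream_space[OF prob_space_mark_measure])

lemma space_driver: "space driver = streams (UNIV \<times> C)"
  by (simp add: driver_def space_stream_space space_pair_measure space_uniform_count_measure)

lemma measurable_nn_integral_Stream: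
  assumes f[measurable]: "f \<in> borel_measurable driver" and c: "c \<in> C"
  shows "(\<lambda>g. \<integral>\<^sup>+\<omega>. f ((g, c) ## \<omega>) \<partial>driver) \<in> borel_measurable lborel"
proof -
  interpret D': prob_space "stream_space mark_measure" using prob_space_driver by (simp add: driver_def)
  have [measurable]: "f \<in> borel_measurable (stream_space mark_measure)" using assms by (simp add: driver_def)
  let ?h = "\<lambda>e. \<integral>\<^sup>+\<omega>. f (e ## \<omega>) \<partial>stream_space mark_measure"
  have h[measurable]: "?h \<in> borel_measurable mark_measure" by measurable
  have "(\<lambda>g. (g, c)) \<in> density lborel (\<lambda>x. ennreal (exponential_density 1 x)) \<rightarrow>\<^sub>M mark_measure"
    using c by (intro measurable_Pair2') (simp add: space_uniform_count_measure)
  from measurable_compose[OF this h] show ?thesis by (simp add: driver_def)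
qed

text \<open>Every computation with the stream conditions on its first gap and first mark by means of this formula.\<close>

lemma nn_integral_driver:
  assumes [measurable]: "f \<in> borel_measurable driver"
  shows "(\<integral>\<^sup>+\<omega>. f \<omega> \<partial>driver)
    = (\<integral>\<^sup>+g. ennreal (exponential_density 1 g) * (\<Sum>c\<in>C. ennreal (1 / card C) * (\<integral>\<^sup>+\<omega>. f ((g, c) ## \<omega>) \<partial>driver)) \<partial>lborel)"
proof -
  interpret E: prob_space "density lborel (\<lambda>x. ennreal (exponential_density 1 x))" by (rule prob_space_exponential)
  interpret U: prob_space "uniform_count_measure C" by (rule prob_space_marks)
  interpret D: prob_space driver by (rule prob_space_driver)
  have [measurable]: "f \<in> borel_measurable (stream_space mark_measure)" using assms by (simp add: driver_def)
  let ?h = "\<lambda>e. \<integral>\<^sup>+\<omega>. f (e ## \<omega>) \<partial>stream_space mark_measure"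
  interpret D': prob_space "stream_space mark_measure" using prob_space_driver by (simp add: driver_def)
  have h[measurable]: "?h \<in> borel_measurable mark_measure" by measurable
  have hg: "(\<lambda>g. ?h (g, c)) \<in> borel_measurable lborel" if "c \<in> C" for c
    using measurable_nn_integral_Stream[OF assms that] by (simp add: driver_def)
  have "(\<integral>\<^sup>+\<omega>. f \<omega> \<partial>driver) = (\<integral>\<^sup>+e. ?h e \<partial>mark_measure)"
    unfolding driver_def by (rule prob_space.nn_integral_stream_space[OF prob_space_mark_measure]) measurable
  also have "\<dots> = (\<integral>\<^sup>+g. \<integral>\<^sup>+c. ?h (g, c) \<partial>uniform_count_measure C \<partial>density lborel (\<lambda>x. ennreal (exponential_density 1 x)))"
    by (rule U.nn_integral_fst[symmetric]) measurable
  also have "\<dots> = (\<integral>\<^sup>+g. (\<Sum>c\<in>C. ennreal (1 / card C) * ?h (g, c)) \<partial>density lborel (\<lambda>x. ennreal (exponential_density 1 x)))"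
    by (simp add: nn_integral_uniform_count_measure finite_C)
  also have "\<dots> = (\<integral>\<^sup>+g. ennreal (exponential_density 1 g) * (\<Sum>c\<in>C. ennreal (1 / card C) * ?h (g, c)) \<partial>lborel)"
    using hg by (intro nn_integral_density) auto
  finally show ?thesis by (simp add: driver_def)
qed

lemma measurable_arrival[measurable]: "arrival k \<in> borel_measurable driver"
  unfolding arrival_def[abs_def] driver_def by measurable

lemma measurable_snth_fst[measurable]: "(\<lambda>\<omega>. fst (\<omega> !! i)) \<in> borel_measurable driver"
  unfolding driver_def by measurable

lemma measurable_snth_mark[measurable]: "(\<lambda>\<omega>. snd (\<omega> !! i)) \<in> driver \<rightarrow>\<^sub>M count_space C"
proof -
  have "(\<lambda>\<omega>. snd (\<omega> !! i)) \<in> driver \<rightarrow>\<^sub>M uniform_count_measure C"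
    unfolding driver_def by measurable
  then show ?thesis
    by (simp only: measurable_cong_sets[OF refl sets_uniform_count_measure_count_space])
qed

lemma measurable_count_is[measurable]: "Measurable.pred driver (count_is k t)"
  unfolding count_is_def[abs_def] by measurable

lemma measurable_residual[measurable]: "residual k t \<in> driver \<rightarrow>\<^sub>M driver"
  unfolding residual_def[abs_def] driver_def arrival_def by measurable

lemma measurable_good_stream[measurable]: "Measurable.pred driver good_stream"
  unfolding good_stream_def[abs_def] by measurable

lemma measurable_run_marks[measurable]:
  "x \<in> S \<Longrightarrow> run_marks F k x \<in> driver \<rightarrow>\<^sub>M count_space S"
proof (induction k arbitrary: x)
  case (Suc k)
  have stl: "stl \<in> driver \<rightarrow>\<^sub>M driver" unfolding driver_def by measurable
  have "(\<lambda>\<omega>. run_marks F k (F (snd (\<omega> !! 0)) x) (stl \<omega>)) \<in> driver \<rightarrow>\<^sub>M count_space S"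
  proof (rule measurable_compose_countable'[OF _ measurable_snth_mark])
    fix c assume "c \<in> C"
    then show "(\<lambda>\<omega>. run_marks F k (F c x) (stl \<omega>)) \<in> driver \<rightarrow>\<^sub>M count_space S"
      by (intro measurable_compose[OF stl] Suc.IH F_in Suc.prems)
  qed (use finite_C in \<open>auto intro: countable_finite\<close>)
  then show ?case by simp
next
  case 0
  have "(\<lambda>\<omega>. x) \<in> driver \<rightarrow>\<^sub>M count_space S" using 0 by simp
  then show ?case by (simp only: run_marks.simps(1)[abs_def])
qed

end

section \<open>Renewal of the driving stream at a fixed time\<close>

context uniform_walk
begin

abbreviation step_prob :: "nat \<Rightarrow> 's \<Rightarrow> 's \<Rightarrow> real" where
  "step_prob k x y \<equiv> steps_avg k (indicator {y}) x"

lemma step_prob_bounds: "x \<in> S \<Longrightarrow> 0 \<le> step_prob k x y \<and> step_prob k x y \<le> 1"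
  by (rule steps_avg_bounds) (auto simp: indicator_def)

lemma measurable_run_marks_eq[measurable]:
  "x \<in> S \<Longrightarrow> Measurable.pred driver (\<lambda>\<omega>. run_marks F k x \<omega> = y)"
  by (rule measurable_compose[OF measurable_run_marks[of x k], of "\<lambda>z. z = y" "count_space UNIV"]) simp_all

lemma Stream_in_space_driver: "c \<in> C \<Longrightarrow> (g, c) ## \<omega> \<in> space driver \<longleftrightarrow> \<omega> \<in> space driver"
  by (simp add: space_driver streams_Stream)

text \<open>The number of jumps before \<open>t\<close>, the state after them and the residual stream: the residual stream is
  independent of the rest and distributed like the whole stream. The induction on the number of jumps
  conditions on the first gap \<open>g\<close> and first mark, which reduces \<open>(k + 1, t)\<close> to \<open>(k, t - g)\<close>; for \<open>k = 0\<close> it is the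
  memorylessness of the exponential law.\<close>

lemma emeasure_count_run_residual:
  assumes A[measurable]: "A \<in> sets driver" and x: "x \<in> S"
  shows "emeasure driver {\<omega>\<in>space driver. count_is k t \<omega> \<and> run_marks F k x \<omega> = y \<and> residual k t \<omega> \<in> A}
    = ennreal (poisson_density k t * step_prob k x y) * emeasure driver A"
  using x
proof (induction k arbitrary: t x)
  case 0
  let ?H = "\<lambda>g. \<Sum>c\<in>C. ennreal (1 / card C) * (\<integral>\<^sup>+\<omega>. indicator A ((g, c) ## \<omega>) \<partial>driver)"
  let ?E = "{\<omega>\<in>space driver. count_is 0 t \<omega> \<and> run_marks F 0 x \<omega> = y \<and> residual 0 t \<omega> \<in> A}"
  have [measurable]: "?H \<in> borel_measurable lborel"
    by (intro borel_measurable_sum borel_measurable_times_ennreal measurable_nn_integral_Stream) auto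
  then have [measurable]: "?H \<in> borel_measurable borel" by simp
  have [measurable]: "?E \<in> sets driver" using 0 by measurable
  have a: "emeasure driver A = (\<integral>\<^sup>+g. ennreal (exponential_density 1 g) * ?H g \<partial>lborel)"
    by (subst nn_integral_driver[symmetric]) auto
  have "emeasure driver ?E = (\<integral>\<^sup>+\<omega>. indicator ?E \<omega> \<partial>driver)" by simp
  also have "\<dots> = (\<integral>\<^sup>+g. ennreal (exponential_density 1 g) *
      (\<Sum>c\<in>C. ennreal (1 / card C) * (\<integral>\<^sup>+\<omega>. indicator ?E ((g, c) ## \<omega>) \<partial>driver)) \<partial>lborel)"
    by (rule nn_integral_driver) simp
  also have "\<dots> = (\<integral>\<^sup>+g. ennreal (exponential_density 1 g) *
      (if 0 \<le> t \<and> t < g \<and> x = y then ?H (g - t) else 0) \<partial>lborel)"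
  proof -
    have "(\<Sum>c\<in>C. ennreal (1 / card C) * (\<integral>\<^sup>+\<omega>. indicator ?E ((g, c) ## \<omega>) \<partial>driver))
        = (if 0 \<le> t \<and> t < g \<and> x = y then ?H (g - t) else 0)" for g
    proof -
      have "(\<integral>\<^sup>+\<omega>. indicator ?E ((g, c) ## \<omega>) \<partial>driver)
          = (if 0 \<le> t \<and> t < g \<and> x = y then (\<integral>\<^sup>+\<omega>. indicator A ((g - t, c) ## \<omega>) \<partial>driver) else 0)"
        if "c \<in> C" for c
      proof (cases "0 \<le> t \<and> t < g \<and> x = y")
        case True
        then show ?thesis using that
          by (simp, intro nn_integral_cong) (auto simp: indicator_def count_is_0 residual_0 Stream_in_space_driver)
      next
        case False
        then have "(\<integral>\<^sup>+\<omega>. indicator ?E ((g, c) ## \<omega>) \<partial>driver) = (\<integral>\<^sup>+\<omega>. 0 \<partial>driver)"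
          by (intro nn_integral_cong) (auto simp: indicator_def count_is_0)
        then show ?thesis using False by auto
      qed
      then have "(\<Sum>c\<in>C. ennreal (1 / card C) * (\<integral>\<^sup>+\<omega>. indicator ?E ((g, c) ## \<omega>) \<partial>driver))
         = (\<Sum>c\<in>C. ennreal (1 / card C) * (if 0 \<le> t \<and> t < g \<and> x = y then (\<integral>\<^sup>+\<omega>. indicator A ((g - t, c) ## \<omega>) \<partial>driver) else 0))"
        by (intro sum.cong) auto
      then show ?thesis by auto
    qed
    then show ?thesis by simp
  qed
  also have "\<dots> = ennreal (poisson_density 0 t * step_prob 0 x y) * emeasure driver A"
  proof (cases "0 \<le> t \<and> x = y")
    case False
    then have "poisson_density 0 t * step_prob 0 x y = 0" by (auto simp: erlang_density_def)
    moreover have "(\<integral>\<^sup>+g. ennreal (exponential_density 1 g) * (if 0 \<le> t \<and> t < g \<and> x = y then ?H (g - t) else 0) \<partial>lborel)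
      = (\<integral>\<^sup>+g. 0 \<partial>(lborel::real measure))"
      using False by (intro nn_integral_cong) auto
    ultimately show ?thesis by simp
  next
    case True
    have "(\<integral>\<^sup>+g. ennreal (exponential_density 1 g) * (if 0 \<le> t \<and> t < g \<and> x = y then ?H (g - t) else 0) \<partial>lborel)
       = (\<integral>\<^sup>+g. ennreal (exponential_density 1 g) * (?H (g - t) * indicator {t<..} g) \<partial>lborel)"
      using True by (intro nn_integral_cong) auto
    also have "\<dots> = (\<integral>\<^sup>+g. ennreal (exponential_density 1 (t + g)) * (?H g * indicator {t<..} (t + g)) \<partial>lborel)"
      by (subst nn_integral_real_affine[where c=1 and t=t]) auto
    also have "\<dots> = (\<integral>\<^sup>+g. ennreal (exp (- t)) * (ennreal (exponential_density 1 g) * ?H g) \<partial>lborel)"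
    \<comment> \<open>The integrands differ at \<open>g = 0\<close>, where the density is positive while the first gap must exceed \<open>t\<close>.\<close>
    proof (rule nn_integral_cong_AE)
      show "AE g in lborel. ennreal (exponential_density 1 (t + g)) * (?H g * indicator {t<..} (t + g))
        = ennreal (exp (- t)) * (ennreal (exponential_density 1 g) * ?H g)"
        using AE_lborel_singleton[of 0]
      proof eventually_elim
        case (elim g)
        show ?case
        proof (cases "0 < g")
          case True
          have "exponential_density 1 (t + g) = exp (- t) * exponential_density 1 g"
            using True \<open>0 \<le> t \<and> x = y\<close> by (simp add: exponential_density_def exp_add[symmetric])
          then have "ennreal (exponential_density 1 (t + g)) = ennreal (exp (- t)) * ennreal (exponential_density 1 g)"
            by (simp add: ennreal_mult')
          then show ?thesis using True by (simp add: mult.assoc)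
        next
          case False
          then show ?thesis using elim by (simp add: exponential_density_def)
        qed
      qed
    qed
    also have "\<dots> = ennreal (exp (- t)) * emeasure driver A"
      unfolding a by (rule nn_integral_cmult) measurable
    also have "exp (- t) = poisson_density 0 t * step_prob 0 x y"
      using True by (simp add: erlang_density_def)
    finally show ?thesis .
  qed
  finally show ?case .
next
  case (Suc k)
  note x = Suc.prems
  let ?E = "\<lambda>k t x. {\<omega>\<in>space driver. count_is k t \<omega> \<and> run_marks F k x \<omega> = y \<and> residual k t \<omega> \<in> A}"
  let ?a = "emeasure driver A"
  let ?q = "ennreal (step_prob (Suc k) x y) * ?a"
  have Es: "?E k t x \<in> sets driver" if "x \<in> S" for k t x using that by measurable
  have E: "(\<integral>\<^sup>+\<omega>. indicator (?E (Suc k) t x) ((g, c) ## \<omega>) \<partial>driver)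
      = ennreal (poisson_density k (t - g) * step_prob k (F c x) y) * ?a" if c: "c \<in> C" for g c
  proof -
    have "(\<integral>\<^sup>+\<omega>. indicator (?E (Suc k) t x) ((g, c) ## \<omega>) \<partial>driver)
        = (\<integral>\<^sup>+\<omega>. indicator (?E k (t - g) (F c x)) \<omega> \<partial>driver)"
      using c by (intro nn_integral_cong) (auto simp: indicator_def count_is_Suc residual_Suc Stream_in_space_driver)
    also have "\<dots> = emeasure driver (?E k (t - g) (F c x))"
      by (rule nn_integral_indicator[OF Es[OF F_in[OF c x]]])
    also have "\<dots> = ennreal (poisson_density k (t - g) * step_prob k (F c x) y) * ?a"
      by (rule Suc.IH) (rule F_in[OF c x])
    finally show ?thesis .
  qed
  have "emeasure driver (?E (Suc k) t x) = (\<integral>\<^sup>+\<omega>. indicator (?E (Suc k) t x) \<omega> \<partial>driver)"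
    by (rule nn_integral_indicator[OF Es[OF x], symmetric])
  also have "\<dots> = (\<integral>\<^sup>+g. ennreal (exponential_density 1 g) *
      (\<Sum>c\<in>C. ennreal (1 / card C) * (\<integral>\<^sup>+\<omega>. indicator (?E (Suc k) t x) ((g, c) ## \<omega>) \<partial>driver)) \<partial>lborel)"
    by (intro nn_integral_driver borel_measurable_indicator Es x)
  also have "\<dots> = (\<integral>\<^sup>+g. (ennreal (exponential_density 1 g) * ennreal (poisson_density k (t - g))) * ?q \<partial>lborel)"
  proof (intro nn_integral_cong)
    fix g :: real
    have "(\<Sum>c\<in>C. ennreal (1 / card C) * (\<integral>\<^sup>+\<omega>. indicator (?E (Suc k) t x) ((g, c) ## \<omega>) \<partial>driver))
      = (\<Sum>c\<in>C. ennreal (1 / card C * (poisson_density k (t - g) * step_prob k (F c x) y)) * ?a)"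
    proof (intro sum.cong refl)
      fix c assume c: "c \<in> C"
      let ?v = "poisson_density k (t - g) * step_prob k (F c x) y"
      have "ennreal (1 / card C * ?v) = ennreal (1 / card C) * ennreal ?v" by (rule ennreal_mult') simp
      then show "ennreal (1 / card C) * (\<integral>\<^sup>+\<omega>. indicator (?E (Suc k) t x) ((g, c) ## \<omega>) \<partial>driver)
        = ennreal (1 / card C * ?v) * ?a" by (simp only: E[OF c] mult.assoc)
    qed
    also have "\<dots> = ennreal (\<Sum>c\<in>C. 1 / card C * (poisson_density k (t - g) * step_prob k (F c x) y)) * ?a"
      using card_C step_prob_bounds F_in x
      unfolding sum_distrib_right[symmetric] by (subst sum_ennreal) auto
    also have "(\<Sum>c\<in>C. 1 / card C * (poisson_density k (t - g) * step_prob k (F c x) y))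
      = poisson_density k (t - g) * step_prob (Suc k) x y"
      by (simp add: step_avg_def sum_distrib_left sum_divide_distrib)
    finally have "(\<Sum>c\<in>C. ennreal (1 / card C) * (\<integral>\<^sup>+\<omega>. indicator (?E (Suc k) t x) ((g, c) ## \<omega>) \<partial>driver))
      = ennreal (poisson_density k (t - g)) * ?q"
      using step_prob_bounds[OF x, of "Suc k" y] by (simp add: ennreal_mult mult.assoc del: steps_avg.simps)
    then show "ennreal (exponential_density 1 g) * (\<Sum>c\<in>C. ennreal (1 / card C) * (\<integral>\<^sup>+\<omega>. indicator (?E (Suc k) t x) ((g, c) ## \<omega>) \<partial>driver))
      = (ennreal (exponential_density 1 g) * ennreal (poisson_density k (t - g))) * ?q"
      by (simp only: mult.assoc)
  qed
  also have "\<dots> = (\<integral>\<^sup>+g. ennreal (exponential_density 1 g) * ennreal (poisson_density k (t - g)) \<partial>lborel) * ?q"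
    by (rule nn_integral_multc) measurable
  also have "\<dots> = ennreal (poisson_density (Suc k) t * step_prob (Suc k) x y) * ?a"
    unfolding nn_integral_exponential_poisson
    using step_prob_bounds[OF x, of "Suc k" y] by (simp add: ennreal_mult mult.assoc del: steps_avg.simps)
  finally show ?case .
qed

lemma steps_avg_cong:
  "(\<And>x. x \<in> S \<Longrightarrow> f x = g x) \<Longrightarrow> x \<in> S \<Longrightarrow> steps_avg k f x = steps_avg k g x"
proof (induction k arbitrary: x)
  case (Suc k)
  then show ?case using step_avg_cong[of "steps_avg k f" "steps_avg k g" x] by simp
qed simp

lemma sum_step_prob:
  assumes "Y \<subseteq> S" "x \<in> S"
  shows "(\<Sum>y\<in>Y. step_prob k x y) = steps_avg k (indicator Y) x"
proof -
  have "finite Y" using assms(1) finite_S by (rule finite_subset)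
  then have "(\<lambda>z. \<Sum>y\<in>Y. indicator {y} z) = (indicator Y :: 's \<Rightarrow> real)"
    by (auto simp: fun_eq_iff indicator_def)
  then show ?thesis using steps_avg_sum[of k "\<lambda>y. indicator {y}" Y x] by simp
qed

lemma emeasure_count_is:
  "emeasure driver {\<omega>\<in>space driver. count_is k t \<omega>} = ennreal (poisson_density k t)"
proof -
  interpret D: prob_space driver by (rule prob_space_driver)
  obtain x where x: "x \<in> S" using S_ne by auto
  let ?E = "\<lambda>y. {\<omega>\<in>space driver. count_is k t \<omega> \<and> run_marks F k x \<omega> = y \<and> residual k t \<omega> \<in> space driver}"
  have "{\<omega>\<in>space driver. count_is k t \<omega>} = (\<Union>y\<in>S. ?E y)"
    using measurable_space[OF measurable_run_marks[OF x, of k]] measurable_space[OF measurable_residual] by auto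
  also have "emeasure driver \<dots> = (\<Sum>y\<in>S. emeasure driver (?E y))"
    using x finite_S by (intro sum_emeasure[symmetric]) (auto simp: disjoint_family_on_def)
  also have "\<dots> = (\<Sum>y\<in>S. ennreal (poisson_density k t * step_prob k x y))"
    using x by (subst emeasure_count_run_residual) (auto simp: D.emeasure_space_1)
  also have "\<dots> = ennreal (poisson_density k t * (\<Sum>y\<in>S. step_prob k x y))"
    using step_prob_bounds[OF x] by (subst sum_ennreal) (auto simp: sum_distrib_left)
  also have "(\<Sum>y\<in>S. step_prob k x y) = 1"
  proof -
    have "steps_avg k (indicator S) x = 1"
      using steps_avg_bounds[of 1 "indicator S" 1 x k] x by force
    then show ?thesis using sum_step_prob[of S x k] x by simp
  qed
  finally show ?thesis by simp
qed

lemma AE_gaps_pos: "AE \<omega> in driver. \<forall>i. 0 < fst (\<omega> !! i)"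
proof -
  interpret E: prob_space "density lborel (\<lambda>x. ennreal (exponential_density 1 x))" by (rule prob_space_exponential)
  interpret U: prob_space "uniform_count_measure C" by (rule prob_space_marks)
  interpret pair_prob_space "density lborel (\<lambda>x. ennreal (exponential_density 1 x))" "uniform_count_measure C" ..
  have "AE g in density lborel (\<lambda>x. ennreal (exponential_density 1 x)). 0 < g"
    using AE_lborel_singleton[of "0::real"]
    by (subst AE_density) (auto simp: exponential_density_def elim!: eventually_mono)
  moreover have "{e\<in>space mark_measure. 0 < fst e} \<in> sets mark_measure" by measurable
  ultimately have "AE e in mark_measure. 0 < fst e"
    by (intro AE_pair_measure) auto
  then have "AE \<omega> in driver. stream_all (\<lambda>e. 0 < fst e) \<omega>"
    unfolding driver_def by (intro prob_space.AE_stream_all[OF prob_space_mark_measure]) auto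
  then show ?thesis by (simp add: sset_range)
qed

text \<open>The Poisson weights add up to 1, so at each fixed time the arrival count almost surely exists.\<close>

lemma AE_good_stream: "AE \<omega> in driver. good_stream \<omega>"
proof -
  interpret D: prob_space driver by (rule prob_space_driver)
  have "AE \<omega> in driver. \<exists>k. count_is k t \<omega>" if t: "0 \<le> t" for t
  proof -
    let ?P = "\<lambda>k. {\<omega>\<in>space driver. (\<forall>i. 0 < fst (\<omega> !! i)) \<and> count_is k t \<omega>}"
    have "emeasure driver (\<Union>k. ?P k) = (\<Sum>k. emeasure driver (?P k))"
    proof (rule suminf_emeasure[symmetric])
      show "disjoint_family ?P" using count_is_unique by (fastforce simp: disjoint_family_on_def)
    qed auto
    also have "\<dots> = (\<Sum>k. ennreal (poisson_density k t))"
    proof (intro suminf_cong)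
      fix k
      have "emeasure driver (?P k) = emeasure driver {\<omega>\<in>space driver. count_is k t \<omega>}"
        using AE_gaps_pos by (intro emeasure_eq_AE) auto
      then show "emeasure driver (?P k) = ennreal (poisson_density k t)" by (simp add: emeasure_count_is)
    qed
    also have "\<dots> = 1"
      using poisson_density_sums[OF t] by (subst suminf_ennreal2) (auto simp: sums_iff)
    finally have "AE \<omega> in driver. \<omega> \<in> (\<Union>k. ?P k)" by (intro D.AE_prob_1) (auto simp: measure_def)
    then show ?thesis by eventually_elim auto
  qed
  then have "AE \<omega> in driver. \<forall>n::nat. \<exists>k. count_is k (real n) \<omega>" by (subst AE_all_countable) auto
  with AE_gaps_pos show ?thesis unfolding good_stream_def by eventually_elim auto
qed

text \<open>Restricting the space, instead of excluding a null set in each statement, gives jump paths at every point of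
  the sample space.\<close>

definition good_driver :: "(real \<times> 'm) stream measure" where
  "good_driver = restrict_space driver {\<omega>. good_stream \<omega>}"

lemma good_sets: "{\<omega>. good_stream \<omega>} \<inter> space driver \<in> sets driver"
proof -
  have "{\<omega>\<in>space driver. good_stream \<omega>} \<in> sets driver" by measurable
  then show ?thesis by (simp add: Int_def conj_commute)
qed

lemma space_good_driver: "space good_driver = {\<omega>\<in>space driver. good_stream \<omega>}"
  by (auto simp: good_driver_def space_restrict_space)

lemma emeasure_good_driver:
  assumes "A \<in> sets driver"
  shows "emeasure good_driver {\<omega>\<in>space good_driver. \<omega> \<in> A} = emeasure driver A"
proof -
  have "emeasure good_driver {\<omega>\<in>space good_driver. \<omega> \<in> A} = emeasure driver {\<omega>\<in>space good_driver. \<omega> \<in> A}"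
    unfolding good_driver_def using good_sets
    by (intro emeasure_restrict_space) (auto simp: space_restrict_space)
  also have "\<dots> = emeasure driver A"
    using AE_good_stream AE_space[of driver]
  proof (intro emeasure_eq_AE)
    show "{\<omega>\<in>space good_driver. \<omega> \<in> A} \<in> sets driver"
    proof -
      have "{\<omega>\<in>space good_driver. \<omega> \<in> A} = {\<omega>\<in>space driver. good_stream \<omega>} \<inter> A"
        using sets.sets_into_space[OF assms] by (auto simp: space_good_driver)
      then show ?thesis using assms by simp
    qed
  qed (use assms in \<open>auto simp: space_good_driver\<close>)
  finally show ?thesis .
qed

lemma sets_good_driverD: "A \<in> sets good_driver \<Longrightarrow> A \<in> sets driver \<and> A \<subseteq> space good_driver"
  using sets.sets_into_space[of A good_driver] good_sets
  by (auto simp: good_driver_def sets_restrict_space_iff)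

lemma prob_space_good_driver: "prob_space good_driver"
proof
  show "emeasure good_driver (space good_driver) = 1"
    using emeasure_good_driver[OF sets.top] prob_space.emeasure_space_1[OF prob_space_driver]
    by (simp add: space_good_driver conj_ac cong: conj_cong)
qed

lemma measurable_good_driver: "f \<in> driver \<rightarrow>\<^sub>M N \<Longrightarrow> f \<in> good_driver \<rightarrow>\<^sub>M N"
  unfolding good_driver_def by (rule measurable_restrict_space1)

end

section \<open>The driven walk is a stationary Markov jump process\<close>

context uniform_walk
begin

lemma measurable_jump_count:
  assumes t: "0 \<le> t"
  shows "jump_count t \<in> good_driver \<rightarrow>\<^sub>M count_space UNIV"
proof (subst measurable_count_space_eq2_countable, intro conjI ballI)
  fix k :: nat
  have "jump_count t -` {k} \<inter> space good_driver = {\<omega>\<in>space good_driver. count_is k t \<omega>}"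
    using t jump_count_eq count_is_jump_count by (auto simp: space_good_driver)
  also have "\<dots> \<in> sets good_driver"
    using measurable_good_driver[OF measurable_count_is[of k t]] by (simp add: pred_def)
  finally show "jump_count t -` {k} \<inter> space good_driver \<in> sets good_driver" .
qed auto

lemma measurable_marked_path:
  assumes t: "0 \<le> t" and x: "x \<in> S"
  shows "(\<lambda>\<omega>. marked_path F t (x, \<omega>)) \<in> good_driver \<rightarrow>\<^sub>M count_space S"
  unfolding marked_path_def fst_conv snd_conv
  by (rule measurable_compose_countable[OF _ measurable_jump_count[OF t]])
    (rule measurable_good_driver[OF measurable_run_marks[OF x]])

lemma marked_path_in: "0 \<le> t \<Longrightarrow> x \<in> S \<Longrightarrow> \<omega> \<in> space good_driver \<Longrightarrow> marked_path F t (x, \<omega>) \<in> S"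
  using measurable_space[OF measurable_marked_path] by force

text \<open>The time shift of the driving stream.\<close>

definition residual_at :: "real \<Rightarrow> (real \<times> 'm) stream \<Rightarrow> (real \<times> 'm) stream" where
  "residual_at t \<omega> = residual (jump_count t \<omega>) t \<omega>"

lemma measurable_residual_at:
  assumes t: "0 \<le> t"
  shows "residual_at t \<in> good_driver \<rightarrow>\<^sub>M good_driver"
proof -
  have "residual_at t \<in> good_driver \<rightarrow>\<^sub>M driver"
    unfolding residual_at_def[abs_def]
    by (rule measurable_compose_countable[OF _ measurable_jump_count[OF t]])
      (rule measurable_good_driver[OF measurable_residual])
  moreover have "good_stream (residual_at t \<omega>)" if "\<omega> \<in> space good_driver" for \<omega>
    using that t by (auto simp: residual_at_def space_good_driver intro!: good_stream_residual count_is_jump_count)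
  ultimately show ?thesis
    unfolding good_driver_def[of ] by (intro measurable_restrict_space2) (auto simp: good_driver_def)
qed

lemma marked_path_split:
  assumes "\<omega> \<in> space good_driver" "0 \<le> t" "0 \<le> s"
  shows "marked_path F (t + s) (x, \<omega>) = marked_path F s (marked_path F t (x, \<omega>), residual_at t \<omega>)"
  using marked_path_shift[of \<omega> t s F x] assms by (simp add: space_good_driver residual_at_def)

definition trans_prob :: "real \<Rightarrow> 's \<Rightarrow> 's \<Rightarrow> real" where
  "trans_prob t x y = (\<Sum>k. poisson_density k t * step_prob k x y)"

lemma summable_trans_prob:
  assumes "0 \<le> t" "x \<in> S"
  shows "summable (\<lambda>k. poisson_density k t * step_prob k x y)"
proof (rule summable_comparison_test')
  show "summable (\<lambda>k. poisson_density k t)" using poisson_density_sums[OF assms(1)] by (rule sums_summable)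
  show "norm (poisson_density k t * step_prob k x y) \<le> poisson_density k t" if "0 \<le> k" for k
    using step_prob_bounds[OF assms(2), of k y] by (auto intro: mult_left_le)
qed

lemma trans_prob_nonneg: "0 \<le> t \<Longrightarrow> x \<in> S \<Longrightarrow> 0 \<le> trans_prob t x y"
  unfolding trans_prob_def using step_prob_bounds by (intro suminf_nonneg summable_trans_prob) auto

text \<open>The fixed-time renewal property summed over the number of jumps.\<close>

lemma measure_path_residual:
  assumes t: "0 \<le> t" and x: "x \<in> S" and A: "A \<in> sets good_driver"
  shows "measure good_driver {\<omega>\<in>space good_driver. marked_path F t (x, \<omega>) = y \<and> residual_at t \<omega> \<in> A}
    = trans_prob t x y * measure good_driver A"
proof -
  interpret G: prob_space good_driver by (rule prob_space_good_driver)
  have AD: "A \<in> sets driver" "A \<subseteq> space good_driver" using sets_good_driverD[OF A] by auto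
  let ?E = "\<lambda>k. {\<omega>\<in>space driver. count_is k t \<omega> \<and> run_marks F k x \<omega> = y \<and> residual k t \<omega> \<in> A}"
  let ?P = "\<lambda>k. {\<omega>\<in>space good_driver. \<omega> \<in> ?E k}"
  have E: "?E k \<in> sets driver" for k using x AD by measurable
  have P: "?P k \<in> sets good_driver" for k
    using measurable_good_driver[of "\<lambda>\<omega>. \<omega> \<in> ?E k" "count_space UNIV"] E[of k] by (simp add: pred_def)
  have "count_is k t \<omega> \<longleftrightarrow> jump_count t \<omega> = k" if "\<omega> \<in> space good_driver" for \<omega> k
    using that t jump_count_eq[of \<omega> k t] count_is_jump_count[of \<omega> t] by (auto simp: space_good_driver)
  then have Peq: "?P = (\<lambda>k. {\<omega>\<in>space good_driver. jump_count t \<omega> = k \<and>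
      run_marks F (jump_count t \<omega>) x \<omega> = y \<and> residual (jump_count t \<omega>) t \<omega> \<in> A})"
    by (auto simp: space_good_driver)
  have "{\<omega>\<in>space good_driver. marked_path F t (x, \<omega>) = y \<and> residual_at t \<omega> \<in> A} = (\<Union>k. ?P k)"
    unfolding Peq by (auto simp: marked_path_def residual_at_def)
  then have "emeasure good_driver {\<omega>\<in>space good_driver. marked_path F t (x, \<omega>) = y \<and> residual_at t \<omega> \<in> A}
    = emeasure good_driver (\<Union>k. ?P k)" by (simp only:)
  also have "\<dots> = (\<Sum>k. emeasure good_driver (?P k))"
  proof (rule suminf_emeasure[symmetric])
    show "disjoint_family ?P" unfolding Peq by (auto simp: disjoint_family_on_def)
  qed (use P in auto)
  also have "\<dots> = (\<Sum>k. ennreal (poisson_density k t * step_prob k x y) * emeasure driver A)"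
    by (simp only: emeasure_good_driver[OF E] emeasure_count_run_residual[OF AD(1) x])
  also have "\<dots> = (\<Sum>k. ennreal (poisson_density k t * step_prob k x y)) * emeasure driver A"
    by (rule ennreal_suminf_multc)
  also have "(\<Sum>k. ennreal (poisson_density k t * step_prob k x y)) = ennreal (trans_prob t x y)"
    unfolding trans_prob_def using step_prob_bounds[OF x] summable_trans_prob[OF t x]
    by (intro suminf_ennreal2) auto
  also have "emeasure driver A = emeasure good_driver A"
    using emeasure_good_driver[OF AD(1)] AD(2) by (simp add: Int_absorb1 Collect_conj_eq)
  finally show ?thesis
    using trans_prob_nonneg[OF t x] by (simp add: measure_def enn2real_mult)
qed

text \<open>Law of total probability at time \<open>t\<close>. The future event may depend on the state reached.\<close>

lemma measure_path_residual_cases: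
  assumes t: "0 \<le> t" and x: "x \<in> S" and Y: "Y \<subseteq> S" and A: "\<And>y. y \<in> Y \<Longrightarrow> A y \<in> sets good_driver"
  shows "measure good_driver {\<omega>\<in>space good_driver. marked_path F t (x, \<omega>) \<in> Y \<and> residual_at t \<omega> \<in> A (marked_path F t (x, \<omega>))}
    = (\<Sum>y\<in>Y. trans_prob t x y * measure good_driver (A y))"
    and "{\<omega>\<in>space good_driver. marked_path F t (x, \<omega>) \<in> Y \<and> residual_at t \<omega> \<in> A (marked_path F t (x, \<omega>))} \<in> sets good_driver"
proof -
  interpret G: prob_space good_driver by (rule prob_space_good_driver)
  have fin: "finite Y" using Y finite_S by (rule finite_subset)
  let ?P = "\<lambda>y. {\<omega>\<in>space good_driver. marked_path F t (x, \<omega>) = y \<and> residual_at t \<omega> \<in> A y}"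
  have P: "?P y \<in> sets good_driver" if "y \<in> Y" for y
  proof -
    have "?P y = ((\<lambda>\<omega>. marked_path F t (x, \<omega>)) -` {y} \<inter> space good_driver) \<inter> (residual_at t -` A y \<inter> space good_driver)"
      by auto
    moreover have "(\<lambda>\<omega>. marked_path F t (x, \<omega>)) -` {y} \<inter> space good_driver \<in> sets good_driver"
      using that Y by (intro measurable_sets[OF measurable_marked_path[OF t x]]) auto
    moreover have "residual_at t -` A y \<inter> space good_driver \<in> sets good_driver"
      using that A by (intro measurable_sets[OF measurable_residual_at[OF t]]) auto
    ultimately show ?thesis by simp
  qed
  have eq: "{\<omega>\<in>space good_driver. marked_path F t (x, \<omega>) \<in> Y \<and> residual_at t \<omega> \<in> A (marked_path F t (x, \<omega>))} = (\<Union>y\<in>Y. ?P y)"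
    by auto
  show "{\<omega>\<in>space good_driver. marked_path F t (x, \<omega>) \<in> Y \<and> residual_at t \<omega> \<in> A (marked_path F t (x, \<omega>))} \<in> sets good_driver"
    unfolding eq using fin P by (intro sets.finite_UN) auto
  have "measure good_driver (\<Union>y\<in>Y. ?P y) = (\<Sum>y\<in>Y. measure good_driver (?P y))"
    using fin P by (intro G.finite_measure_finite_Union) (auto simp: disjoint_family_on_def)
  also have "\<dots> = (\<Sum>y\<in>Y. trans_prob t x y * measure good_driver (A y))"
    using measure_path_residual[OF t x] A by (intro sum.cong) auto
  finally show "measure good_driver {\<omega>\<in>space good_driver. marked_path F t (x, \<omega>) \<in> Y \<and> residual_at t \<omega> \<in> A (marked_path F t (x, \<omega>))}
    = (\<Sum>y\<in>Y. trans_prob t x y * measure good_driver (A y))" unfolding eq .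
qed

text \<open>Transition probabilities are doubly stochastic because each mark permutes the states.\<close>

lemma sum_trans_prob_start:
  assumes "0 \<le> t" "y \<in> S"
  shows "(\<Sum>x\<in>S. trans_prob t x y) = 1"
proof -
  have "(\<Sum>x\<in>S. trans_prob t x y) = (\<Sum>k. \<Sum>x\<in>S. poisson_density k t * step_prob k x y)"
    unfolding trans_prob_def using summable_trans_prob[OF assms(1)] by (intro suminf_sum[symmetric]) auto
  also have "(\<lambda>k. \<Sum>x\<in>S. poisson_density k t * step_prob k x y) = (\<lambda>k. poisson_density k t)"
    using assms(2) finite_S
    by (simp add: sum_distrib_left[symmetric] sum_steps_avg) (simp add: indicator_def of_bool_def)
  also have "(\<Sum>k. poisson_density k t) = 1" using poisson_density_sums[OF assms(1)] by (simp add: sums_iff)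
  finally show ?thesis .
qed

definition walk_space :: "('s \<times> (real \<times> 'm) stream) measure" where
  "walk_space = uniform_count_measure S \<Otimes>\<^sub>M good_driver"

lemma space_walk_space: "space walk_space = S \<times> space good_driver"
  by (simp add: walk_space_def space_pair_measure space_uniform_count_measure)

lemma prob_space_uniform_S: "prob_space (uniform_count_measure S)"
  using finite_S S_ne by (intro prob_space_uniform_count_measure)

lemma prob_space_walk_space: "prob_space walk_space"
proof -
  interpret G: prob_space good_driver by (rule prob_space_good_driver)
  interpret U: prob_space "uniform_count_measure S" by (rule prob_space_uniform_S)
  interpret pair_prob_space "uniform_count_measure S" good_driver ..
  show ?thesis unfolding walk_space_def by unfold_locales
qed

lemma walk_space_events:
  assumes "\<And>x. x \<in> S \<Longrightarrow> {\<omega>\<in>space good_driver. P (x, \<omega>)} \<in> sets good_driver"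
  shows "{z\<in>space walk_space. P z} \<in> sets walk_space"
    and "measure walk_space {z\<in>space walk_space. P z}
      = (\<Sum>x\<in>S. measure good_driver {\<omega>\<in>space good_driver. P (x, \<omega>)}) / card S"
proof -
  interpret G: prob_space good_driver by (rule prob_space_good_driver)
  let ?E = "\<lambda>x. {\<omega>\<in>space good_driver. P (x, \<omega>)}"
  have eq: "{z\<in>space walk_space. P z} = (\<Union>x\<in>S. {x} \<times> ?E x)"
    by (auto simp: space_walk_space)
  show m: "{z\<in>space walk_space. P z} \<in> sets walk_space"
  proof -
    have "(\<Union>x\<in>S. {x} \<times> ?E x) \<in> sets walk_space"
      unfolding walk_space_def using assms finite_S
      by (intro sets.finite_UN pair_measureI) (auto simp: sets_uniform_count_measure)
    then show ?thesis by (simp only: eq)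
  qed
  have "emeasure walk_space {z\<in>space walk_space. P z}
    = (\<integral>\<^sup>+x. emeasure good_driver (Pair x -` {z\<in>space walk_space. P z}) \<partial>uniform_count_measure S)"
    using m unfolding walk_space_def by (rule G.emeasure_pair_measure_alt)
  also have "\<dots> = (\<Sum>x\<in>S. ennreal (1 / card S) * emeasure good_driver (Pair x -` {z\<in>space walk_space. P z}))"
    using finite_S by (rule nn_integral_uniform_count_measure)
  also have "\<dots> = (\<Sum>x\<in>S. ennreal (1 / card S * measure good_driver (?E x)))"
  proof (intro sum.cong refl)
    fix x assume "x \<in> S"
    then have "Pair x -` {z\<in>space walk_space. P z} = ?E x" by (auto simp: space_walk_space)
    then show "ennreal (1 / card S) * emeasure good_driver (Pair x -` {z\<in>space walk_space. P z})
      = ennreal (1 / card S * measure good_driver (?E x))"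
      by (simp only: G.emeasure_eq_measure ennreal_mult''[symmetric] measure_nonneg)
  qed
  also have "\<dots> = ennreal (\<Sum>x\<in>S. 1 / card S * measure good_driver (?E x))"
    by (rule sum_ennreal) simp
  finally show "measure walk_space {z\<in>space walk_space. P z}
      = (\<Sum>x\<in>S. measure good_driver {\<omega>\<in>space good_driver. P (x, \<omega>)}) / card S"
    by (simp add: measure_def sum_nonneg sum_divide_distrib)
qed

context
  fixes S' :: "'t set" and h :: "'s \<Rightarrow> 't" and G' :: "('t \<Rightarrow> real) \<Rightarrow> 't \<Rightarrow> real"
  assumes finite_S': "finite S'" and h: "\<And>x. x \<in> S \<Longrightarrow> h x \<in> S'"
    and G': "\<And>f x. x \<in> S \<Longrightarrow> G' f (h x) = step_avg (f \<circ> h) x - f (h x)"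
begin

text \<open>The probability to be in the fibre of \<open>b\<close> depends on the starting point \<open>x\<close> only through \<open>h x\<close>, because the
  generator of the walk projects to \<open>G'\<close>.\<close>

lemma semigroup_eq_trans_prob:
  assumes t: "0 \<le> t" and x: "x \<in> S"
  shows "(\<Sum>y\<in>{y\<in>S. h y = b}. trans_prob t x y) = semigroup_of G' t (indicator {b}) (h x)"
proof -
  let ?Y = "{y\<in>S. h y = b}"
  have "(\<Sum>y\<in>?Y. trans_prob t x y) = (\<Sum>k. \<Sum>y\<in>?Y. poisson_density k t * step_prob k x y)"
    unfolding trans_prob_def using summable_trans_prob[OF t x] by (intro suminf_sum[symmetric]) auto
  also have "(\<lambda>k. \<Sum>y\<in>?Y. poisson_density k t * step_prob k x y)
    = (\<lambda>k. poisson_density k t * steps_avg k (indicator {b} \<circ> h) x)"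
  proof
    fix k
    have "(\<Sum>y\<in>?Y. step_prob k x y) = steps_avg k (indicator ?Y) x"
      using x by (intro sum_step_prob) auto
    also have "\<dots> = steps_avg k (indicator {b} \<circ> h) x"
      using x by (intro steps_avg_cong) (auto simp: indicator_def)
    finally show "(\<Sum>y\<in>?Y. poisson_density k t * step_prob k x y)
        = poisson_density k t * steps_avg k (indicator {b} \<circ> h) x"
      by (simp add: sum_distrib_left[symmetric])
  qed
  also have "(\<Sum>k. poisson_density k t * steps_avg k (indicator {b} \<circ> h) x) = semigroup_of G' t (indicator {b}) (h x)"
    using semigroup_eq[where h=h and G'=G', OF G' x t, of "indicator {b}"] by (simp add: sums_iff)
  finally show ?thesis .
qed

lemma path_event_sets:
  assumes "finite I" "\<And>i. i \<in> I \<Longrightarrow> 0 \<le> \<tau> i" "x \<in> S"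
  shows "{\<omega>\<in>space good_driver. \<forall>i\<in>I. h (marked_path F (\<tau> i) (x, \<omega>)) = a i} \<in> sets good_driver"
proof -
  have "{\<omega>\<in>space good_driver. h (marked_path F (\<tau> i) (x, \<omega>)) = a i} \<in> sets good_driver" if "i \<in> I" for i
  proof -
    have "{\<omega>\<in>space good_driver. h (marked_path F (\<tau> i) (x, \<omega>)) = a i}
       = (\<lambda>\<omega>. marked_path F (\<tau> i) (x, \<omega>)) -` {y\<in>S. h y = a i} \<inter> space good_driver"
      using marked_path_in assms that by auto
    also have "\<dots> \<in> sets good_driver"
      using assms that by (intro measurable_sets[OF measurable_marked_path]) auto
    finally show ?thesis .
  qed
  then show ?thesis using assms(1) by (intro sets.sets_Collect_finite_All) auto
qed

lemma path_event_sets_single: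
  assumes "0 \<le> t" "x \<in> S"
  shows "{\<omega>\<in>space good_driver. h (marked_path F t (x, \<omega>)) = b} \<in> sets good_driver"
proof -
  have "{\<omega>\<in>space good_driver. \<forall>i\<in>{0::nat}. h (marked_path F t (x, \<omega>)) = b} \<in> sets good_driver"
    by (rule path_event_sets) (use assms in auto)
  then show ?thesis by simp
qed

text \<open>Renewal at the first observation time turns the statement for \<open>m + 1\<close> observation times into the one for
  \<open>m\<close>, from a new starting point. The last factor depends only on the last observed value and can be pulled out of
  the sum over starting points.\<close>

lemma markov_from_point:
  fixes m :: nat and \<tau> :: "nat \<Rightarrow> real"
  assumes x: "x \<in> S" and "0 \<le> \<tau> 0" "mono_on {..m} \<tau>" "0 \<le> t"
  shows "measure good_driver {\<omega>\<in>space good_driver. (\<forall>i\<le>m. h (marked_path F (\<tau> i) (x, \<omega>)) = a i) \<and>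
            h (marked_path F (\<tau> m + t) (x, \<omega>)) = b}
    = measure good_driver {\<omega>\<in>space good_driver. \<forall>i\<le>m. h (marked_path F (\<tau> i) (x, \<omega>)) = a i}
      * semigroup_of G' t (indicator {b}) (a m)"
proof -
  interpret G: prob_space good_driver by (rule prob_space_good_driver)
  show ?thesis
  using assms(1-3)
  proof (induction m arbitrary: x \<tau> a)
    case 0
    let ?Y = "{y\<in>S. h y = a 0}"
    let ?A = "\<lambda>y. {\<omega>\<in>space good_driver. h (marked_path F t (y, \<omega>)) = b}"
    have A: "?A y \<in> sets good_driver" if "y \<in> S" for y
      by (rule path_event_sets_single[OF \<open>0 \<le> t\<close> that])
    have mA: "measure good_driver (?A y) = semigroup_of G' t (indicator {b}) (h y)" if y: "y \<in> S" for y
    proof -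
      have "?A y = {\<omega>\<in>space good_driver. marked_path F t (y, \<omega>) \<in> {z\<in>S. h z = b} \<and> residual_at t \<omega> \<in> space good_driver}"
        using marked_path_in[OF \<open>0 \<le> t\<close> y] measurable_space[OF measurable_residual_at[OF \<open>0 \<le> t\<close>]] by auto
      then show ?thesis
        using measure_path_residual_cases(1)[OF \<open>0 \<le> t\<close> y, of "{z\<in>S. h z = b}" "\<lambda>_. space good_driver"]
          semigroup_eq_trans_prob[OF \<open>0 \<le> t\<close> y, of b] by (simp add: G.prob_space)
    qed
    have "{\<omega>\<in>space good_driver. (\<forall>i\<le>0. h (marked_path F (\<tau> i) (x, \<omega>)) = a i) \<and> h (marked_path F (\<tau> 0 + t) (x, \<omega>)) = b}
      = {\<omega>\<in>space good_driver. marked_path F (\<tau> 0) (x, \<omega>) \<in> ?Y \<and> residual_at (\<tau> 0) \<omega> \<in> ?A (marked_path F (\<tau> 0) (x, \<omega>))}"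
      using 0 \<open>0 \<le> t\<close> marked_path_in measurable_space[OF measurable_residual_at] by (auto simp: marked_path_split)
    then have 1: "measure good_driver {\<omega>\<in>space good_driver. (\<forall>i\<le>0. h (marked_path F (\<tau> i) (x, \<omega>)) = a i) \<and> h (marked_path F (\<tau> 0 + t) (x, \<omega>)) = b}
      = (\<Sum>y\<in>?Y. trans_prob (\<tau> 0) x y * measure good_driver (?A y))"
      using measure_path_residual_cases(1)[of "\<tau> 0" x ?Y ?A] 0 A by simp
    have "{\<omega>\<in>space good_driver. \<forall>i\<le>0. h (marked_path F (\<tau> i) (x, \<omega>)) = a i}
      = {\<omega>\<in>space good_driver. marked_path F (\<tau> 0) (x, \<omega>) \<in> ?Y \<and> residual_at (\<tau> 0) \<omega> \<in> space good_driver}"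
      using 0 marked_path_in measurable_space[OF measurable_residual_at] by auto
    then have 2: "measure good_driver {\<omega>\<in>space good_driver. \<forall>i\<le>0. h (marked_path F (\<tau> i) (x, \<omega>)) = a i}
      = (\<Sum>y\<in>?Y. trans_prob (\<tau> 0) x y)"
      using measure_path_residual_cases(1)[of "\<tau> 0" x ?Y "\<lambda>_. space good_driver"] 0 by (simp add: G.prob_space)
    show ?case unfolding 1 2 by (simp add: mA sum_distrib_right)
  next
    case (Suc m)
    let ?Y = "{y\<in>S. h y = a 0}"
    let ?\<tau> = "\<lambda>i. \<tau> (Suc i) - \<tau> 0"
    have mono: "\<tau> i \<le> \<tau> j" if "i \<le> j" "j \<le> Suc m" for i j
      using Suc.prems(3) that by (auto simp: mono_on_def)
    let ?A = "\<lambda>y. {\<omega>\<in>space good_driver. \<forall>i\<le>m. h (marked_path F (?\<tau> i) (y, \<omega>)) = a (Suc i)}"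
    let ?B = "\<lambda>y. {\<omega>\<in>space good_driver. (\<forall>i\<le>m. h (marked_path F (?\<tau> i) (y, \<omega>)) = a (Suc i)) \<and>
       h (marked_path F (?\<tau> m + t) (y, \<omega>)) = b}"
    have \<tau>0: "0 \<le> ?\<tau> i" if "i \<le> m" for i using mono[of 0 "Suc i"] that by simp
    have A: "?A y \<in> sets good_driver" if "y \<in> S" for y
    proof -
      have "{\<omega>\<in>space good_driver. \<forall>i\<in>{..m}. h (marked_path F (?\<tau> i) (y, \<omega>)) = a (Suc i)} \<in> sets good_driver"
        by (rule path_event_sets) (use \<tau>0 that in auto)
      then show ?thesis by (simp only: Ball_def atMost_iff)
    qed
    have B: "?B y \<in> sets good_driver" if "y \<in> S" for y
    proof -
      have eq: "?B y = ?A y \<inter> {\<omega>\<in>space good_driver. h (marked_path F (?\<tau> m + t) (y, \<omega>)) = b}" by auto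
      have "{\<omega>\<in>space good_driver. h (marked_path F (?\<tau> m + t) (y, \<omega>)) = b} \<in> sets good_driver"
        using \<tau>0[of m] \<open>0 \<le> t\<close> that by (intro path_event_sets_single) auto
      from sets.Int[OF A[OF that] this] show ?thesis unfolding eq .
    qed
    have IH: "measure good_driver (?B y) = measure good_driver (?A y) * semigroup_of G' t (indicator {b}) (a (Suc m))"
      if "y \<in> S" for y
      using \<tau>0 mono that by (intro Suc.IH[of y ?\<tau> "\<lambda>i. a (Suc i)"]) (auto intro!: mono_onI)
    have all: "(\<forall>i\<le>Suc m. P i) \<longleftrightarrow> P 0 \<and> (\<forall>i\<le>m. P (Suc i))" for P
      by (metis Suc_le_mono le0 not0_implies_Suc)
    have sp: "marked_path F (\<tau> (Suc i)) (x, \<omega>) = marked_path F (?\<tau> i) (marked_path F (\<tau> 0) (x, \<omega>), residual_at (\<tau> 0) \<omega>)"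
      if "i \<le> m" "\<omega> \<in> space good_driver" for i \<omega>
      using marked_path_split[OF that(2) Suc.prems(2) \<tau>0[OF that(1)], of x] by simp
    have sp2: "marked_path F (\<tau> (Suc m) + t) (x, \<omega>) = marked_path F (?\<tau> m + t) (marked_path F (\<tau> 0) (x, \<omega>), residual_at (\<tau> 0) \<omega>)"
      if "\<omega> \<in> space good_driver" for \<omega>
    proof -
      have "\<tau> 0 + (?\<tau> m + t) = \<tau> (Suc m) + t" by simp
      then show ?thesis
        using marked_path_split[OF that Suc.prems(2), of "?\<tau> m + t" x] \<open>0 \<le> t\<close> \<tau>0[of m] by simp
    qed
    have inY: "h (marked_path F (\<tau> 0) (x, \<omega>)) = a 0 \<longleftrightarrow> marked_path F (\<tau> 0) (x, \<omega>) \<in> ?Y"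
      if "\<omega> \<in> space good_driver" for \<omega>
      using marked_path_in[OF Suc.prems(2,1) that] by simp
    have res: "residual_at (\<tau> 0) \<omega> \<in> space good_driver" if "\<omega> \<in> space good_driver" for \<omega>
      using measurable_space[OF measurable_residual_at[OF Suc.prems(2)] that] .
    let ?x = "\<lambda>\<omega>. marked_path F (\<tau> 0) (x, \<omega>)"
    have e1: "(\<forall>i\<le>Suc m. h (marked_path F (\<tau> i) (x, \<omega>)) = a i) \<longleftrightarrow> ?x \<omega> \<in> ?Y \<and> residual_at (\<tau> 0) \<omega> \<in> ?A (?x \<omega>)"
      if \<omega>: "\<omega> \<in> space good_driver" for \<omega>
    proof -
      have "(\<forall>i\<le>m. h (marked_path F (\<tau> (Suc i)) (x, \<omega>)) = a (Suc i))
        \<longleftrightarrow> (\<forall>i\<le>m. h (marked_path F (?\<tau> i) (?x \<omega>, residual_at (\<tau> 0) \<omega>)) = a (Suc i))"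
        by (intro iff_allI imp_cong refl) (simp only: sp[OF _ \<omega>])
      then show ?thesis unfolding all inY[OF \<omega>] using res[OF \<omega>] by (simp only: mem_Collect_eq simp_thms)
    qed
    have e2: "(\<forall>i\<le>Suc m. h (marked_path F (\<tau> i) (x, \<omega>)) = a i) \<and> h (marked_path F (\<tau> (Suc m) + t) (x, \<omega>)) = b
        \<longleftrightarrow> ?x \<omega> \<in> ?Y \<and> residual_at (\<tau> 0) \<omega> \<in> ?B (?x \<omega>)"
      if \<omega>: "\<omega> \<in> space good_driver" for \<omega>
      unfolding e1[OF \<omega>] sp2[OF \<omega>] by (simp only: mem_Collect_eq conj_assoc)
    have "measure good_driver {\<omega>\<in>space good_driver. (\<forall>i\<le>Suc m. h (marked_path F (\<tau> i) (x, \<omega>)) = a i) \<and> h (marked_path F (\<tau> (Suc m) + t) (x, \<omega>)) = b}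
      = measure good_driver {\<omega>\<in>space good_driver. ?x \<omega> \<in> ?Y \<and> residual_at (\<tau> 0) \<omega> \<in> ?B (?x \<omega>)}"
      by (intro arg_cong[of _ _ "measure good_driver"] Collect_cong conj_cong refl e2)
    also have "\<dots> = (\<Sum>y\<in>?Y. trans_prob (\<tau> 0) x y * measure good_driver (?B y))"
    proof (rule measure_path_residual_cases(1)[OF Suc.prems(2,1)])
      show "?B y \<in> sets good_driver" if "y \<in> ?Y" for y by (rule B) (use that in simp)
    qed simp
    finally have 1: "measure good_driver {\<omega>\<in>space good_driver. (\<forall>i\<le>Suc m. h (marked_path F (\<tau> i) (x, \<omega>)) = a i) \<and> h (marked_path F (\<tau> (Suc m) + t) (x, \<omega>)) = b}
      = (\<Sum>y\<in>?Y. trans_prob (\<tau> 0) x y * measure good_driver (?B y))" .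
    have "measure good_driver {\<omega>\<in>space good_driver. (\<forall>i\<le>Suc m. h (marked_path F (\<tau> i) (x, \<omega>)) = a i)}
      = measure good_driver {\<omega>\<in>space good_driver. ?x \<omega> \<in> ?Y \<and> residual_at (\<tau> 0) \<omega> \<in> ?A (?x \<omega>)}"
      by (intro arg_cong[of _ _ "measure good_driver"] Collect_cong conj_cong refl e1)
    also have "\<dots> = (\<Sum>y\<in>?Y. trans_prob (\<tau> 0) x y * measure good_driver (?A y))"
    proof (rule measure_path_residual_cases(1)[OF Suc.prems(2,1)])
      show "?A y \<in> sets good_driver" if "y \<in> ?Y" for y by (rule A) (use that in simp)
    qed simp
    finally have 2: "measure good_driver {\<omega>\<in>space good_driver. (\<forall>i\<le>Suc m. h (marked_path F (\<tau> i) (x, \<omega>)) = a i)}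
      = (\<Sum>y\<in>?Y. trans_prob (\<tau> 0) x y * measure good_driver (?A y))" .
    show ?case unfolding 1 2 by (simp add: IH sum_distrib_right mult.assoc)
  qed
qed

text \<open>The walk observed through \<open>h\<close>, started from the uniform law. It is stationary because a time shift replaces the starting point by
  the state at time \<open>s\<close>, which is again uniform, and the stream by the residual stream, which has the same
  law and is independent of that state.\<close>

theorem stationary_markov_jump_process_walk:
  "stationary_markov_jump_process walk_space S' G'
     (distr (uniform_count_measure S) (count_space S') h) (\<lambda>t z. h (marked_path F t z))"
  unfolding stationary_markov_jump_process_def
proof (intro conjI)
  interpret G: prob_space good_driver by (rule prob_space_good_driver)
  interpret U: prob_space "uniform_count_measure S" by (rule prob_space_uniform_S)
  have meas: "(\<lambda>z. h (marked_path F t z)) \<in> walk_space \<rightarrow>\<^sub>M count_space S'" if t: "0 \<le> t" for t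
  proof (subst measurable_count_space_eq2[OF finite_S'], intro conjI ballI)
    show "(\<lambda>z. h (marked_path F t z)) \<in> space walk_space \<rightarrow> S'"
      using marked_path_in[OF t] h by (auto simp: space_walk_space)
    fix b assume "b \<in> S'"
    have "(\<lambda>z. h (marked_path F t z)) -` {b} \<inter> space walk_space = {z\<in>space walk_space. h (marked_path F t z) = b}"
      by auto
    also have "\<dots> \<in> sets walk_space"
      using t by (intro walk_space_events(1) path_event_sets_single)
    finally show "(\<lambda>z. h (marked_path F t z)) -` {b} \<inter> space walk_space \<in> sets walk_space" .
  qed
  show "markov_jump_process walk_space S' G' (\<lambda>t z. h (marked_path F t z))"
    unfolding markov_jump_process_def
  proof (intro conjI allI impI ballI)
    show "prob_space walk_space" by (rule prob_space_walk_space)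
    show "finite S'" by (rule finite_S')
    show "(\<lambda>z. h (marked_path F t z)) \<in> walk_space \<rightarrow>\<^sub>M count_space S'" if "0 \<le> t" for t
      by (rule meas[OF that])
    fix z assume z: "z \<in> space walk_space"
    obtain x \<omega> where z2: "z = (x, \<omega>)" by (cases z)
    then have "jump_path (\<lambda>t. marked_path F t (x, \<omega>))"
      using z by (intro jump_path_marked_path) (auto simp: space_walk_space space_good_driver)
    then show "jump_path (\<lambda>t. h (marked_path F t z))"
      unfolding z2 by (rule jump_path_map)
  next
    fix m :: nat and \<tau> :: "nat \<Rightarrow> real" and a and t :: real and b
    assume \<tau>: "0 \<le> \<tau> 0" "mono_on {..m} \<tau>" and t: "0 \<le> t"
    have \<tau>0: "0 \<le> \<tau> i" if "i \<le> m" for i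
      using order_trans[OF \<tau>(1) mono_onD[OF \<tau>(2), of 0 i]] that by simp
    have 1: "{\<omega>\<in>space good_driver. \<forall>i\<le>m. h (marked_path F (\<tau> i) (x, \<omega>)) = a i} \<in> sets good_driver"
      if "x \<in> S" for x
    proof -
      have "{\<omega>\<in>space good_driver. \<forall>i\<in>{..m}. h (marked_path F (\<tau> i) (x, \<omega>)) = a i} \<in> sets good_driver"
        by (rule path_event_sets) (use \<tau>0 that in auto)
      then show ?thesis by (simp only: Ball_def atMost_iff)
    qed
    have 2: "{\<omega>\<in>space good_driver. (\<forall>i\<le>m. h (marked_path F (\<tau> i) (x, \<omega>)) = a i) \<and> h (marked_path F (\<tau> m + t) (x, \<omega>)) = b}
      \<in> sets good_driver" if x: "x \<in> S" for x
    proof -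
      have "{\<omega>\<in>space good_driver. h (marked_path F (\<tau> m + t) (x, \<omega>)) = b} \<in> sets good_driver"
        using \<tau>0[of m] t x by (intro path_event_sets_single) auto
      from sets.Int[OF 1[OF x] this] show ?thesis
        by (rule back_subst[of "\<lambda>X. X \<in> sets good_driver"]) blast
    qed
    show "\<P>(z in walk_space. (\<forall>i\<le>m. h (marked_path F (\<tau> i) z) = a i) \<and> h (marked_path F (\<tau> m + t) z) = b)
      = \<P>(z in walk_space. \<forall>i\<le>m. h (marked_path F (\<tau> i) z) = a i) * semigroup_of G' t (indicator {b}) (a m)"
    proof -
      have P1: "\<P>(z in walk_space. \<forall>i\<le>m. h (marked_path F (\<tau> i) z) = a i) =
        (\<Sum>x\<in>S. measure good_driver {\<omega>\<in>space good_driver. \<forall>i\<le>m. h (marked_path F (\<tau> i) (x, \<omega>)) = a i}) / card S"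
        by (intro walk_space_events(2) 1)
      have P2: "\<P>(z in walk_space. (\<forall>i\<le>m. h (marked_path F (\<tau> i) z) = a i) \<and> h (marked_path F (\<tau> m + t) z) = b) =
        (\<Sum>x\<in>S. measure good_driver {\<omega>\<in>space good_driver. (\<forall>i\<le>m. h (marked_path F (\<tau> i) (x, \<omega>)) = a i) \<and>
           h (marked_path F (\<tau> m + t) (x, \<omega>)) = b}) / card S"
        by (intro walk_space_events(2) 2)
      show ?thesis unfolding P1 P2 by (simp add: markov_from_point[OF _ \<tau> t] sum_distrib_right)
    qed
  qed
  show "distr walk_space (count_space S') (\<lambda>z. h (marked_path F 0 z)) = distr (uniform_count_measure S) (count_space S') h"
  proof -
    have 0: "marked_path F 0 z = fst z" if "z \<in> space walk_space" for z
    proof -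
      have g: "good_stream (snd z)" using that by (auto simp: space_walk_space space_good_driver)
      then have "count_is 0 0 (snd z)" by (simp add: count_is_0 good_stream_def) (metis snth.simps(1))
      then show ?thesis using jump_count_eq[OF g] by (simp add: marked_path_def)
    qed
    have hm: "h \<in> uniform_count_measure S \<rightarrow>\<^sub>M count_space S'"
      using h by (auto simp: measurable_def space_uniform_count_measure sets_uniform_count_measure)
    have "distr walk_space (count_space S') (\<lambda>z. h (marked_path F 0 z)) = distr walk_space (count_space S') (h \<circ> fst)"
      by (rule distr_cong) (simp_all add: 0)
    also have "\<dots> = distr (distr walk_space (uniform_count_measure S) fst) (count_space S') h"
      by (rule distr_distr[symmetric, OF hm]) (simp add: walk_space_def)
    also have "distr walk_space (uniform_count_measure S) fst = uniform_count_measure S"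
    proof -
      interpret pair_prob_space "uniform_count_measure S" good_driver ..
      show ?thesis unfolding walk_space_def by (rule G.distr_pair_fst)
    qed
    finally show ?thesis .
  qed
  show "stationary_process walk_space S' (\<lambda>t z. h (marked_path F t z))"
    unfolding stationary_process_def
  proof (intro allI impI)
    fix m :: nat and \<tau> :: "nat \<Rightarrow> real" and a and s :: real
    assume \<tau>: "\<forall>i<m. 0 \<le> \<tau> i \<and> a i \<in> S'" and s: "0 \<le> s"
    let ?A = "\<lambda>y. {\<omega>\<in>space good_driver. \<forall>i<m. h (marked_path F (\<tau> i) (y, \<omega>)) = a i}"
    have A: "?A y \<in> sets good_driver" if "y \<in> S" for y
    proof -
      have "{\<omega>\<in>space good_driver. \<forall>i\<in>{..<m}. h (marked_path F (\<tau> i) (y, \<omega>)) = a i} \<in> sets good_driver"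
        by (rule path_event_sets) (use \<tau> that in auto)
      then show ?thesis by (simp only: Ball_def lessThan_iff)
    qed
    have eq: "{\<omega>\<in>space good_driver. \<forall>i<m. h (marked_path F (\<tau> i + s) (x, \<omega>)) = a i}
      = {\<omega>\<in>space good_driver. marked_path F s (x, \<omega>) \<in> S \<and> residual_at s \<omega> \<in> ?A (marked_path F s (x, \<omega>))}"
      if x: "x \<in> S" for x
    proof -
      have "marked_path F (\<tau> i + s) (x, \<omega>) = marked_path F (\<tau> i) (marked_path F s (x, \<omega>), residual_at s \<omega>)"
        if "\<omega> \<in> space good_driver" "i < m" for \<omega> i
        using marked_path_split[OF that(1) s, of "\<tau> i" x] \<tau> that by (simp add: add.commute)
      then show ?thesis
        using marked_path_in[OF s x] measurable_space[OF measurable_residual_at[OF s]] by auto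
    qed
    note L = measure_path_residual_cases[OF s _ order_refl, of _ ?A, OF _ A]
    have "\<P>(z in walk_space. \<forall>i<m. h (marked_path F (\<tau> i + s) z) = a i)
       = (\<Sum>x\<in>S. measure good_driver {\<omega>\<in>space good_driver. \<forall>i<m. h (marked_path F (\<tau> i + s) (x, \<omega>)) = a i}) / card S"
      using L(2) by (intro walk_space_events(2)) (simp only: eq)
    also have "\<dots> = (\<Sum>x\<in>S. \<Sum>y\<in>S. trans_prob s x y * measure good_driver (?A y)) / card S"
      using L(1) by (intro arg_cong2[where f="(/)"] sum.cong refl) (simp only: eq)
    also have "(\<Sum>x\<in>S. \<Sum>y\<in>S. trans_prob s x y * measure good_driver (?A y))
       = (\<Sum>y\<in>S. (\<Sum>x\<in>S. trans_prob s x y) * measure good_driver (?A y))"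
      by (subst sum.swap) (simp add: sum_distrib_right)
    also have "\<dots> = (\<Sum>y\<in>S. measure good_driver (?A y))"
      by (simp add: sum_trans_prob_start[OF s])
    also have "\<dots> / card S = \<P>(z in walk_space. \<forall>i<m. h (marked_path F (\<tau> i) z) = a i)"
      by (intro walk_space_events(2)[symmetric] A)
    finally show "\<P>(z in walk_space. \<forall>i<m. h (marked_path F (\<tau> i + s) z) = a i)
      = \<P>(z in walk_space. \<forall>i<m. h (marked_path F (\<tau> i) z) = a i)" .
  qed
qed

end

end

section \<open>Collisions between marks and the number of jumps\<close>

context uniform_walk
begin

lemma sum_marks_const: "(\<Sum>c\<in>C. ennreal (1 / card C) * a) = a"
proof -
  have "(\<Sum>c\<in>C. ennreal (1 / card C)) = ennreal (\<Sum>c\<in>C. 1 / card C)" by (rule sum_ennreal) simp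
  also have "(\<Sum>c\<in>C. 1 / real (card C)) = 1" using card_C by simp
  finally have "(\<Sum>c\<in>C. ennreal (1 / card C)) = 1" by simp
  then show ?thesis by (simp only: sum_distrib_right[symmetric] mult_1)
qed

lemma nn_integral_exponential_1: "(\<integral>\<^sup>+g. ennreal (exponential_density 1 g) * a \<partial>lborel) = a"
proof -
  interpret E: prob_space "density lborel (\<lambda>x. ennreal (exponential_density 1 x))" by (rule prob_space_exponential)
  have "(\<integral>\<^sup>+g. ennreal (exponential_density 1 g) \<partial>lborel) = 1"
    using E.emeasure_space_1 by (simp add: emeasure_density)
  then show ?thesis by (simp add: nn_integral_multc)
qed

lemma emeasure_driver_Stream:
  assumes "X \<in> sets driver"
  shows "emeasure driver X = (\<integral>\<^sup>+g. ennreal (exponential_density 1 g) *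
      (\<Sum>c\<in>C. ennreal (1 / card C) * (\<integral>\<^sup>+\<omega>. indicator X ((g, c) ## \<omega>) \<partial>driver)) \<partial>lborel)"
  using nn_integral_driver[of "indicator X"] assms by simp

lemma measurable_marks_pred:
  "Measurable.pred driver (\<lambda>\<omega>. P (snd (\<omega> !! i)) (snd (\<omega> !! j)))"
proof -
  have "(\<lambda>\<omega>. P c (snd (\<omega> !! j))) \<in> driver \<rightarrow>\<^sub>M count_space UNIV" for c
    by (rule measurable_compose[OF measurable_snth_mark]) simp
  then show ?thesis using finite_C
    by (intro measurable_compose_countable'[where f="\<lambda>c \<omega>. P c (snd (\<omega> !! j))", OF _ measurable_snth_mark])
      (auto intro: countable_finite)
qed

lemma emeasure_mark_le:
  assumes B: "real (card {c\<in>C. Q c}) \<le> b * real (card C)"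
  shows "emeasure driver {\<omega>\<in>space driver. Q (snd (\<omega> !! j))} \<le> ennreal b"
proof (induction j)
  have m: "{\<omega>\<in>space driver. Q (snd (\<omega> !! j))} \<in> sets driver" for j
    using measurable_marks_pred[of "\<lambda>_ c. Q c" 0 j] by (simp add: pred_def)
  interpret D: prob_space driver by (rule prob_space_driver)
  case 0
  have "(\<integral>\<^sup>+\<omega>. indicator {\<omega>\<in>space driver. Q (snd (\<omega> !! 0))} ((g, c) ## \<omega>) \<partial>driver) = indicator {c. Q c} c"
    if "c \<in> C" for g c
  proof -
    have "(\<integral>\<^sup>+\<omega>. indicator {\<omega>\<in>space driver. Q (snd (\<omega> !! 0))} ((g, c) ## \<omega>) \<partial>driver)
       = (\<integral>\<^sup>+\<omega>. indicator {c. Q c} c \<partial>driver)"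
      using that by (intro nn_integral_cong) (auto simp: indicator_def Stream_in_space_driver)
    then show ?thesis by (simp add: D.emeasure_space_1)
  qed
  then have "emeasure driver {\<omega>\<in>space driver. Q (snd (\<omega> !! 0))} =
     (\<integral>\<^sup>+g. ennreal (exponential_density 1 g) * (\<Sum>c\<in>C. ennreal (1 / card C) * indicator {c. Q c} c) \<partial>lborel)"
    unfolding emeasure_driver_Stream[OF m] by simp
  also have "\<dots> = (\<Sum>c\<in>C. ennreal (1 / card C) * indicator {c. Q c} c)" by (rule nn_integral_exponential_1)
  also have "\<dots> = (\<Sum>c\<in>C. ennreal (1 / card C * indicator {c. Q c} c))"
    by (intro sum.cong) (auto simp: indicator_def)
  also have "\<dots> = ennreal (\<Sum>c\<in>C. 1 / card C * indicator {c. Q c} c)" by (rule sum_ennreal) auto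
  also have "(\<Sum>c\<in>C. 1 / real (card C) * indicator {c. Q c} c) = real (card {c\<in>C. Q c}) / card C"
    using finite_C by (simp add: sum_divide_distrib[symmetric] indicator_def of_bool_def sum.If_cases Int_def)
  finally show ?case using B card_C by (simp add: ennreal_leI divide_le_eq)
next
  case (Suc j)
  have m: "{\<omega>\<in>space driver. Q (snd (\<omega> !! j))} \<in> sets driver" for j
    using measurable_marks_pred[of "\<lambda>_ c. Q c" 0 j] by (simp add: pred_def)
  have "(\<integral>\<^sup>+\<omega>. indicator {\<omega>\<in>space driver. Q (snd (\<omega> !! Suc j))} ((g, c) ## \<omega>) \<partial>driver)
      = emeasure driver {\<omega>\<in>space driver. Q (snd (\<omega> !! j))}" if "c \<in> C" for g c
  proof -
    have "(\<integral>\<^sup>+\<omega>. indicator {\<omega>\<in>space driver. Q (snd (\<omega> !! Suc j))} ((g, c) ## \<omega>) \<partial>driver)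
       = (\<integral>\<^sup>+\<omega>. indicator {\<omega>\<in>space driver. Q (snd (\<omega> !! j))} \<omega> \<partial>driver)"
      using that by (intro nn_integral_cong) (auto simp: indicator_def Stream_in_space_driver)
    then show ?thesis using m by simp
  qed
  then have "emeasure driver {\<omega>\<in>space driver. Q (snd (\<omega> !! Suc j))}
     = (\<integral>\<^sup>+g. ennreal (exponential_density 1 g) * (\<Sum>c\<in>C. ennreal (1 / card C) *
         emeasure driver {\<omega>\<in>space driver. Q (snd (\<omega> !! j))}) \<partial>lborel)"
    unfolding emeasure_driver_Stream[OF m[of "Suc j"]]
    by (intro nn_integral_cong arg_cong2[where f="(*)"] sum.cong refl)
  also have "\<dots> = emeasure driver {\<omega>\<in>space driver. Q (snd (\<omega> !! j))}"
    by (simp only: sum_marks_const nn_integral_exponential_1)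
  finally show ?case using Suc by (simp only:)
qed

lemma emeasure_two_marks_le:
  assumes R: "\<And>c. c \<in> C \<Longrightarrow> real (card {c'\<in>C. R c c'}) \<le> b * real (card C)" and "i < j"
  shows "emeasure driver {\<omega>\<in>space driver. R (snd (\<omega> !! i)) (snd (\<omega> !! j))} \<le> ennreal b"
  using \<open>i < j\<close>
proof (induction i arbitrary: j)
  have m: "{\<omega>\<in>space driver. R (snd (\<omega> !! i)) (snd (\<omega> !! j))} \<in> sets driver" for i j
    using measurable_marks_pred[of R i j] by (simp add: pred_def)
  have m1: "{\<omega>\<in>space driver. R c (snd (\<omega> !! j))} \<in> sets driver" for c j
    using measurable_marks_pred[of "\<lambda>_ c'. R c c'" 0 j] by (simp add: pred_def)
  {
    case 0
    then obtain k where j: "j = Suc k" by (cases j) auto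
    have "(\<integral>\<^sup>+\<omega>. indicator {\<omega>\<in>space driver. R (snd (\<omega> !! 0)) (snd (\<omega> !! j))} ((g, c) ## \<omega>) \<partial>driver) \<le> ennreal b"
      if "c \<in> C" for g c
    proof -
      have "(\<integral>\<^sup>+\<omega>. indicator {\<omega>\<in>space driver. R (snd (\<omega> !! 0)) (snd (\<omega> !! j))} ((g, c) ## \<omega>) \<partial>driver)
        = (\<integral>\<^sup>+\<omega>. indicator {\<omega>\<in>space driver. R c (snd (\<omega> !! k))} \<omega> \<partial>driver)"
        using that by (intro nn_integral_cong) (auto simp: indicator_def Stream_in_space_driver j)
      also have "\<dots> = emeasure driver {\<omega>\<in>space driver. R c (snd (\<omega> !! k))}"
        using m1 by simp
      finally show ?thesis using emeasure_mark_le[OF R[OF that], of k] by simp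
    qed
    then have "emeasure driver {\<omega>\<in>space driver. R (snd (\<omega> !! 0)) (snd (\<omega> !! j))}
      \<le> (\<integral>\<^sup>+g. ennreal (exponential_density 1 g) * (\<Sum>c\<in>C. ennreal (1 / card C) * ennreal b) \<partial>lborel)"
      unfolding emeasure_driver_Stream[OF m]
      by (intro nn_integral_mono mult_left_mono sum_mono) auto
    also have "\<dots> = ennreal b" by (simp only: sum_marks_const nn_integral_exponential_1)
    finally show ?case .
  next
    case (Suc i)
    then obtain k where j: "j = Suc k" by (cases j) auto
    have "(\<integral>\<^sup>+\<omega>. indicator {\<omega>\<in>space driver. R (snd (\<omega> !! Suc i)) (snd (\<omega> !! j))} ((g, c) ## \<omega>) \<partial>driver)
        = emeasure driver {\<omega>\<in>space driver. R (snd (\<omega> !! i)) (snd (\<omega> !! k))}" if "c \<in> C" for g c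
    proof -
      have "(\<integral>\<^sup>+\<omega>. indicator {\<omega>\<in>space driver. R (snd (\<omega> !! Suc i)) (snd (\<omega> !! j))} ((g, c) ## \<omega>) \<partial>driver)
         = (\<integral>\<^sup>+\<omega>. indicator {\<omega>\<in>space driver. R (snd (\<omega> !! i)) (snd (\<omega> !! k))} \<omega> \<partial>driver)"
        using that by (intro nn_integral_cong) (auto simp: indicator_def Stream_in_space_driver j)
      then show ?thesis using m by simp
    qed
    then have "emeasure driver {\<omega>\<in>space driver. R (snd (\<omega> !! Suc i)) (snd (\<omega> !! j))}
       = (\<integral>\<^sup>+g. ennreal (exponential_density 1 g) * (\<Sum>c\<in>C. ennreal (1 / card C) *
           emeasure driver {\<omega>\<in>space driver. R (snd (\<omega> !! i)) (snd (\<omega> !! k))}) \<partial>lborel)"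
      unfolding emeasure_driver_Stream[OF m[of "Suc i" j]]
      by (intro nn_integral_cong arg_cong2[where f="(*)"] sum.cong refl)
    also have "\<dots> = emeasure driver {\<omega>\<in>space driver. R (snd (\<omega> !! i)) (snd (\<omega> !! k))}"
      by (simp only: sum_marks_const nn_integral_exponential_1)
    also have "\<dots> \<le> ennreal b" using Suc.prems j by (intro Suc.IH) simp
    finally show ?case .
  }
qed

text \<open>A union bound over at most \<open>K\<^sup>2\<close> pairs of positions, each of which holds two independent uniform marks.\<close>

lemma measure_clash_le:
  assumes R: "\<And>c. c \<in> C \<Longrightarrow> real (card {c'\<in>C. R c c'}) \<le> b * real (card C)" and b: "0 \<le> b"
  shows "measure good_driver {\<omega>\<in>space good_driver. \<exists>j<K. \<exists>i<j. R (snd (\<omega> !! i)) (snd (\<omega> !! j))} \<le> real K ^ 2 * b"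
    and "{\<omega>\<in>space good_driver. \<exists>j<K. \<exists>i<j. R (snd (\<omega> !! i)) (snd (\<omega> !! j))} \<in> sets good_driver"
proof -
  interpret G: prob_space good_driver by (rule prob_space_good_driver)
  let ?E = "\<lambda>(i, j). {\<omega>\<in>space good_driver. R (snd (\<omega> !! i)) (snd (\<omega> !! j))}"
  let ?I = "Sigma {..<K} (\<lambda>j. {..<j})"
  have E: "?E (i, j) \<in> sets good_driver" for i j
    using measurable_good_driver[OF measurable_marks_pred[of R i j]] by (simp add: pred_def)
  have le: "measure good_driver (?E (i, j)) \<le> b" if "i < j" for i j
  proof -
    have m: "{\<omega>\<in>space driver. R (snd (\<omega> !! i)) (snd (\<omega> !! j))} \<in> sets driver"
      using measurable_marks_pred[of R i j] by (simp add: pred_def)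
    have "?E (i, j) = {\<omega>\<in>space good_driver. \<omega> \<in> {\<omega>\<in>space driver. R (snd (\<omega> !! i)) (snd (\<omega> !! j))}}"
      by (auto simp: space_good_driver)
    then have "emeasure good_driver (?E (i, j)) \<le> ennreal b"
      using emeasure_good_driver[OF m] emeasure_two_marks_le[OF R that] by simp
    then show ?thesis using b by (simp add: G.emeasure_eq_measure)
  qed
  have eq: "{\<omega>\<in>space good_driver. \<exists>j<K. \<exists>i<j. R (snd (\<omega> !! i)) (snd (\<omega> !! j))} = (\<Union>p\<in>?I. ?E (snd p, fst p))"
  proof (intro equalityI subsetI)
    fix \<omega> assume "\<omega> \<in> {\<omega>\<in>space good_driver. \<exists>j<K. \<exists>i<j. R (snd (\<omega> !! i)) (snd (\<omega> !! j))}"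
    then obtain i j where "\<omega> \<in> space good_driver" "j < K" "i < j" "R (snd (\<omega> !! i)) (snd (\<omega> !! j))" by blast
    then show "\<omega> \<in> (\<Union>p\<in>?I. ?E (snd p, fst p))" by (intro UN_I[of "(j, i)"]) simp_all
  qed auto
  show "{\<omega>\<in>space good_driver. \<exists>j<K. \<exists>i<j. R (snd (\<omega> !! i)) (snd (\<omega> !! j))} \<in> sets good_driver"
    unfolding eq using E by (intro sets.finite_UN) auto
  have "measure good_driver (\<Union>p\<in>?I. ?E (snd p, fst p)) \<le> (\<Sum>p\<in>?I. measure good_driver (?E (snd p, fst p)))"
    using E by (intro G.finite_measure_subadditive_finite) auto
  also have "\<dots> \<le> (\<Sum>p\<in>?I. b)" using le by (intro sum_mono) auto
  also have "\<dots> = real (card ?I) * b" by simp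
  also have "\<dots> \<le> real (K * K) * b"
  proof -
    have "card ?I \<le> card ({..<K} \<times> {..<K})" by (intro card_mono) auto
    then have "real (card ?I) \<le> real (K * K)" by (simp only: card_cartesian_product card_lessThan of_nat_le_iff)
    then show ?thesis using b by (rule mult_right_mono)
  qed
  finally show "measure good_driver {\<omega>\<in>space good_driver. \<exists>j<K. \<exists>i<j. R (snd (\<omega> !! i)) (snd (\<omega> !! j))} \<le> real K ^ 2 * b"
    unfolding eq by (simp add: power2_eq_square)
qed

text \<open>Every Poisson weight beyond \<open>K\<close> is at most \<open>T / (K + 1)\<close> times the preceding one, and the weights add up to 1.\<close>

lemma measure_jump_count_gt_le:
  assumes T: "0 \<le> T"
  shows "measure good_driver {\<omega>\<in>space good_driver. K < jump_count T \<omega>} \<le> T / (real K + 1)"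
    and "{\<omega>\<in>space good_driver. K < jump_count T \<omega>} \<in> sets good_driver"
proof -
  interpret G: prob_space good_driver by (rule prob_space_good_driver)
  let ?E = "\<lambda>k. {\<omega>\<in>space good_driver. jump_count T \<omega> = k}"
  have jc: "count_is k T \<omega> \<longleftrightarrow> jump_count T \<omega> = k" if "\<omega> \<in> space good_driver" for \<omega> k
    using that T jump_count_eq[of \<omega> k T] count_is_jump_count[of \<omega> T] by (auto simp: space_good_driver)
  have mE: "?E k \<in> sets good_driver" for k
    using measurable_sets[OF measurable_jump_count[OF T], of "{k}"] by (simp add: vimage_def Int_def conj_commute)
  show gt: "{\<omega>\<in>space good_driver. K < jump_count T \<omega>} \<in> sets good_driver"
    using measurable_sets[OF measurable_jump_count[OF T], of "{K<..}"] by (simp add: vimage_def Int_def conj_commute)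
  have pE: "measure good_driver (?E k) = poisson_density k T" for k
  proof -
    have m: "{\<omega>\<in>space driver. count_is k T \<omega>} \<in> sets driver" by measurable
    have "?E k = {\<omega>\<in>space good_driver. \<omega> \<in> {\<omega>\<in>space driver. count_is k T \<omega>}}"
      using jc by (auto simp: space_good_driver)
    then have "emeasure good_driver (?E k) = ennreal (poisson_density k T)"
      using emeasure_good_driver[OF m] emeasure_count_is[of k T] by simp
    then show ?thesis by (simp add: G.emeasure_eq_measure)
  qed
  have "measure good_driver (\<Union>k\<in>{..K}. ?E k) = (\<Sum>k\<le>K. measure good_driver (?E k))"
    using mE by (intro G.finite_measure_finite_Union) (auto simp: disjoint_family_on_def)
  also have "(\<Union>k\<in>{..K}. ?E k) = space good_driver - {\<omega>\<in>space good_driver. K < jump_count T \<omega>}"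
    by auto
  finally have "measure good_driver {\<omega>\<in>space good_driver. K < jump_count T \<omega>} = 1 - (\<Sum>k\<le>K. poisson_density k T)"
    using G.prob_compl[OF gt] by (simp add: pE)
  also have "\<dots> = (\<Sum>j. poisson_density (j + Suc K) T)"
    using suminf_minus_initial_segment[OF sums_summable[OF poisson_density_sums[OF T]], of "Suc K"]
      poisson_density_sums[OF T] by (simp add: sums_iff lessThan_Suc_atMost)
  also have "\<dots> \<le> (\<Sum>j. T / (real K + 1) * poisson_density (j + K) T)"
  proof (rule suminf_le)
    have s: "summable (\<lambda>k. poisson_density k T)" using poisson_density_sums[OF T] by (rule sums_summable)
    show "summable (\<lambda>j. poisson_density (j + Suc K) T)" using s by (subst summable_iff_shift)
    show "summable (\<lambda>j. T / (real K + 1) * poisson_density (j + K) T)"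
      using s by (intro summable_mult) (subst summable_iff_shift)
    fix j
    have "poisson_density (j + Suc K) T = T / real (Suc (j + K)) * poisson_density (j + K) T"
      using T by (simp add: erlang_density_def)
    also have "\<dots> \<le> T / (real K + 1) * poisson_density (j + K) T"
      using T by (intro mult_right_mono divide_left_mono) auto
    finally show "poisson_density (j + Suc K) T \<le> T / (real K + 1) * poisson_density (j + K) T" .
  qed
  also have "\<dots> = T / (real K + 1) * (\<Sum>j. poisson_density (j + K) T)"
    using poisson_density_sums[OF T] by (intro suminf_mult) (subst summable_iff_shift, rule sums_summable)
  also have "(\<Sum>j. poisson_density (j + K) T) \<le> 1"
    using suminf_minus_initial_segment[OF sums_summable[OF poisson_density_sums[OF T]], of K]
      poisson_density_sums[OF T] sum_nonneg[of "{..<K}" "\<lambda>k. poisson_density k T"] by (simp add: sums_iff)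
  then have "T / (real K + 1) * (\<Sum>j. poisson_density (j + K) T) \<le> T / (real K + 1) * 1"
    using T by (intro mult_left_mono) auto
  finally show "measure good_driver {\<omega>\<in>space good_driver. K < jump_count T \<omega>} \<le> T / (real K + 1)" by simp
qed

lemma measure_walk_space_snd:
  assumes "{\<omega>\<in>space good_driver. Q \<omega>} \<in> sets good_driver"
  shows "measure walk_space {z\<in>space walk_space. Q (snd z)} = measure good_driver {\<omega>\<in>space good_driver. Q \<omega>}"
    and "{z\<in>space walk_space. Q (snd z)} \<in> sets walk_space"
  using walk_space_events[of "\<lambda>z. Q (snd z)"] assms finite_S S_ne by (auto simp: card_gt_0_iff)

lemma marked_path_0:
  assumes "z \<in> space walk_space"
  shows "marked_path f 0 z = fst z"
proof -
  have g: "good_stream (snd z)" using assms by (auto simp: space_walk_space space_good_driver)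
  then have "0 < fst (snd z !! 0)" unfolding good_stream_def by blast
  then have "count_is 0 0 (snd z)" by (simp add: count_is_0)
  then show ?thesis using jump_count_eq[OF g] by (simp add: marked_path_def)
qed

end

section \<open>Relabelling one walk into the other\<close>

lemma extend_to_permutation:
  assumes V: "finite V" and A: "A \<subseteq> V" and g: "inj_on g A" "g ` A \<subseteq> V"
  obtains \<pi> where "\<pi> permutes V" "\<And>a. a \<in> A \<Longrightarrow> \<pi> a = g a"
proof -
  have fA: "finite A" using V A by (rule rev_finite_subset)
  have "card (V - A) = card (V - g ` A)"
    using V A g fA by (simp add: card_Diff_subset card_image)
  then obtain k where k: "bij_betw k (V - A) (V - g ` A)"
    using V finite_same_card_bij[of "V - A" "V - g ` A"] by auto
  define \<pi> where "\<pi> x = (if x \<in> A then g x else if x \<in> V then k x else x)" for x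
  have "bij_betw \<pi> A (g ` A)" using g by (auto simp: bij_betw_def \<pi>_def inj_on_def)
  moreover have "bij_betw \<pi> (V - A) (V - g ` A)"
    using k by (rule bij_betw_cong[THEN iffD1, rotated]) (auto simp: \<pi>_def)
  ultimately have "bij_betw \<pi> (A \<union> (V - A)) (g ` A \<union> (V - g ` A))"
    by (rule bij_betw_combine) auto
  moreover have "A \<union> (V - A) = V" "g ` A \<union> (V - g ` A) = V" using A g by auto
  ultimately have "\<pi> permutes V" by (intro bij_imp_permutes) (use A in \<open>auto simp: \<pi>_def\<close>)
  then show ?thesis by (rule that) (auto simp: \<pi>_def)
qed

definition meets :: "'v \<times> 'v \<Rightarrow> 'v \<times> 'v \<Rightarrow> bool" where
  "meets p q \<longleftrightarrow> {fst p, snd p} \<inter> {fst q, snd q} \<noteq> {}"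

text \<open>Pairwise disjointness makes both families of \<open>2 K\<close> endpoints injective, so that matching endpoints extends to a
  permutation of the whole vertex set.\<close>

lemma align_disjoint_pairs:
  fixes p q :: "nat \<Rightarrow> 'v \<times> 'v"
  assumes V: "finite V"
    and p: "\<And>k. k < K \<Longrightarrow> p k \<in> distinct_pairs V" "\<not> (\<exists>j<K. \<exists>i<j. meets (p i) (p j))"
    and q: "\<And>k. k < K \<Longrightarrow> q k \<in> distinct_pairs V" "\<not> (\<exists>j<K. \<exists>i<j. meets (q i) (q j))"
  obtains \<pi> where "\<pi> permutes V" "\<And>k. k < K \<Longrightarrow> \<pi> (fst (p k)) = fst (q k) \<and> \<pi> (snd (p k)) = snd (q k)"
proof -
  \<comment> \<open>The endpoints of a family of pairs, indexed by position and by a flag for first or second endpoint.\<close>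
  define pt where "pt r kb = (if snd kb then fst (r (fst kb)) else snd (r (fst kb)))"
    for r :: "nat \<Rightarrow> 'v \<times> 'v" and kb :: "nat \<times> bool"
  define I where "I = {..<K} \<times> (UNIV :: bool set)"
  have inj: "inj_on (pt r) I" and im: "pt r ` I \<subseteq> V"
    if r: "\<And>k. k < K \<Longrightarrow> r k \<in> distinct_pairs V" "\<not> (\<exists>j<K. \<exists>i<j. meets (r i) (r j))" for r
  proof -
    show "inj_on (pt r) I"
    proof (rule inj_onI)
      fix a b assume ab: "a \<in> I" "b \<in> I" "pt r a = pt r b"
      have "meets (r (fst a)) (r (fst b))" "meets (r (fst b)) (r (fst a))"
        using ab(3) by (auto simp: meets_def pt_def split: if_splits)
      moreover have "fst a < K" "fst b < K" using ab by (auto simp: I_def)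
      ultimately have "fst a = fst b" using r(2) by (metis linorder_neqE_nat)
      moreover have "fst (r (fst a)) \<noteq> snd (r (fst a))"
        using r(1)[OF \<open>fst a < K\<close>] by (auto simp: distinct_pairs_def)
      ultimately show "a = b" using ab(3) by (auto simp: pt_def prod_eq_iff split: if_splits)
    qed
    show "pt r ` I \<subseteq> V" using r(1) by (fastforce simp: pt_def I_def distinct_pairs_def)
  qed
  have inj_p: "inj_on (pt p) I" by (rule inj) (fact p)+
  have inj_q: "inj_on (pt q) I" by (rule inj) (fact q)+
  have im_p: "pt p ` I \<subseteq> V" by (rule im) (fact p)+
  have im_q: "pt q ` I \<subseteq> V" by (rule im) (fact q)+
  define g where "g = pt q \<circ> inv_into I (pt p)"
  have "inj_on g (pt p ` I)"
    unfolding g_def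
  proof (rule comp_inj_on)
    show "inj_on (inv_into I (pt p)) (pt p ` I)" by (rule inj_on_inv_into) simp
    show "inj_on (pt q) (inv_into I (pt p) ` pt p ` I)"
      using inj_q by (rule inj_on_subset) (auto simp: inj_p)
  qed
  moreover have "g ` (pt p ` I) \<subseteq> V"
    using im_q inj_p by (auto simp: g_def)
  ultimately obtain \<pi> where \<pi>: "\<pi> permutes V" "\<forall>a\<in>pt p ` I. \<pi> a = g a"
    by (rule extend_to_permutation[OF V im_p]) blast
  have "\<pi> (pt p kb) = pt q kb" if "kb \<in> I" for kb
    using \<pi>(2) inj_p that by (simp add: g_def)
  note on_pts = this
  show ?thesis
  proof (rule that[OF \<pi>(1)])
    fix k assume "k < K"
    then have "(k, True) \<in> I" "(k, False) \<in> I" by (simp_all add: I_def)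
    from this[THEN on_pts] show "\<pi> (fst (p k)) = fst (q k) \<and> \<pi> (snd (p k)) = snd (q k)"
      by (simp add: pt_def)
  qed
qed

lemma image_Collect_preimage:
  assumes "f ` S = S" "A \<subseteq> S"
  shows "f ` {x\<in>S. f x \<in> A} = A"
proof (intro equalityI subsetI)
  fix a assume a: "a \<in> A"
  then have "a \<in> f ` S" using assms by auto
  then obtain x where "x \<in> S" "a = f x" by (rule imageE)
  with a show "a \<in> f ` {x\<in>S. f x \<in> A}" by auto
qed auto

lemma conj_transpose:
  assumes "bij \<pi>"
  shows "\<pi> \<circ> Transposition.transpose x y \<circ> inv \<pi> = Transposition.transpose (\<pi> x) (\<pi> y)"
  using assms bij_is_inj[OF assms] bij_is_surj[OF assms]
  by (auto simp: fun_eq_iff Transposition.transpose_def inv_f_f surj_f_inv_f dest: injD)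

text \<open>One stream of marks \<open>(e, c) \<in> E \<times> D\<close> drives two walks, which use the left and the right component and
  share the jump times. As \<open>e\<close> and \<open>c\<close> are independent, each walk has its own uniform marks.\<close>

locale coupled_walks =
  fixes V :: "'v set" and E D :: "('v \<times> 'v) set"
  assumes finite_V: "finite V" and V_ne: "V \<noteq> {}"
    and E: "E \<subseteq> distinct_pairs V" "E \<noteq> {}" and D: "D \<subseteq> distinct_pairs V" "D \<noteq> {}"
begin

lemma finite_distinct_pairs: "finite (distinct_pairs V)"
  by (rule finite_subset[of _ "V \<times> V"]) (use finite_V in \<open>auto simp: distinct_pairs_def\<close>)

lemma finite_E: "finite E" and finite_D: "finite D"
  using E D finite_distinct_pairs finite_subset by blast+

definition swap_left :: "('v \<times> 'v) \<times> ('v \<times> 'v) \<Rightarrow> ('v \<Rightarrow> 'v) \<Rightarrow> 'v \<Rightarrow> 'v" where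
  "swap_left c \<sigma> = Transposition.transpose (fst (fst c)) (snd (fst c)) \<circ> \<sigma>"

definition swap_right :: "('v \<times> 'v) \<times> ('v \<times> 'v) \<Rightarrow> ('v \<Rightarrow> 'v) \<Rightarrow> 'v \<Rightarrow> 'v" where
  "swap_right c \<sigma> = Transposition.transpose (fst (snd c)) (snd (snd c)) \<circ> \<sigma>"

lemma transpose_comp_bij_betw:
  assumes "x \<in> V" "y \<in> V"
  shows "bij_betw ((\<circ>) (Transposition.transpose x y)) (perms_on V) (perms_on V)"
proof (rule bij_betwI[where g="(\<circ>) (Transposition.transpose x y)"])
  show "(\<circ>) (Transposition.transpose x y) \<in> perms_on V \<rightarrow> perms_on V"
    using assms by (auto simp: perms_on_def intro: permutes_transpose_comp)
qed (use assms in \<open>auto simp: perms_on_def o_assoc intro: permutes_transpose_comp\<close>)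

lemma finite_perms: "finite (perms_on V)" and perms_ne: "perms_on V \<noteq> {}"
proof -
  show "finite (perms_on V)" unfolding perms_on_def using finite_V by (rule finite_permutations)
  have "id \<in> perms_on V" by (simp add: perms_on_def permutes_id)
  then show "perms_on V \<noteq> {}" by blast
qed

sublocale left: uniform_walk "E \<times> D" "perms_on V" swap_left
proof
  fix c assume c: "c \<in> E \<times> D"
  have "bij_betw ((\<circ>) (Transposition.transpose (fst (fst c)) (snd (fst c)))) (perms_on V) (perms_on V)"
    using c E by (intro transpose_comp_bij_betw) (auto simp: distinct_pairs_def)
  then show "bij_betw (swap_left c) (perms_on V) (perms_on V)" by (simp add: swap_left_def[abs_def])
qed (use E D finite_E finite_D finite_perms perms_ne in auto)

sublocale right: uniform_walk "E \<times> D" "perms_on V" swap_right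
proof
  fix c assume c: "c \<in> E \<times> D"
  have "bij_betw ((\<circ>) (Transposition.transpose (fst (snd c)) (snd (snd c)))) (perms_on V) (perms_on V)"
    using c D by (intro transpose_comp_bij_betw) (auto simp: distinct_pairs_def)
  then show "bij_betw (swap_right c) (perms_on V) (perms_on V)" by (simp add: swap_right_def[abs_def])
qed (use E D finite_E finite_D finite_perms perms_ne in auto)

lemma left_step_avg:
  "left.step_avg f \<sigma> = (\<Sum>(x, y)\<in>E. f (Transposition.transpose x y \<circ> \<sigma>)) / real (card E)"
proof -
  have "(\<Sum>c\<in>E \<times> D. f (swap_left c \<sigma>)) = (\<Sum>e\<in>E. \<Sum>d\<in>D. f (Transposition.transpose (fst e) (snd e) \<circ> \<sigma>))"
    using finite_E finite_D by (subst sum.cartesian_product) (auto simp: swap_left_def intro!: sum.cong)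
  then show ?thesis using finite_E finite_D E D
    by (simp add: left.step_avg_def case_prod_unfold sum_distrib_left[symmetric] card_cartesian_product card_gt_0_iff)
qed

lemma right_step_avg:
  "right.step_avg f \<sigma> = (\<Sum>(x, y)\<in>D. f (Transposition.transpose x y \<circ> \<sigma>)) / real (card D)"
proof -
  have "(\<Sum>c\<in>E \<times> D. f (swap_right c \<sigma>)) = (\<Sum>e\<in>E. \<Sum>d\<in>D. f (Transposition.transpose (fst d) (snd d) \<circ> \<sigma>))"
    using finite_E finite_D by (subst sum.cartesian_product) (auto simp: swap_right_def intro!: sum.cong)
  then show ?thesis using finite_E finite_D E D
    by (simp add: right.step_avg_def case_prod_unfold card_cartesian_product card_gt_0_iff)
qed

definition aligns :: "(('v \<times> 'v) \<times> ('v \<times> 'v)) list \<Rightarrow> ('v \<Rightarrow> 'v) \<Rightarrow> bool" where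
  "aligns cs \<pi> \<longleftrightarrow> \<pi> permutes V \<and>
     (\<forall>c\<in>set cs. \<pi> (fst (fst c)) = fst (snd c) \<and> \<pi> (snd (fst c)) = snd (snd c))"

definition align_choice :: "(('v \<times> 'v) \<times> ('v \<times> 'v)) list \<Rightarrow> 'v \<Rightarrow> 'v" where
  "align_choice cs = (if \<exists>\<pi>. aligns cs \<pi> then SOME \<pi>. aligns cs \<pi> else id)"

lemma align_choice_aligns: "aligns cs \<pi> \<Longrightarrow> aligns cs (align_choice cs)"
  unfolding align_choice_def by (metis someI)

text \<open>The relabelling depends on the first \<open>K\<close> marks only, and in particular not on the initial permutation.\<close>

definition aligner :: "nat \<Rightarrow> (real \<times> ('v \<times> 'v) \<times> ('v \<times> 'v)) stream \<Rightarrow> 'v \<Rightarrow> 'v" where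
  "aligner K \<omega> = align_choice (map (\<lambda>k. snd (\<omega> !! k)) [0..<K])"

lemma aligner_permutes: "aligner K \<omega> permutes V"
proof (cases "\<exists>\<pi>. aligns (map (\<lambda>k. snd (\<omega> !! k)) [0..<K]) \<pi>")
  case True
  then show ?thesis using align_choice_aligns by (auto simp: aligner_def aligns_def)
next
  case False
  then have "aligner K \<omega> = id" unfolding aligner_def align_choice_def by (rule if_not_P)
  then show ?thesis by (simp add: permutes_id)
qed

lemma mark_in: "\<omega> \<in> space left.good_driver \<Longrightarrow> snd (\<omega> !! k) \<in> E \<times> D"
proof -
  assume "\<omega> \<in> space left.good_driver"
  then have "\<omega> \<in> streams (UNIV \<times> E \<times> D)" by (simp add: left.space_good_driver left.space_driver)
  then have "\<omega> !! k \<in> UNIV \<times> E \<times> D" by (rule snth_in)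
  then show ?thesis by (simp add: mem_Times_iff)
qed

lemma aligner_aligns:
  assumes \<omega>: "\<omega> \<in> space left.good_driver"
    and e: "\<not> (\<exists>j<K. \<exists>i<j. meets (fst (snd (\<omega> !! i))) (fst (snd (\<omega> !! j))))"
    and d: "\<not> (\<exists>j<K. \<exists>i<j. meets (snd (snd (\<omega> !! i))) (snd (snd (\<omega> !! j))))"
    and k: "k < K"
  shows "aligner K \<omega> (fst (fst (snd (\<omega> !! k)))) = fst (snd (snd (\<omega> !! k)))"
    and "aligner K \<omega> (snd (fst (snd (\<omega> !! k)))) = snd (snd (snd (\<omega> !! k)))"
proof -
  have "fst (snd (\<omega> !! k)) \<in> distinct_pairs V" "snd (snd (\<omega> !! k)) \<in> distinct_pairs V" for k
    using mark_in[OF \<omega>, of k] E D by (auto simp: mem_Times_iff)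
  then obtain \<pi> where "\<pi> permutes V" "\<And>k. k < K \<Longrightarrow>
      \<pi> (fst (fst (snd (\<omega> !! k)))) = fst (snd (snd (\<omega> !! k))) \<and>
      \<pi> (snd (fst (snd (\<omega> !! k)))) = snd (snd (snd (\<omega> !! k)))"
    using align_disjoint_pairs[OF finite_V _ e _ d] by metis
  then have "aligns (map (\<lambda>k. snd (\<omega> !! k)) [0..<K]) \<pi>" by (auto simp: aligns_def)
  then have "aligns (map (\<lambda>k. snd (\<omega> !! k)) [0..<K]) (aligner K \<omega>)"
    unfolding aligner_def by (rule align_choice_aligns)
  then show "aligner K \<omega> (fst (fst (snd (\<omega> !! k)))) = fst (snd (snd (\<omega> !! k)))"
    and "aligner K \<omega> (snd (fst (snd (\<omega> !! k)))) = snd (snd (snd (\<omega> !! k)))"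
    using k by (auto simp: aligns_def)
qed

text \<open>The initial state is conjugated while the stream is kept, so the second walk uses the same jump times and
  its own marks.\<close>

definition realign :: "nat \<Rightarrow> ('v \<Rightarrow> 'v) \<times> (real \<times> ('v \<times> 'v) \<times> ('v \<times> 'v)) stream \<Rightarrow>
    ('v \<Rightarrow> 'v) \<times> (real \<times> ('v \<times> 'v) \<times> ('v \<times> 'v)) stream" where
  "realign K z = (aligner K (snd z) \<circ> fst z \<circ> inv (aligner K (snd z)), snd z)"

text \<open>If the relabelling \<open>\<pi>\<close> carries each left pair to the right pair, conjugation by \<open>\<pi>\<close> turns the left
  transpositions into the right ones, step by step.\<close>

lemma run_realign:
  assumes \<omega>: "\<omega> \<in> space left.good_driver"
    and e: "\<not> (\<exists>j<K. \<exists>i<j. meets (fst (snd (\<omega> !! i))) (fst (snd (\<omega> !! j))))"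
    and d: "\<not> (\<exists>j<K. \<exists>i<j. meets (snd (snd (\<omega> !! i))) (snd (snd (\<omega> !! j))))"
    and k: "k \<le> K"
  defines "\<pi> \<equiv> aligner K \<omega>"
  shows "run_marks swap_right k (\<pi> \<circ> \<sigma> \<circ> inv \<pi>) \<omega> = \<pi> \<circ> run_marks swap_left k \<sigma> \<omega> \<circ> inv \<pi>"
  using k
proof (induction k)
  case (Suc k)
  have bij: "bij \<pi>" unfolding \<pi>_def using aligner_permutes by (rule permutes_bij)
  let ?l = "snd (\<omega> !! k)"
  let ?t = "Transposition.transpose (fst (fst ?l)) (snd (fst ?l))"
  have "Transposition.transpose (fst (snd ?l)) (snd (snd ?l)) = \<pi> \<circ> ?t \<circ> inv \<pi>"
    unfolding conj_transpose[OF bij] using aligner_aligns[OF \<omega> e d, of k] Suc.prems by (simp add: \<pi>_def)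
  moreover have "(\<pi> \<circ> ?t \<circ> inv \<pi>) \<circ> (\<pi> \<circ> a \<circ> inv \<pi>) = \<pi> \<circ> (?t \<circ> a) \<circ> inv \<pi>" for a
    using bij by (simp add: fun_eq_iff bij_is_inj inv_f_f)
  moreover have "run_marks swap_right k (\<pi> \<circ> \<sigma> \<circ> inv \<pi>) \<omega> = \<pi> \<circ> run_marks swap_left k \<sigma> \<omega> \<circ> inv \<pi>"
    by (rule Suc.IH) (use Suc.prems in simp)
  ultimately show ?case by (simp only: run_marks_Suc_snth swap_left_def[of ?l] swap_right_def[of ?l])
qed simp

lemma cycle_partition_coupled:
  assumes z: "z \<in> space left.walk_space"
    and e: "\<not> (\<exists>j<K. \<exists>i<j. meets (fst (snd (snd z !! i))) (fst (snd (snd z !! j))))"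
    and d: "\<not> (\<exists>j<K. \<exists>i<j. meets (snd (snd (snd z !! i))) (snd (snd (snd z !! j))))"
    and T: "jump_count T (snd z) \<le> K" "0 \<le> t" "t \<le> T"
  shows "cycle_partition V (marked_path swap_right t (realign K z)) = cycle_partition V (marked_path swap_left t z)"
proof -
  obtain \<sigma> \<omega> where z2: "z = (\<sigma>, \<omega>)" by (cases z)
  have \<omega>: "\<omega> \<in> space left.good_driver" and \<sigma>: "\<sigma> \<in> perms_on V" using z by (auto simp: left.space_walk_space z2)
  then have g: "good_stream \<omega>" by (simp add: left.space_good_driver)
  have "jump_count t \<omega> \<le> jump_count T \<omega>"
    using jump_count_residual[OF g T(2), of "T - t"] T(3) by simp
  then have k: "jump_count t \<omega> \<le> K" using T by (simp add: z2)
  have "marked_path swap_left t (\<sigma>, \<omega>) \<in> perms_on V"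
    using left.marked_path_in[OF T(2) \<sigma> \<omega>] .
  then have "permutation (marked_path swap_left t (\<sigma>, \<omega>))"
    using finite_V by (auto simp: perms_on_def permutation_permutes)
  then show ?thesis
    using run_realign[OF \<omega> _ _ k, of \<sigma>] e d cycle_partition_conj[OF aligner_permutes, of "marked_path swap_left t (\<sigma>, \<omega>)" K \<omega>]
    by (simp add: z2 marked_path_def realign_def)
qed

lemma aligner_sets:
  "{\<omega>\<in>space left.good_driver. aligner K \<omega> = \<pi>} \<in> sets left.good_driver"
proof -
  let ?L = "{cs. set cs \<subseteq> E \<times> D \<and> length cs = K}"
  have fin: "finite ?L" using finite_E finite_D by (intro finite_lists_length_eq) auto
  have m: "{\<omega>\<in>space left.good_driver. snd (\<omega> !! k) = c} \<in> sets left.good_driver" for k c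
    using left.measurable_good_driver[OF left.measurable_marks_pred[of "\<lambda>_ c'. c' = c" 0 k]] by (simp add: pred_def)
  have "{\<omega>\<in>space left.good_driver. aligner K \<omega> = \<pi>}
     = (\<Union>cs\<in>{cs\<in>?L. align_choice cs = \<pi>}. {\<omega>\<in>space left.good_driver. \<forall>k\<in>{..<K}. snd (\<omega> !! k) = cs ! k})"
  proof (intro equalityI subsetI)
    fix \<omega> assume \<omega>: "\<omega> \<in> {\<omega>\<in>space left.good_driver. aligner K \<omega> = \<pi>}"
    then show "\<omega> \<in> (\<Union>cs\<in>{cs\<in>?L. align_choice cs = \<pi>}. {\<omega>\<in>space left.good_driver. \<forall>k\<in>{..<K}. snd (\<omega> !! k) = cs ! k})"
    proof (intro UN_I[of "map (\<lambda>k. snd (\<omega> !! k)) [0..<K]"])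
      have "set (map (\<lambda>k. snd (\<omega> !! k)) [0..<K]) \<subseteq> E \<times> D"
        using \<omega> mark_in by (simp only: set_map image_subset_iff) blast
      then show "map (\<lambda>k. snd (\<omega> !! k)) [0..<K] \<in> {cs\<in>?L. align_choice cs = \<pi>}"
        using \<omega> by (simp add: aligner_def)
    qed (use \<omega> in auto)
  next
    fix \<omega> assume "\<omega> \<in> (\<Union>cs\<in>{cs\<in>?L. align_choice cs = \<pi>}. {\<omega>\<in>space left.good_driver. \<forall>k\<in>{..<K}. snd (\<omega> !! k) = cs ! k})"
    then obtain cs where cs: "length cs = K" "align_choice cs = \<pi>" "\<omega> \<in> space left.good_driver" "\<forall>k\<in>{..<K}. snd (\<omega> !! k) = cs ! k"
      by blast
    have "map (\<lambda>k. snd (\<omega> !! k)) [0..<K] = cs" using cs by (intro nth_equalityI) auto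
    then show "\<omega> \<in> {\<omega>\<in>space left.good_driver. aligner K \<omega> = \<pi>}" using cs by (simp add: aligner_def)
  qed
  also have "\<dots> \<in> sets left.good_driver"
  proof (intro sets.finite_UN sets.sets_Collect_finite_All m)
    show "finite {cs\<in>?L. align_choice cs = \<pi>}" by (rule finite_subset[OF _ fin]) auto
  qed auto
  finally show ?thesis .
qed

lemma measurable_aligner: "aligner K \<in> left.good_driver \<rightarrow>\<^sub>M count_space (perms_on V)"
proof (subst measurable_count_space_eq2[OF finite_perms], intro conjI ballI)
  show "aligner K \<in> space left.good_driver \<rightarrow> perms_on V" using aligner_permutes by (auto simp: perms_on_def)
  fix \<pi>
  have "aligner K -` {\<pi>} \<inter> space left.good_driver = {\<omega>\<in>space left.good_driver. aligner K \<omega> = \<pi>}" by auto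
  then show "aligner K -` {\<pi>} \<inter> space left.good_driver \<in> sets left.good_driver" using aligner_sets by simp
qed

lemma conj_bij_betw:
  assumes "\<pi> permutes V"
  shows "bij_betw (\<lambda>\<sigma>. \<pi> \<circ> \<sigma> \<circ> inv \<pi>) (perms_on V) (perms_on V)"
proof (rule bij_betwI[where g="\<lambda>\<sigma>. inv \<pi> \<circ> \<sigma> \<circ> \<pi>"])
  have b: "bij \<pi>" using assms by (rule permutes_bij)
  show "(\<lambda>\<sigma>. \<pi> \<circ> \<sigma> \<circ> inv \<pi>) \<in> perms_on V \<rightarrow> perms_on V" "(\<lambda>\<sigma>. inv \<pi> \<circ> \<sigma> \<circ> \<pi>) \<in> perms_on V \<rightarrow> perms_on V"
    using assms permutes_inv[OF assms] by (auto simp: perms_on_def intro!: permutes_compose)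
  show "inv \<pi> \<circ> (\<pi> \<circ> \<sigma> \<circ> inv \<pi>) \<circ> \<pi> = \<sigma>" "\<pi> \<circ> (inv \<pi> \<circ> \<sigma> \<circ> \<pi>) \<circ> inv \<pi> = \<sigma>" for \<sigma>
    using b by (auto simp: fun_eq_iff bij_is_inj inv_f_f bij_is_surj surj_f_inv_f)
qed

text \<open>For every fixed stream, conjugation by its relabelling is a bijection of the group and preserves the uniform
  law; integrating over the stream gives the claim. This is why no relation between the relabelling and
  the marks disturbs the law of the second walk.\<close>

lemma realign_measure_preserving:
  "realign K \<in> left.walk_space \<rightarrow>\<^sub>M left.walk_space"
  "distr left.walk_space left.walk_space (realign K) = left.walk_space"
proof -
  interpret G: prob_space left.good_driver by (rule left.prob_space_good_driver)
  interpret U: prob_space "uniform_count_measure (perms_on V)" by (rule left.prob_space_uniform_S)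
  interpret pair_prob_space "uniform_count_measure (perms_on V)" left.good_driver ..
  let ?S = "perms_on V" and ?c = "\<lambda>\<pi> \<sigma>. \<pi> \<circ> \<sigma> \<circ> inv \<pi> :: 'v \<Rightarrow> 'v"
  have fst_m: "fst \<in> left.walk_space \<rightarrow>\<^sub>M count_space ?S"
  proof -
    have "fst \<in> left.walk_space \<rightarrow>\<^sub>M uniform_count_measure ?S" by (simp add: left.walk_space_def)
    then show ?thesis by (simp only: measurable_cong_sets[OF refl sets_uniform_count_measure_count_space])
  qed
  have al: "(\<lambda>z. aligner K (snd z)) \<in> left.walk_space \<rightarrow>\<^sub>M count_space ?S"
    by (rule measurable_compose[OF _ measurable_aligner]) (simp add: left.walk_space_def)
  have "(\<lambda>z. ?c (aligner K (snd z)) (fst z)) \<in> left.walk_space \<rightarrow>\<^sub>M count_space ?S"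
  proof (rule measurable_compose_countable'[where f="\<lambda>\<pi> z. ?c \<pi> (fst z)", OF _ al])
    fix \<pi> assume "\<pi> \<in> ?S"
    then have "?c \<pi> \<in> count_space ?S \<rightarrow>\<^sub>M count_space ?S"
      using conj_bij_betw[of \<pi>] by (auto simp: perms_on_def bij_betw_def)
    then show "(\<lambda>z. ?c \<pi> (fst z)) \<in> left.walk_space \<rightarrow>\<^sub>M count_space ?S"
      by (rule measurable_compose[OF fst_m])
  qed (use finite_perms in \<open>auto intro: countable_finite\<close>)
  then have "(\<lambda>z. ?c (aligner K (snd z)) (fst z)) \<in> left.walk_space \<rightarrow>\<^sub>M uniform_count_measure ?S"
    by (simp only: measurable_cong_sets[OF refl sets_uniform_count_measure_count_space])
  moreover have "snd \<in> left.walk_space \<rightarrow>\<^sub>M left.good_driver" by (simp add: left.walk_space_def)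
  ultimately show m: "realign K \<in> left.walk_space \<rightarrow>\<^sub>M left.walk_space"
    unfolding realign_def[abs_def] left.walk_space_def[of ] by (intro measurable_Pair) (simp_all add: left.walk_space_def)
  show "distr left.walk_space left.walk_space (realign K) = left.walk_space"
  proof (rule measure_eqI)
    fix X assume "X \<in> sets (distr left.walk_space left.walk_space (realign K))"
    then have X: "X \<in> sets left.walk_space" by simp
    have X': "realign K -` X \<inter> space left.walk_space \<in> sets left.walk_space"
      using m X by (rule measurable_sets)
    have "emeasure (distr left.walk_space left.walk_space (realign K)) X = emeasure left.walk_space (realign K -` X \<inter> space left.walk_space)"
      using m X by (rule emeasure_distr)
    also have "\<dots> = (\<integral>\<^sup>+\<omega>. emeasure (uniform_count_measure ?S) ((\<lambda>\<sigma>. (\<sigma>, \<omega>)) -` (realign K -` X \<inter> space left.walk_space)) \<partial>left.good_driver)"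
      using X' unfolding left.walk_space_def by (rule emeasure_pair_measure_alt2)
    also have "\<dots> = (\<integral>\<^sup>+\<omega>. emeasure (uniform_count_measure ?S) ((\<lambda>\<sigma>. (\<sigma>, \<omega>)) -` X) \<partial>left.good_driver)"
    proof (rule nn_integral_cong)
      fix \<omega> assume \<omega>: "\<omega> \<in> space left.good_driver"
      let ?A = "(\<lambda>\<sigma>. (\<sigma>, \<omega>)) -` X"
      let ?B = "(\<lambda>\<sigma>. (\<sigma>, \<omega>)) -` (realign K -` X \<inter> space left.walk_space)"
      have A: "?A \<subseteq> ?S" using sets.sets_into_space[OF X] by (auto simp: left.space_walk_space)
      have B: "?B = {\<sigma>\<in>?S. ?c (aligner K \<omega>) \<sigma> \<in> ?A}"
        by (rule set_eqI) (simp add: left.space_walk_space realign_def \<omega> conj_commute)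
      note bij = conj_bij_betw[OF aligner_permutes, of K \<omega>]
      have im: "?c (aligner K \<omega>) ` ?B = ?A"
        unfolding B by (rule image_Collect_preimage[OF bij_betw_imp_surj_on[OF bij] A])
      have "inj_on (?c (aligner K \<omega>)) ?B"
        using bij_betw_imp_inj_on[OF bij] unfolding B by (rule inj_on_subset) auto
      from card_image[OF this] have card: "card ?A = card ?B" unfolding im .
      have BS: "?B \<subseteq> ?S" unfolding B by auto
      show "emeasure (uniform_count_measure ?S) ?B = emeasure (uniform_count_measure ?S) ?A"
        unfolding emeasure_uniform_count_measure[OF finite_perms BS]
          emeasure_uniform_count_measure[OF finite_perms A] card ..
    qed
    also have "\<dots> = emeasure left.walk_space X"
      using X unfolding left.walk_space_def by (rule emeasure_pair_measure_alt2[symmetric])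
    finally show "emeasure (distr left.walk_space left.walk_space (realign K)) X = emeasure left.walk_space X" .
  qed simp
qed

end

section \<open>The coupled processes on one sample space\<close>

lemma sets_process_event:
  assumes X: "X \<in> M \<rightarrow>\<^sub>M count_space S"
  shows "{\<omega>\<in>space M. X \<omega> = a} \<in> sets M"
proof -
  have "{\<omega>\<in>space M. X \<omega> = a} = X -` ({a} \<inter> S) \<inter> space M"
    using measurable_space[OF X] by auto
  also have "\<dots> \<in> sets M" using X by (rule measurable_sets) auto
  finally show ?thesis .
qed

lemma measure_preserving_event:
  assumes "T \<in> M \<rightarrow>\<^sub>M M'" "distr M M' T = M'" "{z\<in>space M'. P z} \<in> sets M'"
  shows "measure M {\<omega>\<in>space M. P (T \<omega>)} = measure M' {z\<in>space M'. P z}"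
proof -
  have "measure M' {z\<in>space M'. P z} = measure (distr M M' T) {z\<in>space M'. P z}" by (simp only: assms(2))
  also have "\<dots> = measure M (T -` {z\<in>space M'. P z} \<inter> space M)"
    using assms(1,3) by (rule measure_distr)
  also have "T -` {z\<in>space M'. P z} \<inter> space M = {\<omega>\<in>space M. P (T \<omega>)}"
    using measurable_space[OF assms(1)] by auto
  finally show ?thesis by simp
qed

lemma stationary_markov_jump_process_measure_preserving:
  assumes X: "stationary_markov_jump_process M' S G \<nu> X"
    and T: "T \<in> M \<rightarrow>\<^sub>M M'" "distr M M' T = M'" and M: "prob_space M"
  shows "stationary_markov_jump_process M S G \<nu> (\<lambda>t \<omega>. X t (T \<omega>))"
proof -
  have mj: "markov_jump_process M' S G X" and st: "stationary_process M' S X"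
    and init: "distr M' (count_space S) (X 0) = \<nu>"
    using X by (auto simp: stationary_markov_jump_process_def)
  have meas: "X t \<in> M' \<rightarrow>\<^sub>M count_space S" if "0 \<le> t" for t
    using mj that by (simp add: markov_jump_process_def)
  have ev: "{z\<in>space M'. \<forall>i\<in>I. X (\<tau> i) z = a i} \<in> sets M'" if "finite I" "\<And>i. i \<in> I \<Longrightarrow> 0 \<le> \<tau> i"
    for I :: "nat set" and \<tau> a
    using that by (intro sets.sets_Collect_finite_All sets_process_event[of _ M' S] meas) auto
  have "markov_jump_process M S G (\<lambda>t \<omega>. X t (T \<omega>))"
    unfolding markov_jump_process_def
  proof (intro conjI allI impI ballI)
    show "prob_space M" by (rule M)
    show "finite S" using mj by (simp add: markov_jump_process_def)
    show "(\<lambda>\<omega>. X t (T \<omega>)) \<in> M \<rightarrow>\<^sub>M count_space S" if "0 \<le> t" for t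
      by (rule measurable_compose[OF T(1) meas[OF that]])
    show "jump_path (\<lambda>t. X t (T \<omega>))" if "\<omega> \<in> space M" for \<omega>
      using mj measurable_space[OF T(1) that] by (simp add: markov_jump_process_def)
    fix m :: nat and \<tau> :: "nat \<Rightarrow> real" and a t b
    assume \<tau>: "0 \<le> \<tau> 0" "mono_on {..m} \<tau>" and a: "\<forall>i\<le>m. a i \<in> S" and t: "0 \<le> (t::real)" and b: "b \<in> S"
    have \<tau>0: "0 \<le> \<tau> i" if "i \<le> m" for i
      using order_trans[OF \<tau>(1) mono_onD[OF \<tau>(2), of 0 i]] that by simp
    have 1: "{z\<in>space M'. \<forall>i\<le>m. X (\<tau> i) z = a i} \<in> sets M'"
    proof -
      have "{z\<in>space M'. \<forall>i\<in>{..m}. X (\<tau> i) z = a i} \<in> sets M'" by (rule ev) (use \<tau>0 in auto)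
      then show ?thesis by (simp only: Ball_def atMost_iff)
    qed
    have 2: "{z\<in>space M'. (\<forall>i\<le>m. X (\<tau> i) z = a i) \<and> X (\<tau> m + t) z = b} \<in> sets M'"
    proof -
      have "{z\<in>space M'. X (\<tau> m + t) z = b} \<in> sets M'"
        using \<tau>0[of m] t by (intro sets_process_event[of _ M' S] meas) auto
      from sets.Int[OF 1 this] show ?thesis
        by (rule back_subst[of "\<lambda>X. X \<in> sets M'"]) blast
    qed
    have mk: "\<P>(z in M'. (\<forall>i\<le>m. X (\<tau> i) z = a i) \<and> X (\<tau> m + t) z = b)
      = \<P>(z in M'. \<forall>i\<le>m. X (\<tau> i) z = a i) * semigroup_of G t (indicator {b}) (a m)"
      using mj \<tau> a t b unfolding markov_jump_process_def by blast
    have P1: "\<P>(\<omega> in M. \<forall>i\<le>m. X (\<tau> i) (T \<omega>) = a i) = \<P>(z in M'. \<forall>i\<le>m. X (\<tau> i) z = a i)"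
      by (rule measure_preserving_event[OF T 1])
    have P2: "\<P>(\<omega> in M. (\<forall>i\<le>m. X (\<tau> i) (T \<omega>) = a i) \<and> X (\<tau> m + t) (T \<omega>) = b)
      = \<P>(z in M'. (\<forall>i\<le>m. X (\<tau> i) z = a i) \<and> X (\<tau> m + t) z = b)"
      by (rule measure_preserving_event[OF T 2])
    show "\<P>(\<omega> in M. (\<forall>i\<le>m. X (\<tau> i) (T \<omega>) = a i) \<and> X (\<tau> m + t) (T \<omega>) = b)
      = \<P>(\<omega> in M. \<forall>i\<le>m. X (\<tau> i) (T \<omega>) = a i) * semigroup_of G t (indicator {b}) (a m)"
      unfolding P1 P2 by (rule mk)
  qed
  moreover have "distr M (count_space S) (\<lambda>\<omega>. X 0 (T \<omega>)) = \<nu>"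
  proof -
    have "distr M (count_space S) (\<lambda>\<omega>. X 0 (T \<omega>)) = distr (distr M M' T) (count_space S) (X 0)"
      using distr_distr[OF meas[of 0] T(1)] by (simp add: o_def)
    then show ?thesis by (simp only: T(2) init)
  qed
  moreover have "stationary_process M S (\<lambda>t \<omega>. X t (T \<omega>))"
    unfolding stationary_process_def
  proof (intro allI impI)
    fix m :: nat and \<tau> :: "nat \<Rightarrow> real" and a s
    assume \<tau>: "\<forall>i<m. 0 \<le> \<tau> i \<and> a i \<in> S" and s: "0 \<le> (s::real)"
    have 1: "{z\<in>space M'. \<forall>i<m. X (\<sigma> i) z = a i} \<in> sets M'" if "\<And>i. i < m \<Longrightarrow> 0 \<le> \<sigma> i" for \<sigma> :: "nat \<Rightarrow> real"
    proof -
      have "{z\<in>space M'. \<forall>i\<in>{..<m}. X (\<sigma> i) z = a i} \<in> sets M'" by (rule ev) (use that in auto)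
      then show ?thesis by (simp only: Ball_def lessThan_iff)
    qed
    have P1: "\<P>(\<omega> in M. \<forall>i<m. X (\<tau> i) (T \<omega>) = a i) = \<P>(z in M'. \<forall>i<m. X (\<tau> i) z = a i)"
      using \<tau> by (intro measure_preserving_event[OF T] 1) auto
    have P2: "\<P>(\<omega> in M. \<forall>i<m. X (\<tau> i + s) (T \<omega>) = a i) = \<P>(z in M'. \<forall>i<m. X (\<tau> i + s) z = a i)"
      using \<tau> s by (intro measure_preserving_event[OF T] 1) auto
    show "\<P>(\<omega> in M. \<forall>i<m. X (\<tau> i + s) (T \<omega>) = a i) = \<P>(\<omega> in M. \<forall>i<m. X (\<tau> i) (T \<omega>) = a i)"
      unfolding P1 P2 using st \<tau> s unfolding stationary_process_def by blast
  qed
  ultimately show ?thesis by (simp add: stationary_markov_jump_process_def)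
qed

text \<open>Any probability space that injects into the required type of sample points can be transported there; decoding is
  measure preserving.\<close>

lemma embed_measure_decode:
  assumes e: "inj_on e (space N)" and N: "prob_space N"
  defines "dec \<equiv> the_inv_into (space N) e"
  shows "prob_space (embed_measure N e)"
    and "dec \<in> embed_measure N e \<rightarrow>\<^sub>M N" and "distr (embed_measure N e) N dec = N"
proof -
  have em: "e \<in> N \<rightarrow>\<^sub>M embed_measure N e" by (rule measurable_embed_measure2'[OF e])
  have eq: "embed_measure N e = distr N (embed_measure N e) e" by (rule embed_measure_eq_distr'[OF e])
  show "prob_space (embed_measure N e)"
    using prob_space.prob_space_distr[OF N em] by (simp only: eq[symmetric])
  have de: "dec (e z) = z" if "z \<in> space N" for z
    using the_inv_into_f_f[OF e that] by (simp add: dec_def)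
  show dm: "dec \<in> embed_measure N e \<rightarrow>\<^sub>M N"
  proof (rule measurable_embed_measure1)
    show "(\<lambda>z. dec (e z)) \<in> N \<rightarrow>\<^sub>M N" by (subst measurable_cong[OF de]) simp_all
  qed
  have "distr (embed_measure N e) N dec = distr (distr N (embed_measure N e) e) N dec"
    using eq by (rule arg_cong)
  also have "\<dots> = distr N N (dec \<circ> e)" by (rule distr_distr[OF dm em])
  also have "\<dots> = distr N N (\<lambda>z. z)" by (rule distr_cong) (simp_all add: de)
  also have "\<dots> = N" by (rule distr_id)
  finally show "distr (embed_measure N e) N dec = N" .
qed

lemma encode_marked_streams:
  assumes "finite S" "finite C"
  obtains e :: "'s \<times> (real \<times> 'm) stream \<Rightarrow> nat \<Rightarrow> real" where "inj_on e (S \<times> streams (UNIV \<times> C))"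
proof -
  \<comment> \<open>Coordinate 0 holds the state; gaps and marks alternate in the coordinates from 1 on.\<close>
  define e :: "'s \<times> (real \<times> 'm) stream \<Rightarrow> nat \<Rightarrow> real" where
    "e z i = (case i of 0 \<Rightarrow> real (to_nat_on S (fst z)) | Suc j \<Rightarrow>
        if even j then fst (snd z !! (j div 2)) else real (to_nat_on C (snd (snd z !! (j div 2)))))" for z i
  have "inj_on e (S \<times> streams (UNIV \<times> C))"
  proof (rule inj_onI)
    fix z w assume z: "z \<in> S \<times> streams (UNIV \<times> C)" and w: "w \<in> S \<times> streams (UNIV \<times> C)" and eq: "e z = e w"
    have "to_nat_on S (fst z) = to_nat_on S (fst w)" using fun_cong[OF eq, of 0] by (simp add: e_def)
    then have 1: "fst z = fst w"
      using z w inj_onD[OF inj_on_to_nat_on[OF countable_finite[OF assms(1)]], of "fst z" "fst w"]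
      by (simp add: mem_Times_iff)
    have "snd z !! k = snd w !! k" for k
    proof -
      have "fst (snd z !! k) = fst (snd w !! k)" using fun_cong[OF eq, of "Suc (2 * k)"] by (simp add: e_def)
      moreover have "to_nat_on C (snd (snd z !! k)) = to_nat_on C (snd (snd w !! k))"
        using fun_cong[OF eq, of "Suc (2 * k + 1)"] by (simp add: e_def)
      moreover have "snd (snd z !! k) \<in> C" "snd (snd w !! k) \<in> C"
        using snth_in[of "snd z" "UNIV \<times> C" k] snth_in[of "snd w" "UNIV \<times> C" k] z w
        by (simp_all add: mem_Times_iff)
      ultimately show ?thesis
        using inj_onD[OF inj_on_to_nat_on[OF countable_finite[OF assms(2)]], of "snd (snd z !! k)" "snd (snd w !! k)"]
        by (simp add: prod_eq_iff)
    qed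
    then have "snd z = snd w" by (metis (no_types) smap_alt stream.map_ident)
    with 1 show "z = w" by (simp add: prod_eq_iff)
  qed
  then show ?thesis by (rule that)
qed

text \<open>By right-continuity every value taken on \<open>[0, T)\<close> is taken at a rational time, so the maximum over the
  interval, which ranges over finitely many values, is a maximum over countably many times.\<close>

lemma measurable_Max_of_jump_paths:
  fixes d :: "'a \<Rightarrow> 'b \<Rightarrow> real"
  assumes fin: "finite S" "finite S'"
    and X: "\<And>t. 0 \<le> t \<Longrightarrow> X t \<in> M \<rightarrow>\<^sub>M count_space S" "\<And>\<omega>. \<omega> \<in> space M \<Longrightarrow> jump_path (\<lambda>t. X t \<omega>)"
    and Y: "\<And>t. 0 \<le> t \<Longrightarrow> Y t \<in> M \<rightarrow>\<^sub>M count_space S'" "\<And>\<omega>. \<omega> \<in> space M \<Longrightarrow> jump_path (\<lambda>t. Y t \<omega>)"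
    and T: "0 \<le> T"
  shows "(\<lambda>\<omega>. MAX t\<in>{0..T}. d (X t \<omega>) (Y t \<omega>)) \<in> borel_measurable M"
proof -
  let ?f = "\<lambda>t \<omega>. d (X t \<omega>) (Y t \<omega>)"
  have fim: "finite ((\<lambda>t. ?f t \<omega>) ` {0..T})" if "\<omega> \<in> space M" for \<omega>
  proof (rule finite_subset)
    show "(\<lambda>t. ?f t \<omega>) ` {0..T} \<subseteq> (\<lambda>(x, y). d x y) ` (S \<times> S')"
      using measurable_space[OF X(1) that] measurable_space[OF Y(1) that] by force
  qed (use fin in auto)
  define Q where "Q = insert T (\<rat> \<inter> {0..T})"
  have Q: "countable Q" using countable_rat by (auto simp: Q_def)
  have Q0: "0 \<le> q" "q \<le> T" if "q \<in> Q" for q using that T by (auto simp: Q_def)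
  have rat: "\<exists>q\<in>Q. ?f q \<omega> = ?f t \<omega>" if t: "t \<in> {0..T}" and \<omega>: "\<omega> \<in> space M" for t \<omega>
  proof (cases "t = T")
    case False
    obtain e where e: "e > 0" "\<forall>s\<in>{t..<t + e}. X s \<omega> = X t \<omega>"
      using X(2)[OF \<omega>, unfolded jump_path_def, THEN conjunct1, THEN spec, THEN mp, of t] t by auto
    obtain e' where e': "e' > 0" "\<forall>s\<in>{t..<t + e'}. Y s \<omega> = Y t \<omega>"
      using Y(2)[OF \<omega>, unfolded jump_path_def, THEN conjunct1, THEN spec, THEN mp, of t] t by auto
    \<comment> \<open>Both paths are constant on a common interval to the right of \<open>t\<close>, which contains a rational.\<close>
    have "t < min T (min (t + e) (t + e'))" using False t e e' by auto
    from Rats_dense_in_real[OF this] obtain q where q: "q \<in> \<rat>" "t < q" "q < min T (min (t + e) (t + e'))" by blast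
    then have "X q \<omega> = X t \<omega>" "Y q \<omega> = Y t \<omega>" by (auto intro!: e(2)[THEN bspec] e'(2)[THEN bspec])
    moreover have "q \<in> Q" using q t by (auto simp: Q_def)
    ultimately show ?thesis by (intro bexI[of _ q]) simp_all
  qed (auto simp: Q_def)
  show ?thesis
    unfolding borel_measurable_iff_le
  proof
    fix c
    have "{\<omega>\<in>space M. (MAX t\<in>{0..T}. ?f t \<omega>) \<le> c} = {\<omega>\<in>space M. \<forall>q\<in>Q. ?f q \<omega> \<le> c}"
    proof (intro Collect_cong conj_cong refl)
      fix \<omega> assume \<omega>: "\<omega> \<in> space M"
      have "(MAX t\<in>{0..T}. ?f t \<omega>) \<le> c \<longleftrightarrow> (\<forall>t\<in>{0..T}. ?f t \<omega> \<le> c)"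
        using fim[OF \<omega>] T by (subst Max_le_iff) auto
      also have "\<dots> \<longleftrightarrow> (\<forall>q\<in>Q. ?f q \<omega> \<le> c)"
      proof
        assume a: "\<forall>q\<in>Q. ?f q \<omega> \<le> c"
        show "\<forall>t\<in>{0..T}. ?f t \<omega> \<le> c"
        proof
          fix t assume "t \<in> {0..T}"
          from rat[OF this \<omega>] obtain q where "q \<in> Q" "?f q \<omega> = ?f t \<omega>" by blast
          then show "?f t \<omega> \<le> c" using bspec[OF a, of q] by simp
        qed
      qed (use Q0 in auto)
      finally show "(MAX t\<in>{0..T}. ?f t \<omega>) \<le> c \<longleftrightarrow> (\<forall>q\<in>Q. ?f q \<omega> \<le> c)" .
    qed
    also have "\<dots> \<in> sets M"
    proof (rule sets.sets_Collect_countable_All'[OF _ Q])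
      fix q assume "q \<in> Q"
      then have q: "0 \<le> q" by (rule Q0)
      have "{\<omega>\<in>space M. ?f q \<omega> \<le> c} = (\<Union>x\<in>S. \<Union>y\<in>{y\<in>S'. d x y \<le> c}. {\<omega>\<in>space M. X q \<omega> = x} \<inter> {\<omega>\<in>space M. Y q \<omega> = y})"
        using measurable_space[OF X(1)[OF q]] measurable_space[OF Y(1)[OF q]] by auto
      also have "\<dots> \<in> sets M"
        using fin by (intro sets.finite_UN sets.Int sets_process_event[OF X(1)[OF q]] sets_process_event[OF Y(1)[OF q]]) auto
      finally show "{\<omega>\<in>space M. ?f q \<omega> \<le> c} \<in> sets M" .
    qed
    finally show "{\<omega>\<in>space M. (MAX t\<in>{0..T}. ?f t \<omega>) \<le> c} \<in> sets M" .
  qed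
qed

text \<open>Each endpoint of a uniformly chosen pair hits any given vertex with probability at most \<open>1 / N\<close>, written
  without division.\<close>

definition balanced_pairs :: "'v set \<Rightarrow> ('v \<times> 'v) set \<Rightarrow> bool" where
  "balanced_pairs V E \<longleftrightarrow> (\<forall>v. card V * card {e\<in>E. fst e = v} \<le> card E \<and> card V * card {e\<in>E. snd e = v} \<le> card E)"

lemma balanced_pairs_meets:
  assumes E: "balanced_pairs V E" "finite E" and V: "0 < card V"
  shows "real (card {q\<in>E. meets p q}) \<le> 4 / real (card V) * real (card E)"
proof -
  let ?A = "\<lambda>v. {e\<in>E. fst e = v}" and ?B = "\<lambda>v. {e\<in>E. snd e = v}"
  have "{q\<in>E. meets p q} \<subseteq> (?A (fst p) \<union> ?B (fst p)) \<union> (?A (snd p) \<union> ?B (snd p))"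
    by (auto simp: meets_def)
  then have "card {q\<in>E. meets p q} \<le> card ((?A (fst p) \<union> ?B (fst p)) \<union> (?A (snd p) \<union> ?B (snd p)))"
    using E(2) by (intro card_mono) auto
  also have "\<dots> \<le> (card (?A (fst p)) + card (?B (fst p))) + (card (?A (snd p)) + card (?B (snd p)))"
    by (rule order_trans[OF card_Un_le add_mono[OF card_Un_le card_Un_le]])
  finally have "card V * card {q\<in>E. meets p q} \<le> card V * ((card (?A (fst p)) + card (?B (fst p))) + (card (?A (snd p)) + card (?B (snd p))))"
    by (rule mult_left_mono) simp
  also have "\<dots> = (card V * card (?A (fst p)) + card V * card (?B (fst p))) + (card V * card (?A (snd p)) + card V * card (?B (snd p)))"
    by (simp only: distrib_left)
  also have "\<dots> \<le> (card E + card E) + (card E + card E)"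
    using E(1) unfolding balanced_pairs_def by (intro add_mono) auto
  finally have "real (card V * card {q\<in>E. meets p q}) \<le> real (4 * card E)" by (simp only: of_nat_le_iff)
  then show ?thesis using V by (simp add: field_simps)
qed

lemma card_distinct_pairs:
  assumes "finite V"
  shows "card (distinct_pairs V) = card V * (card V - 1)"
proof -
  have "distinct_pairs V = Sigma V (\<lambda>x. V - {x})" by (auto simp: distinct_pairs_def)
  then show ?thesis using assms by simp
qed

lemma balanced_distinct_pairs:
  assumes "finite V"
  shows "balanced_pairs V (distinct_pairs V)"
  unfolding balanced_pairs_def
proof (intro allI conjI)
  fix v
  have "card {e\<in>distinct_pairs V. fst e = v} \<le> card V - 1" "card {e\<in>distinct_pairs V. snd e = v} \<le> card V - 1"
  proof -
    show "card {e\<in>distinct_pairs V. fst e = v} \<le> card V - 1"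
    proof (cases "v \<in> V")
      case True
      have "card {e\<in>distinct_pairs V. fst e = v} \<le> card (Pair v ` (V - {v}))"
        using assms by (intro card_mono) (auto simp: distinct_pairs_def)
      also have "\<dots> \<le> card (V - {v})" using assms by (intro card_image_le) auto
      finally show ?thesis using True assms by simp
    next
      case False
      then have "{e\<in>distinct_pairs V. fst e = v} = {}" by (auto simp: distinct_pairs_def)
      then show ?thesis by (simp only: card.empty)
    qed
    show "card {e\<in>distinct_pairs V. snd e = v} \<le> card V - 1"
    proof (cases "v \<in> V")
      case True
      have "card {e\<in>distinct_pairs V. snd e = v} \<le> card ((\<lambda>x. (x, v)) ` (V - {v}))"
        using assms by (intro card_mono) (auto simp: distinct_pairs_def)
      also have "\<dots> \<le> card (V - {v})" using assms by (intro card_image_le) auto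
      finally show ?thesis using True assms by simp
    next
      case False
      then have "{e\<in>distinct_pairs V. snd e = v} = {}" by (auto simp: distinct_pairs_def)
      then show ?thesis by (simp only: card.empty)
    qed
  qed
  then show "card V * card {e\<in>distinct_pairs V. fst e = v} \<le> card (distinct_pairs V)"
    "card V * card {e\<in>distinct_pairs V. snd e = v} \<le> card (distinct_pairs V)"
    unfolding card_distinct_pairs[OF assms] by (auto intro: mult_left_mono)
qed

context coupled_walks
begin

lemma card_V: "0 < card V" using finite_V V_ne by (simp add: card_gt_0_iff)

text \<open>The event on which the two cycle partitions may differ before time \<open>T\<close>.\<close>

definition uncoupled :: "nat \<Rightarrow> real \<Rightarrow> (real \<times> ('v \<times> 'v) \<times> ('v \<times> 'v)) stream \<Rightarrow> bool" where
  "uncoupled K T \<omega> \<longleftrightarrow> K < jump_count T \<omega> \<or>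
     (\<exists>j<K. \<exists>i<j. meets (fst (snd (\<omega> !! i))) (fst (snd (\<omega> !! j)))) \<or>
     (\<exists>j<K. \<exists>i<j. meets (snd (snd (\<omega> !! i))) (snd (snd (\<omega> !! j))))"

lemma measure_uncoupled:
  assumes bE: "balanced_pairs V E" and bD: "balanced_pairs V D" and T: "0 \<le> T"
  shows "measure left.walk_space {z\<in>space left.walk_space. uncoupled K T (snd z)}
      \<le> T / (real K + 1) + 8 * real K ^ 2 / real (card V)"
    and "{z\<in>space left.walk_space. uncoupled K T (snd z)} \<in> sets left.walk_space"
proof -
  interpret G: prob_space left.good_driver by (rule left.prob_space_good_driver)
  let ?G = left.good_driver
  let ?J = "{\<omega>\<in>space ?G. K < jump_count T \<omega>}"
  let ?L = "{\<omega>\<in>space ?G. \<exists>j<K. \<exists>i<j. meets (fst (snd (\<omega> !! i))) (fst (snd (\<omega> !! j)))}"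
  let ?R = "{\<omega>\<in>space ?G. \<exists>j<K. \<exists>i<j. meets (snd (snd (\<omega> !! i))) (snd (snd (\<omega> !! j)))}"
  have b: "0 \<le> 4 / real (card V)" by simp
  have cE: "real (card {c'\<in>E \<times> D. meets (fst c) (fst c')}) \<le> 4 / real (card V) * real (card (E \<times> D))" for c
  proof -
    have "{c'\<in>E \<times> D. meets (fst c) (fst c')} = {q\<in>E. meets (fst c) q} \<times> D" by auto
    then have "real (card {c'\<in>E \<times> D. meets (fst c) (fst c')}) = real (card {q\<in>E. meets (fst c) q}) * real (card D)"
      by (simp only: card_cartesian_product of_nat_mult)
    also have "\<dots> \<le> (4 / real (card V) * real (card E)) * real (card D)"
      using balanced_pairs_meets[OF bE finite_E card_V] by (rule mult_right_mono) simp
    finally show ?thesis by (simp only: card_cartesian_product of_nat_mult mult.assoc)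
  qed
  have cD: "real (card {c'\<in>E \<times> D. meets (snd c) (snd c')}) \<le> 4 / real (card V) * real (card (E \<times> D))" for c
  proof -
    have "{c'\<in>E \<times> D. meets (snd c) (snd c')} = E \<times> {q\<in>D. meets (snd c) q}" by auto
    then have "real (card {c'\<in>E \<times> D. meets (snd c) (snd c')}) = real (card E) * real (card {q\<in>D. meets (snd c) q})"
      by (simp only: card_cartesian_product of_nat_mult)
    also have "\<dots> \<le> real (card E) * (4 / real (card V) * real (card D))"
      using balanced_pairs_meets[OF bD finite_D card_V] by (rule mult_left_mono) simp
    finally show ?thesis by (simp only: card_cartesian_product of_nat_mult mult_ac)
  qed
  note L = left.measure_clash_le[of "\<lambda>c c'. meets (fst c) (fst c')", OF cE b, of K]
  note R = left.measure_clash_le[of "\<lambda>c c'. meets (snd c) (snd c')", OF cD b, of K]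
  note J = left.measure_jump_count_gt_le[OF T, of K]
  have eq: "{\<omega>\<in>space ?G. uncoupled K T \<omega>} = ?J \<union> (?L \<union> ?R)" unfolding uncoupled_def by blast
  have sets: "{\<omega>\<in>space ?G. uncoupled K T \<omega>} \<in> sets ?G"
    unfolding eq by (intro sets.Un J L R)
  show "{z\<in>space left.walk_space. uncoupled K T (snd z)} \<in> sets left.walk_space"
    by (rule left.measure_walk_space_snd(2)[OF sets])
  have "measure left.walk_space {z\<in>space left.walk_space. uncoupled K T (snd z)} = measure ?G (?J \<union> (?L \<union> ?R))"
    unfolding left.measure_walk_space_snd(1)[OF sets] eq ..
  also have "\<dots> \<le> measure ?G ?J + (measure ?G ?L + measure ?G ?R)"
    by (rule order_trans[OF measure_Un_le add_left_mono[OF measure_Un_le]]) (intro sets.Un J L R)+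
  also have "\<dots> \<le> T / (real K + 1) + (real K ^ 2 * (4 / real (card V)) + real K ^ 2 * (4 / real (card V)))"
    by (intro add_mono J L R)
  finally show "measure left.walk_space {z\<in>space left.walk_space. uncoupled K T (snd z)}
      \<le> T / (real K + 1) + 8 * real K ^ 2 / real (card V)" by (simp add: field_simps)
qed

text \<open>The number \<open>K\<close> of jumps up to which the walks are aligned is free, to be balanced against \<open>T\<close> and \<open>N\<close> later.\<close>

theorem coupling_exists:
  fixes G :: "(('v \<Rightarrow> 'v) \<Rightarrow> real) \<Rightarrow> ('v \<Rightarrow> 'v) \<Rightarrow> real"
  assumes V: "2 \<le> card V" and D_eq: "D = distinct_pairs V" and bE: "balanced_pairs V E" and T: "0 \<le> T"
    and G: "\<And>f \<sigma>. \<sigma> \<in> perms_on V \<Longrightarrow>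
      G f \<sigma> = (\<Sum>(x, y)\<in>E. f (Transposition.transpose x y \<circ> \<sigma>)) / real (card E) - f \<sigma>"
  shows "\<exists>(M :: (nat \<Rightarrow> real) measure) \<eta> \<zeta>.
    stationary_markov_jump_process M (perms_on V) G (uniform_count_measure (perms_on V)) \<eta> \<and>
    stationary_markov_jump_process M (disc_partitions (card V)) (split_merge_gen (card V)) (cycle_law V) \<zeta> \<and>
    (\<forall>\<omega>\<in>space M. \<zeta> 0 \<omega> = cycle_partition V (\<eta> 0 \<omega>)) \<and>
    (\<lambda>\<omega>. MAX t\<in>{0..T}. l1_dist (cycle_partition V (\<eta> t \<omega>)) (\<zeta> t \<omega>)) \<in> borel_measurable M \<and>
    (\<forall>\<delta>>0. \<P>(\<omega> in M. (MAX t\<in>{0..T}. l1_dist (cycle_partition V (\<eta> t \<omega>)) (\<zeta> t \<omega>)) > \<delta>)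
        \<le> T / (real K + 1) + 8 * real K ^ 2 / real (card V))"
proof -
  let ?W = "left.walk_space" and ?S = "perms_on V"
  have NV: "card V \<noteq> 0" using V by simp
  obtain e :: "('v \<Rightarrow> 'v) \<times> (real \<times> ('v \<times> 'v) \<times> ('v \<times> 'v)) stream \<Rightarrow> nat \<Rightarrow> real"
    where e0: "inj_on e (?S \<times> streams (UNIV \<times> (E \<times> D)))"
    by (rule encode_marked_streams[of ?S "E \<times> D"]) (use finite_perms finite_E finite_D in auto)
  have e: "inj_on e (space ?W)"
    by (rule inj_on_subset[OF e0]) (auto simp: left.space_walk_space left.space_good_driver left.space_driver)
  define M where "M = embed_measure ?W e"
  define dec where "dec = the_inv_into (space ?W) e"
  note emb = embed_measure_decode[OF e left.prob_space_walk_space, folded dec_def M_def]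
  define \<eta> where "\<eta> t \<omega> = marked_path swap_left t (dec \<omega>)" for t \<omega>
  define \<zeta> where "\<zeta> t \<omega> = cycle_partition V (marked_path swap_right t (realign K (dec \<omega>)))" for t \<omega>
  interpret M: prob_space M by (rule emb(1))
  have cardD: "real (card D) = real (card V) * (real (card V) - 1)"
    using V by (simp add: D_eq card_distinct_pairs[OF finite_V] of_nat_diff)
  have left_proc: "stationary_markov_jump_process ?W ?S G (distr (uniform_count_measure ?S) (count_space ?S) (\<lambda>x. x))
      (\<lambda>t z. marked_path swap_left t z)"
  proof (rule left.stationary_markov_jump_process_walk[where h="\<lambda>x. x"])
    fix f \<sigma> assume "\<sigma> \<in> ?S"
    then show "G f \<sigma> = left.step_avg (f \<circ> (\<lambda>x. x)) \<sigma> - f \<sigma>"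
      by (simp add: G left_step_avg o_def)
  qed (use finite_perms in auto)
  have "distr (uniform_count_measure ?S) (count_space ?S) (\<lambda>x. x) = uniform_count_measure ?S"
    by (rule trans[OF distr_cong distr_id]) (simp_all add: sets_uniform_count_measure)
  then have \<eta>: "stationary_markov_jump_process M ?S G (uniform_count_measure ?S) \<eta>"
    using stationary_markov_jump_process_measure_preserving[OF left_proc emb(2,3,1)] by (simp add: \<eta>_def[abs_def])
  have right_proc: "stationary_markov_jump_process ?W (disc_partitions (card V)) (split_merge_gen (card V))
      (distr (uniform_count_measure ?S) (count_space (disc_partitions (card V))) (cycle_partition V))
      (\<lambda>t z. cycle_partition V (marked_path swap_right t z))"
  proof (rule right.stationary_markov_jump_process_walk)
    show "finite (disc_partitions (card V))" by (rule finite_disc_partitions[OF NV])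
    show "cycle_partition V \<sigma> \<in> disc_partitions (card V)" if "\<sigma> \<in> ?S" for \<sigma>
      using that by (intro cycle_partition_in_disc_partitions finite_V V_ne) (simp add: perms_on_def)
    fix f \<sigma> assume "\<sigma> \<in> ?S"
    then have \<sigma>: "\<sigma> permutes V" by (simp add: perms_on_def)
    have D0: "real (card D) \<noteq> 0" using cardD V by simp
    have "split_merge_gen (card V) f (cycle_partition V \<sigma>)
      = (\<Sum>(x, y)\<in>D. f (cycle_partition V (Transposition.transpose x y \<circ> \<sigma>)) - f (cycle_partition V \<sigma>)) / real (card D)"
      unfolding split_merge_gen_cycle_partition[OF finite_V V \<sigma>] D_eq[symmetric] cardD ..
    also have "\<dots> = right.step_avg (f \<circ> cycle_partition V) \<sigma> - f (cycle_partition V \<sigma>)"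
      using D0 by (simp add: right_step_avg case_prod_unfold sum_subtractf diff_divide_distrib)
    finally show "split_merge_gen (card V) f (cycle_partition V \<sigma>) =
        right.step_avg (f \<circ> cycle_partition V) \<sigma> - f (cycle_partition V \<sigma>)" .
  qed
  have T2: "(\<lambda>\<omega>. realign K (dec \<omega>)) \<in> M \<rightarrow>\<^sub>M ?W"
    by (rule measurable_compose[OF emb(2) realign_measure_preserving(1)])
  have "distr M ?W (\<lambda>\<omega>. realign K (dec \<omega>)) = distr (distr M ?W dec) ?W (realign K)"
    using distr_distr[OF realign_measure_preserving(1) emb(2), of K] by (simp add: o_def)
  also have "\<dots> = ?W" unfolding emb(3) by (rule realign_measure_preserving(2))
  finally have T2d: "distr M ?W (\<lambda>\<omega>. realign K (dec \<omega>)) = ?W" .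
  have \<zeta>: "stationary_markov_jump_process M (disc_partitions (card V)) (split_merge_gen (card V)) (cycle_law V) \<zeta>"
    using stationary_markov_jump_process_measure_preserving[OF right_proc T2 T2d emb(1)]
    by (simp add: \<zeta>_def[abs_def] cycle_law_def)
  have start: "\<zeta> 0 \<omega> = cycle_partition V (\<eta> 0 \<omega>)" if \<omega>: "\<omega> \<in> space M" for \<omega>
  proof -
    have z: "dec \<omega> \<in> space ?W" using measurable_space[OF emb(2) \<omega>] .
    then have "fst (dec \<omega>) \<in> ?S" by (simp add: left.space_walk_space mem_Times_iff)
    then have "permutation (fst (dec \<omega>))"
      using finite_V by (auto simp: perms_on_def permutation_permutes)
    then show ?thesis
      using left.marked_path_0[OF z, of swap_left]
        left.marked_path_0[OF measurable_space[OF realign_measure_preserving(1) z], of swap_right K]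
      by (simp add: \<eta>_def \<zeta>_def realign_def cycle_partition_conj[OF aligner_permutes])
  qed
  have mj\<eta>: "markov_jump_process M ?S G \<eta>" using \<eta> by (simp add: stationary_markov_jump_process_def)
  have mj\<zeta>: "markov_jump_process M (disc_partitions (card V)) (split_merge_gen (card V)) \<zeta>"
    using \<zeta> by (simp add: stationary_markov_jump_process_def)
  let ?max = "\<lambda>\<omega>. MAX t\<in>{0..T}. l1_dist (cycle_partition V (\<eta> t \<omega>)) (\<zeta> t \<omega>)"
  have meas: "?max \<in> borel_measurable M"
    by (rule measurable_Max_of_jump_paths[OF finite_perms finite_disc_partitions[OF NV],
          where d="\<lambda>\<sigma> p. l1_dist (cycle_partition V \<sigma>) p"])
      (use mj\<eta> mj\<zeta> T in \<open>auto simp: markov_jump_process_def\<close>)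
  have bound: "\<P>(\<omega> in M. ?max \<omega> > \<delta>) \<le> T / (real K + 1) + 8 * real K ^ 2 / real (card V)" if \<delta>: "\<delta> > 0" for \<delta>
  proof -
    have bD: "balanced_pairs V D" unfolding D_eq by (rule balanced_distinct_pairs[OF finite_V])
    note U = measure_uncoupled[OF bE bD T, of K]
    have "{\<omega>\<in>space M. ?max \<omega> > \<delta>} \<subseteq> {\<omega>\<in>space M. uncoupled K T (snd (dec \<omega>))}"
    proof (intro subsetI CollectI conjI)
      fix \<omega> assume \<omega>: "\<omega> \<in> {\<omega>\<in>space M. ?max \<omega> > \<delta>}"
      then show "\<omega> \<in> space M" by simp
      then have z: "dec \<omega> \<in> space ?W" by (rule measurable_space[OF emb(2)])
      show "uncoupled K T (snd (dec \<omega>))"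
      proof (rule ccontr)
        assume n: "\<not> uncoupled K T (snd (dec \<omega>))"
        have "\<zeta> t \<omega> = cycle_partition V (\<eta> t \<omega>)" if "t \<in> {0..T}" for t
          unfolding \<zeta>_def \<eta>_def using n that
          by (intro cycle_partition_coupled[OF z, of K T]) (auto simp: uncoupled_def not_less)
        then have "(\<lambda>t. l1_dist (cycle_partition V (\<eta> t \<omega>)) (\<zeta> t \<omega>)) ` {0..T} = (\<lambda>t. 0) ` {0..T}"
          by (intro image_cong) (auto simp: l1_dist_def)
        then have "?max \<omega> = Max ((\<lambda>t. 0) ` {0..T})" by (rule arg_cong)
        also have "\<dots> = 0" using T by (simp add: image_constant_conv)
        finally show False using \<omega> \<delta> by simp
      qed
    qed
    moreover have "{\<omega>\<in>space M. uncoupled K T (snd (dec \<omega>))} \<in> sets M"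
    proof -
      have "{\<omega>\<in>space M. uncoupled K T (snd (dec \<omega>))} = dec -` {z\<in>space ?W. uncoupled K T (snd z)} \<inter> space M"
        using measurable_space[OF emb(2)] by auto
      then show ?thesis using measurable_sets[OF emb(2) U(2)] by simp
    qed
    ultimately have "\<P>(\<omega> in M. ?max \<omega> > \<delta>) \<le> measure M {\<omega>\<in>space M. uncoupled K T (snd (dec \<omega>))}"
      by (rule M.finite_measure_mono)
    also have "\<dots> = measure ?W {z\<in>space ?W. uncoupled K T (snd z)}"
      by (rule measure_preserving_event[OF emb(2,3) U(2)])
    finally show ?thesis using U(1) by (rule order_trans)
  qed
  show ?thesis
    using \<eta> \<zeta> start meas bound by blast
qed

end

section \<open>The discrete torus\<close>

definition torus_shift :: "nat \<Rightarrow> nat \<Rightarrow> (nat \<Rightarrow> nat) \<Rightarrow> nat \<Rightarrow> nat" where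
  "torus_shift n i x = x(i := (x i + 1) mod n)"

text \<open>Each edge of the torus appears once, in the direction of increasing coordinate. Edges are thereby
  ordered pairs, to be compared with the ordered pairs of the complete graph.\<close>

definition directed_edges :: "nat \<Rightarrow> nat \<Rightarrow> ((nat \<Rightarrow> nat) \<times> (nat \<Rightarrow> nat)) set" where
  "directed_edges d n = (\<lambda>(x, i). (x, torus_shift n i x)) ` (torus d n \<times> {..<d})"

lemma finite_torus: "finite (torus d n)" and card_torus: "card (torus d n) = n ^ d"
  by (auto simp: torus_def card_PiE intro: finite_PiE)

lemma torus_lt: "x \<in> torus d n \<Longrightarrow> i < d \<Longrightarrow> x i < n"
  by (auto simp: torus_def)

lemma torus_shift_in: "x \<in> torus d n \<Longrightarrow> i < d \<Longrightarrow> torus_shift n i x \<in> torus d n"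
proof -
  assume x: "x \<in> torus d n" and i: "i < d"
  then have "0 < n" using torus_lt[OF x i] by simp
  then show ?thesis using x i by (auto simp: torus_def torus_shift_def PiE_iff extensional_def)
qed

lemma Suc_mod_neq: "2 \<le> n \<Longrightarrow> a < n \<Longrightarrow> (a + 1) mod n \<noteq> (a::nat)"
  by (cases "a + 1 = n") auto

lemma Suc_Suc_mod_neq: "3 \<le> n \<Longrightarrow> a < n \<Longrightarrow> ((a + 1) mod n + 1) mod n \<noteq> (a::nat)"
  by (cases "a + 1 = n"; cases "a + 2 = n") auto

lemma torus_shift_neq: "2 \<le> n \<Longrightarrow> x \<in> torus d n \<Longrightarrow> i < d \<Longrightarrow> torus_shift n i x \<noteq> x"
  using Suc_mod_neq[of n "x i"] torus_lt[of x d n i] by (auto simp: torus_shift_def fun_eq_iff)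

lemma torus_shift_inj:
  assumes "2 \<le> n" "x \<in> torus d n" "i < d" "torus_shift n i x = torus_shift n j x"
  shows "i = j"
  using fun_cong[OF assms(4), of i] Suc_mod_neq[OF assms(1) torus_lt[OF assms(2,3)]]
  by (auto simp: torus_shift_def split: if_splits)

lemma torus_shift_shift_neq:
  assumes n: "3 \<le> n" and x: "x \<in> torus d n" and i: "i < d"
  shows "torus_shift n j (torus_shift n i x) \<noteq> x"
proof
  assume "torus_shift n j (torus_shift n i x) = x"
  from fun_cong[OF this, of i] show False
    using Suc_mod_neq[of n "x i"] Suc_Suc_mod_neq[OF n, of "x i"] torus_lt[OF x i] n
    by (cases "i = j") (auto simp: torus_shift_def)
qed

lemma inj_directed_edges: "2 \<le> n \<Longrightarrow> inj_on (\<lambda>(x, i). (x, torus_shift n i x)) (torus d n \<times> {..<d})"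
  by (auto simp: inj_on_def dest: torus_shift_inj)

lemma card_directed_edges: "2 \<le> n \<Longrightarrow> card (directed_edges d n) = d * n ^ d"
  unfolding directed_edges_def by (simp add: card_image[OF inj_directed_edges] card_cartesian_product card_torus)

lemma directed_edges_subset: "2 \<le> n \<Longrightarrow> directed_edges d n \<subseteq> distinct_pairs (torus d n)"
  using torus_shift_neq torus_shift_in
  by (fastforce simp: directed_edges_def distinct_pairs_def)

lemma balanced_directed_edges:
  assumes n: "2 \<le> n"
  shows "balanced_pairs (torus d n) (directed_edges d n)"
  unfolding balanced_pairs_def
proof (intro allI conjI)
  fix v
  have "card {e\<in>directed_edges d n. fst e = v} \<le> card ((\<lambda>i. (v, torus_shift n i v)) ` {..<d})"
    by (intro card_mono) (auto simp: directed_edges_def)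
  also have "\<dots> \<le> d" using card_image_le[of "{..<d}"] by simp
  finally have 1: "card {e\<in>directed_edges d n. fst e = v} \<le> d" .
  have "card {e\<in>directed_edges d n. snd e = v} \<le> card ((\<lambda>i. (v(i := (v i + n - 1) mod n), v)) ` {..<d})"
  proof (intro card_mono subsetI)
    fix e assume "e \<in> {e\<in>directed_edges d n. snd e = v}"
    then obtain x i where x: "x \<in> torus d n" "i < d" "e = (x, v)" "v = torus_shift n i x"
      by (auto simp: directed_edges_def)
    have "(v i + n - 1) mod n = x i"
      using torus_lt[OF x(1,2)] n unfolding x(4) torus_shift_def
      by (cases "x i + 1 = n") (auto simp: mod_if)
    then have "x = v(i := (v i + n - 1) mod n)" by (auto simp: x(4) torus_shift_def)
    then show "e \<in> (\<lambda>i. (v(i := (v i + n - 1) mod n), v)) ` {..<d}" using x by blast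
  qed simp
  also have "\<dots> \<le> d" using card_image_le[of "{..<d}"] by simp
  finally have 2: "card {e\<in>directed_edges d n. snd e = v} \<le> d" .
  show "card (torus d n) * card {e\<in>directed_edges d n. fst e = v} \<le> card (directed_edges d n)"
    "card (torus d n) * card {e\<in>directed_edges d n. snd e = v} \<le> card (directed_edges d n)"
    using mult_left_mono[OF 1, of "n ^ d"] mult_left_mono[OF 2, of "n ^ d"] n
    by (simp_all add: card_torus card_directed_edges mult.commute)
qed

lemma edge_swap_doubleton: "edge_swap {x, y} = Transposition.transpose x y"
  unfolding edge_swap_def
  by (rule the_equality) (auto simp: doubleton_eq_iff transpose_commute)

text \<open>For \<open>n \<ge> 3\<close> an increase of one coordinate by 1 is never undone by an increase of a coordinate by 1, so different directed
  edges have different sets of endpoints.\<close>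

lemma stirring_gen_directed_edges:
  assumes n: "3 \<le> n" and d: "1 \<le> d"
  shows "stirring_gen d n f \<sigma> =
    (\<Sum>(x, y)\<in>directed_edges d n. f (Transposition.transpose x y \<circ> \<sigma>)) / real (card (directed_edges d n)) - f \<sigma>"
proof -
  let ?N = "real (d * n ^ d)"
  have edges: "torus_edges d n = (\<lambda>(x, y). {x, y}) ` directed_edges d n"
    by (force simp: torus_edges_def directed_edges_def torus_shift_def image_iff)
  have inj: "inj_on (\<lambda>(x, y). {x, y}) (directed_edges d n)"
  proof (rule inj_onI)
    fix p q assume "p \<in> directed_edges d n" "q \<in> directed_edges d n"
      and eq: "(case p of (x, y) \<Rightarrow> {x, y}) = (case q of (x, y) \<Rightarrow> {x, y})"
    then obtain x i z j where p: "p = (x, torus_shift n i x)" "x \<in> torus d n" "i < d"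
      and q: "q = (z, torus_shift n j z)" "z \<in> torus d n" "j < d"
      by (auto simp: directed_edges_def)
    show "p = q"
      using eq torus_shift_shift_neq[OF n p(2,3), of j] by (auto simp: p(1) q(1) doubleton_eq_iff)
  qed
  have N: "real (card (directed_edges d n)) = ?N" "?N \<noteq> 0" using n d by (simp_all add: card_directed_edges)
  have "stirring_gen d n f \<sigma> = (\<Sum>(x, y)\<in>directed_edges d n. 1 / ?N * (f (Transposition.transpose x y \<circ> \<sigma>) - f \<sigma>))"
    unfolding stirring_gen_def edges
    by (subst sum.reindex[OF inj]) (auto simp: edge_swap_doubleton intro!: sum.cong)
  also have "\<dots> = (\<Sum>(x, y)\<in>directed_edges d n. f (Transposition.transpose x y \<circ> \<sigma>)) / ?N - f \<sigma>"
    using N n d by (simp add: case_prod_unfold sum_subtractf sum_divide_distrib[symmetric] diff_divide_distrib)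
  finally show ?thesis by (simp only: N(1))
qed

lemma filterlim_powr_at_top:
  assumes "0 < (a::real)"
  shows "filterlim (\<lambda>x. x powr a) at_top at_top"
proof -
  have "filterlim (\<lambda>x. exp (a * ln x)) at_top at_top"
    using assms by (intro filterlim_compose[OF exp_at_top] filterlim_tendsto_pos_mult_at_top[OF tendsto_const _ ln_at_top])
  moreover have "\<forall>\<^sub>F x in at_top. exp (a * ln x) = x powr a"
    using eventually_gt_at_top[of 0] by eventually_elim (simp add: powr_def)
  ultimately show ?thesis by (simp cong: filterlim_cong)
qed

definition coupling_time :: "nat \<Rightarrow> real" where
  "coupling_time N = real N powr (1 / 6)"

definition coupling_jumps :: "nat \<Rightarrow> nat" where
  "coupling_jumps N = nat \<lfloor>real N powr (1 / 3)\<rfloor>"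

text \<open>With \<open>a = N\<^bsup>1/3\<^esup>\<close> one has \<open>K \<le> a \<le> K + 1\<close>: the upper bound is used for the number of collisions and the
  lower one for the number of jumps.\<close>

lemma coupling_error_le:
  assumes "1 \<le> N"
  shows "coupling_time N / (real (coupling_jumps N) + 1) + 8 * real (coupling_jumps N) ^ 2 / real N
    \<le> real N powr (- (1 / 6)) + 8 * real N powr (- (1 / 3))"
proof (rule add_mono)
  have N: "0 < real N" using assms by simp
  define a where "a = real N powr (1 / 3)"
  have a: "0 < a" using N by (simp add: a_def)
  have K: "real (coupling_jumps N) \<le> a" "a \<le> real (coupling_jumps N) + 1"
    using a by (auto simp: coupling_jumps_def a_def[symmetric])
  have "coupling_time N / (real (coupling_jumps N) + 1) \<le> coupling_time N / a"
    using K a by (intro divide_left_mono) (auto simp: coupling_time_def)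
  also have "\<dots> = real N powr (- (1 / 6))"
    by (simp add: coupling_time_def a_def powr_diff[symmetric])
  finally show "coupling_time N / (real (coupling_jumps N) + 1) \<le> real N powr (- (1 / 6))" .
  have "real (coupling_jumps N) ^ 2 \<le> a ^ 2" using K by (intro power_mono) auto
  also have "a ^ 2 = real N powr (2 / 3)" using N by (simp add: a_def powr_powr[symmetric] power2_eq_square powr_add[symmetric])
  finally have "8 * real (coupling_jumps N) ^ 2 / real N \<le> 8 * real N powr (2 / 3) / real N"
    using N by (intro divide_right_mono) auto
  also have "\<dots> = 8 * (real N powr (2 / 3) / real N powr 1)" using N by simp
  also have "\<dots> = 8 * real N powr (- (1 / 3))" by (simp only: powr_diff[symmetric]) simp
  finally show "8 * real (coupling_jumps N) ^ 2 / real N \<le> 8 * real N powr (- (1 / 3))" .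
qed

theorem theorem1:
  fixes d :: nat
  assumes "d \<ge> 1"
  shows "\<exists>(Tstar :: nat \<Rightarrow> real)
            (M :: nat \<Rightarrow> (nat \<Rightarrow> real) measure)
            (\<eta> :: nat \<Rightarrow> real \<Rightarrow> (nat \<Rightarrow> real) \<Rightarrow> ((nat \<Rightarrow> nat) \<Rightarrow> (nat \<Rightarrow> nat)))
            (\<zeta> :: nat \<Rightarrow> real \<Rightarrow> (nat \<Rightarrow> real) \<Rightarrow> (nat \<Rightarrow> real)).
     (\<forall>N. 0 \<le> Tstar N) \<and>
     filterlim (\<lambda>n. Tstar (n ^ d)) at_top sequentially \<and>
     (\<forall>n\<ge>3.
        stationary_markov_jump_process (M n) (perms_on (torus d n)) (stirring_gen d n)
          (uniform_count_measure (perms_on (torus d n))) (\<eta> n) \<and>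
        stationary_markov_jump_process (M n) (disc_partitions (n ^ d)) (split_merge_gen (n ^ d))
          (cycle_law (torus d n)) (\<zeta> n) \<and>
        (\<forall>\<omega>\<in>space (M n). \<zeta> n 0 \<omega> = cycle_partition (torus d n) (\<eta> n 0 \<omega>)) \<and>
        (\<lambda>\<omega>. MAX t\<in>{0..Tstar (n ^ d)}.
            l1_dist (cycle_partition (torus d n) (\<eta> n t \<omega>)) (\<zeta> n t \<omega>))
          \<in> borel_measurable (M n)) \<and>
     (\<forall>\<delta>>0.
        (\<lambda>n. \<P>(\<omega> in M n.
            (MAX t\<in>{0..Tstar (n ^ d)}.
               l1_dist (cycle_partition (torus d n) (\<eta> n t \<omega>)) (\<zeta> n t \<omega>)) > \<delta>))
          \<longlonglongrightarrow> 0)"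
proof -
  let ?T = "\<lambda>n. coupling_time (n ^ d)"
  let ?err = "\<lambda>n. real (n ^ d) powr (- (1 / 6)) + 8 * real (n ^ d) powr (- (1 / 3))"
  define P where "P n M \<eta> \<zeta> \<longleftrightarrow>
        stationary_markov_jump_process M (perms_on (torus d n)) (stirring_gen d n)
          (uniform_count_measure (perms_on (torus d n))) \<eta> \<and>
        stationary_markov_jump_process M (disc_partitions (n ^ d)) (split_merge_gen (n ^ d))
          (cycle_law (torus d n)) \<zeta> \<and>
        (\<forall>\<omega>\<in>space M. \<zeta> 0 \<omega> = cycle_partition (torus d n) (\<eta> 0 \<omega>)) \<and>
        (\<lambda>\<omega>. MAX t\<in>{0..?T n}. l1_dist (cycle_partition (torus d n) (\<eta> t \<omega>)) (\<zeta> t \<omega>)) \<in> borel_measurable M \<and>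
        (\<forall>\<delta>>0. \<P>(\<omega> in M. (MAX t\<in>{0..?T n}. l1_dist (cycle_partition (torus d n) (\<eta> t \<omega>)) (\<zeta> t \<omega>)) > \<delta>)
           \<le> ?err n)"
    for n :: nat and M :: "(nat \<Rightarrow> real) measure" and \<eta> \<zeta>
  have ex: "\<exists>M \<eta> \<zeta>. P n M \<eta> \<zeta>" if n: "3 \<le> n" for n
  proof -
    have nd: "3 \<le> n ^ d" using n assms self_le_power[of n d] by simp
    have V: "finite (torus d n)" "torus d n \<noteq> {}" "2 \<le> card (torus d n)"
      using n nd finite_torus[of d n] card_torus[of d n] by auto
    have "card (directed_edges d n) \<noteq> 0" using n assms by (simp add: card_directed_edges)
    then have E: "directed_edges d n \<noteq> {}" by auto
    have sub: "directed_edges d n \<subseteq> distinct_pairs (torus d n)" using n by (intro directed_edges_subset) simp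
    interpret coupled_walks "torus d n" "directed_edges d n" "distinct_pairs (torus d n)"
      by unfold_locales (use V E sub in auto)
    obtain M :: "(nat \<Rightarrow> real) measure" and \<eta> \<zeta> where M:
      "stationary_markov_jump_process M (perms_on (torus d n)) (stirring_gen d n)
          (uniform_count_measure (perms_on (torus d n))) \<eta>"
      "stationary_markov_jump_process M (disc_partitions (card (torus d n))) (split_merge_gen (card (torus d n)))
          (cycle_law (torus d n)) \<zeta>"
      "\<forall>\<omega>\<in>space M. \<zeta> 0 \<omega> = cycle_partition (torus d n) (\<eta> 0 \<omega>)"
      "(\<lambda>\<omega>. MAX t\<in>{0..?T n}. l1_dist (cycle_partition (torus d n) (\<eta> t \<omega>)) (\<zeta> t \<omega>)) \<in> borel_measurable M"
      "\<forall>\<delta>>0. \<P>(\<omega> in M. (MAX t\<in>{0..?T n}. l1_dist (cycle_partition (torus d n) (\<eta> t \<omega>)) (\<zeta> t \<omega>)) > \<delta>)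
         \<le> ?T n / (real (coupling_jumps (n ^ d)) + 1) + 8 * real (coupling_jumps (n ^ d)) ^ 2 / real (card (torus d n))"
      using coupling_exists[OF V(3) refl balanced_directed_edges, of "?T n" "stirring_gen d n" "coupling_jumps (n ^ d)"]
        n assms stirring_gen_directed_edges by (auto simp: coupling_time_def)
    have "?T n / (real (coupling_jumps (n ^ d)) + 1) + 8 * real (coupling_jumps (n ^ d)) ^ 2 / real (card (torus d n)) \<le> ?err n"
      unfolding card_torus using nd by (intro coupling_error_le) simp
    then have "P n M \<eta> \<zeta>"
      unfolding P_def using M(1,3,4) M(2)[unfolded card_torus] M(5) by (meson order_trans)
    then show ?thesis by blast
  qed
  then obtain M \<eta> \<zeta> where M: "\<And>n. 3 \<le> n \<Longrightarrow> P n (M n) (\<eta> n) (\<zeta> n)" by metis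
  have nd: "filterlim (\<lambda>n. real (n ^ d)) at_top sequentially"
    unfolding of_nat_power using assms
    by (intro filterlim_pow_at_top filterlim_real_sequentially) simp
  show ?thesis
  proof (intro exI conjI allI impI)
    show "0 \<le> coupling_time N" for N by (simp add: coupling_time_def)
    show "filterlim ?T at_top sequentially"
      unfolding coupling_time_def by (rule filterlim_compose[OF filterlim_powr_at_top nd]) simp
    fix n :: nat assume "3 \<le> n"
    from M[OF this] show
      "stationary_markov_jump_process (M n) (perms_on (torus d n)) (stirring_gen d n)
          (uniform_count_measure (perms_on (torus d n))) (\<eta> n)"
      "stationary_markov_jump_process (M n) (disc_partitions (n ^ d)) (split_merge_gen (n ^ d))
          (cycle_law (torus d n)) (\<zeta> n)"
      "\<forall>\<omega>\<in>space (M n). \<zeta> n 0 \<omega> = cycle_partition (torus d n) (\<eta> n 0 \<omega>)"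
      "(\<lambda>\<omega>. MAX t\<in>{0..?T n}. l1_dist (cycle_partition (torus d n) (\<eta> n t \<omega>)) (\<zeta> n t \<omega>)) \<in> borel_measurable (M n)"
      unfolding P_def by blast+
  next
    fix \<delta> :: real assume \<delta>: "0 < \<delta>"
    let ?p = "\<lambda>n. \<P>(\<omega> in M n. (MAX t\<in>{0..?T n}. l1_dist (cycle_partition (torus d n) (\<eta> n t \<omega>)) (\<zeta> n t \<omega>)) > \<delta>)"
    have "(\<lambda>n. real (n ^ d) powr (- (1 / 6))) \<longlonglongrightarrow> 0" "(\<lambda>n. real (n ^ d) powr (- (1 / 3))) \<longlonglongrightarrow> 0"
      by (rule tendsto_neg_powr[OF _ nd], simp)+
    from tendsto_add[OF this(1) tendsto_mult[OF tendsto_const[of 8] this(2)]]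
    have err: "?err \<longlonglongrightarrow> 0" by simp
    show "?p \<longlonglongrightarrow> 0"
    proof (rule tendsto_sandwich[OF _ _ tendsto_const err])
      show "\<forall>\<^sub>F n in sequentially. 0 \<le> ?p n" by simp
      show "\<forall>\<^sub>F n in sequentially. ?p n \<le> ?err n"
        using eventually_ge_at_top[of 3]
      proof eventually_elim
        case (elim n)
        then show ?case using M[OF elim] \<delta> unfolding P_def by blast
      qed
    qed
  qed
qed

end
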